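(* Let $s\le d$ be positive integers. Suppose $K$ is a closed $C^{(1,1)}$ $s$-dimensional embedded submanifold of $\mathbb R^d$; i.e., $0<\mathcal H_s(K)<\infty$ and, for any embedding $\varphi$, all its first partial derivatives exist and are uniformly Lipschitz. Then $K$ is an asymptotically flat $s$-regular manifold, and thus for $X_N$ a set of $N$ points independently and randomly distributed over $K$ with respect to $\mathrm d\mu=\mathbf 1_K\cdot\mathrm d\mathcal H_s/\mathcal H_s(K)$ and any $p\geq1$, $$\lim_{N\to\infty}\mathbb E[\rho(X_N,K)^p]\cdot\left[\frac{N}{\log N}\right]^{p/s}=\left(\frac{\mathcal H_s(K)}{\upsilon_s}\right)^{p/s}.$$ In particular, if $K=\mathbb S^d$ is the unit sphere in $\mathbb R^{d+1}$ (with $X_N$ distributed with respect to normalized $\mathcal H_d$ on $\mathbb S^d$) and $p\geq1$, then $$\lim_{N\to\infty}\mathbb E[\rho(X_N,\mathbb S^d)^p]\cdot\left[\frac{N}{\log N}\right]^{p/d}=\left(\frac{(d+1)\upsilon_{d+1}}{\upsilon_d}\right)^{p/d}=\left(2\sqrt\pi\,\frac{\Gamma(\frac{d+2}{2})}{\Gamma(\frac{d+1}{2})}\right)^{p/d}.$$ Thus, in particular (the case $p=1$), $\lim_{N\to\infty}\mathbb E\rho(X_N,\mathbb S^d)\cdot[N/\log N]^{1/d}=\left((d+1)\upsilon_{d+1}/\upsilon_d\right)^{1/d}$.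
   Context: $\mathcal H_s$ is $s$-dimensional Hausdorff measure (Euclidean metric), normalized by $\mathcal H_s([0,1]^s)=1$; $\upsilon_s=\pi^{s/2}/\Gamma(1+s/2)$ is the volume of the unit ball in $\mathbb R^s$; $B_d(x,r)$ is the closed Euclidean ball in $\mathbb R^d$. The covering radius is $\rho(X_N,K):=\sup_{y\in K}\min_j|y-x_j|$ with Euclidean distance of the ambient space. A closed manifold is a compact manifold without boundary; embeddings here are the local parametrizations of $K$. A compact $s$-dimensional set $K\subset\mathbb R^d$ is asymptotically flat $s$-regular if $r^{-s}\mathcal H_s(B_d(x,r)\cap K)\to\upsilon_s$ as $r\to0^+$, uniformly in $x\in K$. *)

theory Defs
  imports "HOL-Analysis.Analysis"
begin

definition hausdorff_pre :: "nat \<Rightarrow> real \<Rightarrow> 'a::metric_space set \<Rightarrow> ennreal" where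
  "hausdorff_pre s \<delta> A =
     (INF E \<in> {E :: nat \<Rightarrow> 'a set. A \<subseteq> (\<Union>i. E i) \<and> (\<forall>i. bounded (E i) \<and> diameter (E i) \<le> \<delta>)}.
        \<Sum>i. ennreal (diameter (E i) ^ s))"

text \<open>Boundedness is required because \<^const>\<open>diameter\<close> is unspecified on unbounded sets.
  For \<open>s = 0\<close> the convention \<open>0 ^ 0 = 1\<close> would also count empty covering sets; only
  \<open>s > 0\<close> is used below.\<close>

definition hausdorff_outer :: "nat \<Rightarrow> 'a::metric_space set \<Rightarrow> ennreal" where
  "hausdorff_outer s A = (SUP \<delta> \<in> {0<..}. hausdorff_pre s \<delta> A)"

text \<open>The measure \<open>\<H>\<^sub>s\<close> with \<open>s = CARD('s)\<close>, normalized so that the unit cube \<open>[0,1]\<^sup>s\<close>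
  of \<open>real ^ 's\<close> has measure one. It is the restriction of the (metric) outer measure to the
  Borel sets, on which the latter is countably additive by Caratheodory's criterion.\<close>

definition hausdorff :: "'s::finite itself \<Rightarrow> 'a::metric_space measure" where
  "hausdorff _ = measure_of UNIV (sets borel)
     (\<lambda>A. hausdorff_outer CARD('s) A / hausdorff_outer CARD('s) (cbox 0 1 :: (real ^ 's) set))"

text \<open>\<open>D i\<close> is the \<open>i\<close>-th partial derivative of the parametrization \<open>\<phi>\<close>, defined on the open
  set \<open>W\<close>. The last condition says that the Jacobian of \<open>\<phi>\<close> has full rank, which together with
  the homeomorphism condition makes \<open>\<phi>\<close> an embedding.\<close>

definition C11_local_parametrization ::
    "(real ^ 'd) set \<Rightarrow> (real ^ 's) set \<Rightarrow> (real ^ 's \<Rightarrow> real ^ 'd) \<Rightarrow> bool" where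
  "C11_local_parametrization K W \<phi> \<longleftrightarrow>
     open W \<and> openin (top_of_set K) (\<phi> ` W) \<and> (\<exists>\<psi>. homeomorphism W (\<phi> ` W) \<phi> \<psi>) \<and>
     (\<exists>D :: 's \<Rightarrow> real ^ 's \<Rightarrow> real ^ 'd.
        (\<forall>i. \<forall>u\<in>W. ((\<lambda>t. \<phi> (u + t *\<^sub>R axis i 1)) has_vector_derivative D i u) (at 0)) \<and>
        (\<exists>L. \<forall>i. L-lipschitz_on W (D i)) \<and>
        (\<forall>u\<in>W. inj (\<lambda>v :: real ^ 's. \<Sum>i\<in>UNIV. v $ i *\<^sub>R D i u)))"

definition closed_C11_submanifold :: "'s::finite itself \<Rightarrow> (real ^ 'd) set \<Rightarrow> bool" where
  "closed_C11_submanifold S K \<longleftrightarrow>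
     compact K \<and> 0 < emeasure (hausdorff S) K \<and> emeasure (hausdorff S) K < \<infinity> \<and>
     (\<forall>x\<in>K. \<exists>(W :: (real ^ 's) set) \<phi>. C11_local_parametrization K W \<phi> \<and> x \<in> \<phi> ` W)"

text \<open>That the compact set \<open>K\<close> is \<open>s\<close>-dimensional is taken to mean \<open>0 < \<H>\<^sub>s(K) < \<infinity>\<close>
  (so its Hausdorff dimension is \<open>s\<close>).\<close>

definition asymptotically_flat_regular :: "'s::finite itself \<Rightarrow> (real ^ 'd) set \<Rightarrow> bool" where
  "asymptotically_flat_regular S K \<longleftrightarrow>
     compact K \<and> 0 < emeasure (hausdorff S) K \<and> emeasure (hausdorff S) K < \<infinity> \<and>
     uniform_limit K
       (\<lambda>r x. measure (hausdorff S) (cball x r \<inter> K) / r ^ CARD('s))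
       (\<lambda>_. unit_ball_vol (real CARD('s))) (at_right 0)"

definition covering_radius :: "'a::metric_space set \<Rightarrow> 'a set \<Rightarrow> real" where
  "covering_radius X K = (SUP y\<in>K. MIN x\<in>X. dist y x)"

text \<open>The expectation of \<open>\<rho>(X\<^sub>N, K)\<^sup>p\<close> for \<open>N\<close> independent points with common law
  \<open>1\<^sub>K d\<H>\<^sub>s / \<H>\<^sub>s(K)\<close>, realized as the coordinates of the product probability space.\<close>

definition expected_covering_radius_powr ::
    "'s::finite itself \<Rightarrow> 'a::metric_space set \<Rightarrow> real \<Rightarrow> nat \<Rightarrow> real" where
  "expected_covering_radius_powr S K p N =
     (\<integral>\<omega>. covering_radius (\<omega> ` {..<N}) K powr p
        \<partial>(\<Pi>\<^sub>M i\<in>{..<N}. uniform_measure (hausdorff S) K))"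

end

theory Submission
  imports Defs "HOL-Probability.Probability" "HOL-Real_Asymp.Real_Asymp"
begin

text \<open>
The theorem combines two facts. A compact $C^1$ submanifold looks Euclidean at small scales,
uniformly in the base point. And for every probability measure with that property, the covering
radius of a random sample is decided by a coupon collector threshold.

\<^bold>\<open>Hausdorff measure.\<close> The outer measure \<^const>\<open>hausdorff_outer\<close> is additive on sets at positive
distance, so by Caratheodory's criterion it is a measure on the Borel sets. On \<open>\<real>\<^sup>s\<close> it is
translation invariant, and the normalization makes it equal to Lebesgue measure
(\<open>hausdorff_eq_lborel\<close>). As an \<open>L\<close>-Lipschitz map increases it at most by the factor \<open>L\<^sup>s\<close>, the image
of a Euclidean ball under an almost isometric map has almost the volume of that ball.

\<^bold>\<open>Flatness.\<close> Since the partial derivatives of a chart are continuous, the chart is close to its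
linearization near each point. Composing it with the linear map that turns the linearization into
an isometry gives a parametrization that distorts distances by a factor between \<open>1 - e\<close> and \<open>1 + e\<close>
(\<open>C11_chart_almost_isometry\<close>). Hence \<open>K \<inter> cball x r\<close> lies between the images of two balls whose
radii are close to \<open>r\<close>, and compactness makes the estimate uniform (\<open>C11_asymptotically_flat\<close>).

\<^bold>\<open>Probability.\<close> Let the balls of radius \<open>r\<close> around points of \<open>K\<close> have mass about \<open>c r\<^sup>s\<close>, and choose
\<open>r\<close> with \<open>N c r\<^sup>s = \<alpha> ln N\<close>. A given ball is missed by all \<open>N\<close> points with probability about
\<open>N\<close> to the power \<open>-\<alpha>\<close>, and about \<open>N / ln N\<close> balls of that size matter. For \<open>\<alpha> > 1\<close> a union bound
over a fine net shows that most likely no ball is missed (\<open>\<rho>_upper_tail\<close>). For \<open>\<alpha> < 1\<close> the expected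
number of missed balls in a packing tends to infinity, and a second moment estimate shows that most
likely one of them is missed (\<open>\<rho>_lower_tail\<close>). So the covering radius concentrates at the value of
\<open>r\<close> for \<open>\<alpha> = 1\<close>. For large \<open>\<alpha>\<close> the upper tail is below any given power of \<open>N\<close>, so the
diameter of \<open>K\<close> is a sufficient bound there, and the \<open>p\<close>-th moments converge as well
 (\<open>moment_asymptotics\<close>).

\<^bold>\<open>The sphere.\<close> Graphs over tangent hyperplanes are charts of the sphere. For its area, note that two
finite measures on the same set have proportional total masses if the masses of their small balls
are uniformly proportional, by Fubini's theorem (\<open>ball_density_mass_le\<close>). Hausdorff measure is
compared in this way with the radial projection of Lebesgue measure on the unit ball, whose caps lie
between two cones of known volume (\<open>cone_measure_cap_bounds\<close>).
\<close>

section \<open>Caratheodory's criterion for metric outer measures\<close>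

text \<open>The part of \<open>A\<close> outside \<open>C\<close> is exhausted by the sets \<open>D n\<close> of points at distance at least
\<open>1 / (n + 1)\<close> from \<open>C\<close>, and \<open>f\<close> is additive on \<open>D n\<close> and \<open>A \<inter> C\<close>. The shells \<open>R n\<close> between consecutive \<open>D n\<close>
have positive distance from each other when their indices have the same parity, so the sums over even
and over odd indices are at most \<open>f A\<close>. Therefore the full series converges, and its tail bounds the
difference between \<open>f (A - C)\<close> and \<open>f (D n)\<close>.\<close>

lemma metric_outer_measure_closed:
  fixes f :: "'a::metric_space set \<Rightarrow> ennreal"
  assumes oms: "outer_measure_space UNIV f"
    and metric: "\<And>A B e. 0 < e \<Longrightarrow> (\<And>x y. x \<in> A \<Longrightarrow> y \<in> B \<Longrightarrow> e \<le> dist x y) \<Longrightarrow>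
      f A + f B \<le> f (A \<union> B)"
    and "closed C"
  shows "f (A \<inter> C) + f (A - C) \<le> f A"
proof (cases "f A = \<infinity>")
  case True
  then show ?thesis by simp
next
  case False
  from oms have pos: "f {} = 0" and mono: "\<And>X Y. X \<subseteq> Y \<Longrightarrow> f X \<le> f Y"
    and csub: "countably_subadditive UNIV f"
    by (auto simp: outer_measure_space_def positive_def increasing_def)
  have sub: "f (X \<union> Y) \<le> f X + f Y" for X Y
  proof -
    have "subadditive UNIV f"
      using ring_of_sets.countably_subadditive_subadditive[OF _ _ csub] oms ring_of_sets_Pow[of "UNIV :: 'a set"]
      by (simp add: outer_measure_space_def)
    then have "f (X \<union> (Y - X)) \<le> f X + f (Y - X)"
      unfolding subadditive_def by blast
    also have "\<dots> \<le> f X + f Y" by (intro add_left_mono mono) auto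
    finally show ?thesis by simp
  qed
  define D where "D n = {x \<in> A. \<forall>y\<in>C. 1 / real (Suc n) \<le> dist x y}" for n
  define R where "R n = D (Suc n) - D n" for n
  \<comment> \<open>a point of \<open>A\<close> outside \<open>D (Suc m)\<close> is closer to \<open>C\<close> than \<open>1 / (m + 2)\<close>\<close>
  have gap: "f E + f F \<le> f (E \<union> F)" if "E \<subseteq> D m" "F \<inter> D (Suc m) = {}" "F \<subseteq> A" for E F m
  proof (rule metric[of "1 / real (Suc m) - 1 / real (Suc (Suc m))"])
    fix x z assume "x \<in> E" "z \<in> F"
    then have "z \<in> A" "z \<notin> D (Suc m)" using that by auto
    then obtain y where y: "y \<in> C" "dist z y < 1 / real (Suc (Suc m))"
      unfolding D_def by (auto simp: not_le)
    have "1 / real (Suc m) \<le> dist x y"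
      using \<open>x \<in> E\<close> that y by (auto simp: D_def)
    then show "1 / real (Suc m) - 1 / real (Suc (Suc m)) \<le> dist x z"
      using y dist_triangle[of x y z] by linarith
  qed (simp add: frac_less2)
  have Dmono: "D i \<subseteq> D j" if "i \<le> j" for i j
  proof -
    have "1 / real (Suc j) \<le> 1 / real (Suc i)"
      using that by (simp add: frac_le)
    then show ?thesis unfolding D_def by force
  qed
  \<comment> \<open>the parameter \<open>b\<close> selects the even (\<open>0\<close>) or the odd (\<open>1\<close>) shells\<close>
  have parity: "(\<Sum>k<n. f (R (2 * k + b))) \<le> f (\<Union>k<n. R (2 * k + b))" for n b
  proof (induction n)
    case 0
    then show ?case by simp
  next
    case (Suc n)
    have step: "f (\<Union>k<n. R (2 * k + b)) + f (R (2 * n + b)) \<le> f ((\<Union>k<n. R (2 * k + b)) \<union> R (2 * n + b))"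
    proof (cases "n = 0")
      case True
      then show ?thesis using pos by simp
    next
      case False
      show ?thesis
      proof (rule gap[where m = "2 * n + b - 1"])
        show "(\<Union>k<n. R (2 * k + b)) \<subseteq> D (2 * n + b - 1)"
        proof
          fix x assume "x \<in> (\<Union>k<n. R (2 * k + b))"
          then obtain k where "k < n" "x \<in> D (Suc (2 * k + b))" by (auto simp: R_def)
          moreover have "Suc (2 * k + b) \<le> 2 * n + b - 1" using \<open>k < n\<close> by linarith
          ultimately show "x \<in> D (2 * n + b - 1)"
            using Dmono by blast
        qed
        have "Suc (2 * n + b - 1) = 2 * n + b" using False by linarith
        then show "R (2 * n + b) \<inter> D (Suc (2 * n + b - 1)) = {}"
          unfolding R_def by (simp only:) blast
        show "R (2 * n + b) \<subseteq> A" by (auto simp: R_def D_def)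
      qed
    qed
    have U: "(\<Union>k<Suc n. R (2 * k + b)) = (\<Union>k<n. R (2 * k + b)) \<union> R (2 * n + b)"
      unfolding lessThan_Suc by blast
    have S: "(\<Sum>k<Suc n. f (R (2 * k + b))) \<le> f (\<Union>k<n. R (2 * k + b)) + f (R (2 * n + b))"
      unfolding sum.lessThan_Suc by (rule add_right_mono[OF Suc])
    show ?case
      unfolding U by (rule order_trans[OF S step])
  qed
  have RA: "(\<Union>k<n. R (2 * k + b)) \<subseteq> A" for n b
    unfolding R_def D_def by blast
  have "(\<Sum>k<n. f (R k)) \<le> 2 * f A" for n
  proof -
    have "(\<Sum>k<n. f (R k)) \<le> (\<Sum>k<2*n. f (R k))"
      by (rule sum_mono2) auto
    also have "\<dots> = (\<Sum>k<n. f (R (2 * k + 0))) + (\<Sum>k<n. f (R (2 * k + 1)))"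
      by (induction n) (auto simp: algebra_simps)
    also have "\<dots> \<le> f A + f A"
      using parity[of 0 n] parity[of 1 n] mono[OF RA[of 0 n]] mono[OF RA[of 1 n]]
      by (meson add_mono order_trans)
    finally show ?thesis by (simp add: mult_2)
  qed
  then have "(\<Sum>k. f (R k)) \<le> 2 * f A"
    by (intro suminf_le_const) auto
  then have fin: "(\<Sum>k. f (R k)) < top"
    using False by (metis ennreal_mult_less_top ennreal_numeral_less_top infinity_ennreal_def
        le_less_trans less_top)
  then have fR: "f (R k) < top" for k
    by (rule ennreal_suminf_lessD)
  define g where "g k = enn2real (f (R k))" for k
  have fg: "f (R k) = ennreal (g k)" for k
    using fR[of k] by (simp add: g_def less_top)
  have g0: "0 \<le> g k" for k by (simp add: g_def)
  have sg: "summable g"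
    using fin fg g0 by (intro summable_suminf_not_top) auto
  have bound: "f (A \<inter> C) + f (A - C) \<le> f A + ennreal (\<Sum>k. g (k + n))" for n
  proof -
    have "A - C \<subseteq> D n \<union> (\<Union>k. R (k + n))"
    proof
      fix x assume x: "x \<in> A - C"
      obtain e where e: "0 < e" "ball x e \<subseteq> - C"
        using x \<open>closed C\<close> by (metis ComplI DiffD2 open_Compl open_contains_ball)
      obtain j where "1 / real (Suc j) < e"
        using reals_Archimedean[OF e(1)] by (auto simp: inverse_eq_divide)
      moreover have "e \<le> dist x y" if "y \<in> C" for y
        using e that by (meson ComplD linorder_not_le mem_ball subsetD)
      ultimately have "\<exists>j. x \<in> D j"
        unfolding D_def using x by (intro exI[of _ j]) force
      then have j: "x \<in> D (LEAST j. x \<in> D j)" "\<And>i. x \<in> D i \<Longrightarrow> (LEAST j. x \<in> D j) \<le> i"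
        by (auto intro: LeastI Least_le)
      define m where "m = (LEAST j. x \<in> D j)"
      show "x \<in> D n \<union> (\<Union>k. R (k + n))"
      proof (cases "m \<le> n")
        case True
        then show ?thesis using j Dmono m_def by auto
      next
        case False
        then obtain k where k: "m = Suc (k + n)"
          by (metis add.commute less_imp_Suc_add not_le)
        then have "x \<in> R (k + n)"
          unfolding R_def using j m_def
          by (metis DiffI Suc_n_not_le_n)
        then show ?thesis by blast
      qed
    qed
    then have "f (A - C) \<le> f (D n \<union> (\<Union>k. R (k + n)))" by (rule mono)
    also have "\<dots> \<le> f (D n) + f (\<Union>k. R (k + n))" by (rule sub)
    also have "f (\<Union>k. R (k + n)) \<le> (\<Sum>k. f (R (k + n)))"
    proof -
      have "disjoint_family (\<lambda>k. R (k + n))"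
      proof -
        have "R i \<inter> R j = {}" if "i < j" for i j
          using Dmono[of "Suc i" j] that by (auto simp: R_def)
        then show ?thesis
          unfolding disjoint_family_on_def
          by (metis Int_commute add_right_cancel linorder_neqE_nat)
      qed
      then show ?thesis
        using csub by (simp add: countably_subadditive_def)
    qed
    also have "(\<Sum>k. f (R (k + n))) = ennreal (\<Sum>k. g (k + n))"
      unfolding fg using sg g0 by (intro suminf_ennreal2) (auto simp: summable_iff_shift)
    finally have 1: "f (A - C) \<le> f (D n) + ennreal (\<Sum>k. g (k + n))"
      by (simp add: add_left_mono)
    have "f (D n) + f (A \<inter> C) \<le> f (D n \<union> (A \<inter> C))"
      by (rule metric[of "1 / real (Suc n)"]) (auto simp: D_def)
    also have "\<dots> \<le> f A" by (rule mono) (auto simp: D_def)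
    finally have 2: "f (D n) + f (A \<inter> C) \<le> f A" .
    have "f (A \<inter> C) + f (A - C) \<le> (f (D n) + f (A \<inter> C)) + ennreal (\<Sum>k. g (k + n))"
      using add_left_mono[OF 1, of "f (A \<inter> C)"] by (simp add: ac_simps)
    also have "\<dots> \<le> f A + ennreal (\<Sum>k. g (k + n))"
      by (rule add_right_mono[OF 2])
    finally show ?thesis .
  qed
  have "(\<lambda>n. f A + ennreal (\<Sum>k. g (k + n))) \<longlonglongrightarrow> f A + ennreal 0"
    by (intro tendsto_add tendsto_const tendsto_ennrealI suminf_exist_split2 sg)
  then show ?thesis
    using bound by (metis (no_types, lifting) LIMSEQ_le_const add.right_neutral ennreal_0)
qed

lemma metric_outer_measure_borel:
  fixes f :: "'a::metric_space set \<Rightarrow> ennreal"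
  assumes oms: "outer_measure_space UNIV f"
    and metric: "\<And>A B e. 0 < e \<Longrightarrow> (\<And>x y. x \<in> A \<Longrightarrow> y \<in> B \<Longrightarrow> e \<le> dist x y) \<Longrightarrow>
      f A + f B \<le> f (A \<union> B)"
  shows "measure_space UNIV (sets borel) f"
proof -
  interpret P: sigma_algebra "UNIV :: 'a set" "UNIV :: 'a set set"
    using sigma_algebra_Pow[of "UNIV :: 'a set"] by simp
  let ?L = "lambda_system UNIV UNIV f"
  have ms: "measure_space UNIV ?L f"
    using P.caratheodory_lemma[OF oms] .
  then interpret L: sigma_algebra UNIV ?L
    by (simp add: measure_space_def)
  have pos: "f {} = 0" and csub: "countably_subadditive UNIV f"
    using oms by (auto simp: outer_measure_space_def positive_def)
  have sub: "f (X \<union> Y) \<le> f X + f Y" if "X \<inter> Y = {}" for X Y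
    using P.countably_subadditive_subadditive[OF _ csub] oms that
    by (simp add: outer_measure_space_def subadditive_def)
  have "C \<in> ?L" if "closed C" for C
  proof -
    have "f (A \<inter> C) + f (A - C) = f A" for A
    proof (rule antisym)
      show "f (A \<inter> C) + f (A - C) \<le> f A"
        by (rule metric_outer_measure_closed[OF oms metric that])
      show "f A \<le> f (A \<inter> C) + f (A - C)"
        using sub[of "A \<inter> C" "A - C"] by (simp add: Int_Diff_Un Int_Diff_disjoint)
    qed
    then show ?thesis by (simp add: P.lambda_system_eq)
  qed
  then have "Collect closed \<subseteq> ?L" by auto
  then have "sigma_sets UNIV (Collect closed) \<subseteq> ?L"
    by (rule L.sigma_sets_subset)
  then have "sets borel \<subseteq> ?L"
    unfolding borel_eq_closed by simp
  then have "countably_additive (sets borel) f"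
    using ms unfolding countably_additive_def measure_space_def by blast
  then show ?thesis
    using pos sets.sigma_algebra_axioms[of "borel :: 'a measure"]
    by (simp add: measure_space_def positive_def)
qed

section \<open>Hausdorff measure\<close>

lemma hausdorff_pre_lower:
  assumes "A \<subseteq> (\<Union>i. E i)" "\<And>i. bounded (E i)" "\<And>i. diameter (E i) \<le> \<delta>"
  shows "hausdorff_pre s \<delta> A \<le> (\<Sum>i. ennreal (diameter (E i) ^ s))"
  unfolding hausdorff_pre_def using assms by (intro INF_lower) auto

lemma hausdorff_pre_antimono:
  "\<delta> \<le> \<delta>' \<Longrightarrow> hausdorff_pre s \<delta>' A \<le> hausdorff_pre s \<delta> A"
  unfolding hausdorff_pre_def by (intro INF_superset_mono) (auto intro: order_trans)

lemma hausdorff_pre_mono: "A \<subseteq> B \<Longrightarrow> hausdorff_pre s \<delta> A \<le> hausdorff_pre s \<delta> B"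
  unfolding hausdorff_pre_def by (intro INF_superset_mono) auto

lemma hausdorff_pre_le_outer: "0 < \<delta> \<Longrightarrow> hausdorff_pre s \<delta> A \<le> hausdorff_outer s A"
  unfolding hausdorff_outer_def by (intro SUP_upper) auto

lemma hausdorff_pre_close:
  assumes "hausdorff_pre s \<delta> A < c"
  obtains E where "A \<subseteq> (\<Union>i. E i)" "\<And>i. bounded (E i)" "\<And>i. diameter (E i) \<le> \<delta>"
    "(\<Sum>i. ennreal (diameter (E i) ^ s)) < c"
  using assms unfolding hausdorff_pre_def INF_less_iff by auto

lemma hausdorff_pre_countably_subadditive:
  "hausdorff_pre s \<delta> (\<Union>n. A n) \<le> (\<Sum>n. hausdorff_pre s \<delta> (A n))"
proof (rule ennreal_le_epsilon)
  fix e :: real assume "0 < e" "(\<Sum>n. hausdorff_pre s \<delta> (A n)) < top"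
  then have *: "hausdorff_pre s \<delta> (A n) < hausdorff_pre s \<delta> (A n) + e * (1/2)^Suc n" for n
    by (auto simp add: less_top dest!: ennreal_suminf_lessD)
  have "\<forall>n. \<exists>E. A n \<subseteq> (\<Union>i. E i) \<and> (\<forall>i. bounded (E i)) \<and> (\<forall>i. diameter (E i) \<le> \<delta>) \<and>
      (\<Sum>i. ennreal (diameter (E i) ^ s)) < hausdorff_pre s \<delta> (A n) + e * (1/2)^Suc n"
    using hausdorff_pre_close[OF *] by metis
  then obtain B where B: "\<And>n. A n \<subseteq> (\<Union>i. B n i)" "\<And>n i. bounded (B n i)"
      "\<And>n i. diameter (B n i) \<le> \<delta>"
      "\<And>n. (\<Sum>i. ennreal (diameter (B n i) ^ s)) < hausdorff_pre s \<delta> (A n) + e * (1/2)^Suc n"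
    by metis
  define C where "C = case_prod B o prod_decode"
  have "(\<Union>n. A n) \<subseteq> (\<Union>i. C i)"
    using B(1) by (auto simp add: C_def subset_eq) (metis prod.case prod_encode_inverse)
  then have "hausdorff_pre s \<delta> (\<Union>n. A n) \<le> (\<Sum>i. ennreal (diameter (C i) ^ s))"
    using B by (intro hausdorff_pre_lower) (auto simp: C_def split: prod.split)
  also have "\<dots> = (\<Sum>n. \<Sum>i. ennreal (diameter (B n i) ^ s))"
    using suminf_ennreal_2dimen[of "\<lambda>n. \<Sum>i. ennreal (diameter (B n i) ^ s)"
        "\<lambda>p. ennreal (diameter (case_prod B p) ^ s)"]
    by (simp add: C_def comp_def)
  also have "\<dots> \<le> (\<Sum>n. hausdorff_pre s \<delta> (A n) + e * (1/2) ^ Suc n)"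
    using B(4) by (intro suminf_le) (auto intro: less_imp_le)
  also have "... = (\<Sum>n. hausdorff_pre s \<delta> (A n)) + (\<Sum>n. ennreal e * ennreal ((1/2) ^ Suc n))"
    using \<open>0 < e\<close> by (subst suminf_add[symmetric])
                     (auto simp del: ennreal_suminf_cmult simp add: ennreal_mult[symmetric])
  also have "\<dots> = (\<Sum>n. hausdorff_pre s \<delta> (A n)) + e"
    unfolding ennreal_suminf_cmult
    by (subst suminf_ennreal_eq[OF zero_le_power power_half_series]) auto
  finally show "hausdorff_pre s \<delta> (\<Union>n. A n) \<le> (\<Sum>n. hausdorff_pre s \<delta> (A n)) + e" .
qed

lemma hausdorff_outer_mono: "A \<subseteq> B \<Longrightarrow> hausdorff_outer s A \<le> hausdorff_outer s B"
  unfolding hausdorff_outer_def by (intro SUP_mono) (auto intro: hausdorff_pre_mono)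

lemma hausdorff_outer_countably_subadditive:
  "hausdorff_outer s (\<Union>n. A n) \<le> (\<Sum>n. hausdorff_outer s (A n))"
  unfolding hausdorff_outer_def[of s "\<Union>n. A n"]
proof (rule SUP_least)
  fix \<delta> :: real assume "\<delta> \<in> {0<..}"
  then show "hausdorff_pre s \<delta> (\<Union>n. A n) \<le> (\<Sum>n. hausdorff_outer s (A n))"
    by (intro order_trans[OF hausdorff_pre_countably_subadditive] suminf_le)
       (auto intro: hausdorff_pre_le_outer)
qed

lemma hausdorff_outer_empty:
  assumes "0 < s" shows "hausdorff_outer s ({} :: 'a::metric_space set) = 0"
proof -
  have "hausdorff_pre s \<delta> ({} :: 'a set) \<le> 0" if "0 < \<delta>" for \<delta>
  proof -
    have "hausdorff_pre s \<delta> ({} :: 'a set) \<le> (\<Sum>i::nat. ennreal (diameter ({} :: 'a set) ^ s))"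
      using that by (intro hausdorff_pre_lower) auto
    then show ?thesis using assms by (simp add: zero_power)
  qed
  then have "hausdorff_outer s ({} :: 'a set) \<le> 0"
    unfolding hausdorff_outer_def by (intro SUP_least) auto
  then show ?thesis by simp
qed

lemma hausdorff_outer_space:
  assumes "0 < s" shows "outer_measure_space UNIV (hausdorff_outer s)"
  unfolding outer_measure_space_def positive_def increasing_def countably_subadditive_def
  using hausdorff_outer_empty[OF assms] hausdorff_outer_mono hausdorff_outer_countably_subadditive
  by blast

text \<open>No set of diameter below \<open>e\<close> meets both \<open>A\<close> and \<open>B\<close>, so every fine cover of the union splits
into a cover of \<open>A\<close> and a cover of \<open>B\<close>.\<close>

lemma hausdorff_pre_separated:
  assumes "0 < s" and sep: "\<And>x y. x \<in> A \<Longrightarrow> y \<in> B \<Longrightarrow> e \<le> dist x y" and "\<delta> < e"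
  shows "hausdorff_pre s \<delta> A + hausdorff_pre s \<delta> B \<le> hausdorff_pre s \<delta> (A \<union> B)"
  unfolding hausdorff_pre_def[of s \<delta> "A \<union> B"]
proof (rule INF_greatest, clarify)
  fix E :: "nat \<Rightarrow> 'a set"
  assume AB: "A \<union> B \<subseteq> (\<Union>i. E i)" and E: "\<forall>i. bounded (E i) \<and> diameter (E i) \<le> \<delta>"
  \<comment> \<open>for \<open>s > 0\<close> the empty sets that fill the two covers up contribute nothing\<close>
  define EA where "EA i = (if E i \<inter> A = {} then {} else E i)" for i
  define EB where "EB i = (if E i \<inter> A = {} then E i else {})" for i
  have d: "0 \<le> \<delta>" using E diameter_ge_0[of "E 0"] by (auto intro: order_trans)
  have "B \<subseteq> (\<Union>i. EB i)"
  proof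
    fix b assume b: "b \<in> B"
    then obtain i where i: "b \<in> E i" using AB by blast
    have "E i \<inter> A = {}"
    proof (rule ccontr)
      assume "E i \<inter> A \<noteq> {}"
      then obtain a where a: "a \<in> E i" "a \<in> A" by blast
      have "dist a b \<le> diameter (E i)"
        using E a i by (intro diameter_bounded_bound) auto
      then show False using sep[OF a(2) b] E \<open>\<delta> < e\<close> by (smt (verit))
    qed
    then show "b \<in> (\<Union>i. EB i)" using i by (auto simp: EB_def)
  qed
  moreover have "A \<subseteq> (\<Union>i. EA i)" using AB by (fastforce simp: EA_def)
  ultimately have "hausdorff_pre s \<delta> A + hausdorff_pre s \<delta> B \<le>
      (\<Sum>i. ennreal (diameter (EA i) ^ s)) + (\<Sum>i. ennreal (diameter (EB i) ^ s))"
    using E d by (intro add_mono hausdorff_pre_lower) (auto simp: EA_def EB_def)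
  also have "\<dots> = (\<Sum>i. ennreal (diameter (EA i) ^ s) + ennreal (diameter (EB i) ^ s))"
    by (intro suminf_add) auto
  also have "\<dots> = (\<Sum>i. ennreal (diameter (E i) ^ s))"
    using \<open>0 < s\<close> by (intro suminf_cong) (auto simp: EA_def EB_def)
  finally show "hausdorff_pre s \<delta> A + hausdorff_pre s \<delta> B \<le> (\<Sum>i. ennreal (diameter (E i) ^ s))" .
qed

lemma hausdorff_outer_separated:
  assumes "0 < s" "0 < e" and sep: "\<And>x y. x \<in> A \<Longrightarrow> y \<in> B \<Longrightarrow> e \<le> dist x y"
  shows "hausdorff_outer s A + hausdorff_outer s B \<le> hausdorff_outer s (A \<union> B)"
proof -
  have *: "hausdorff_pre s \<delta> A + hausdorff_pre s \<delta>' B \<le> hausdorff_outer s (A \<union> B)"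
    if "0 < \<delta>" "0 < \<delta>'" for \<delta> \<delta>'
  proof -
    define \<eta> where "\<eta> = min (min \<delta> \<delta>') (e / 2)"
    have \<eta>: "0 < \<eta>" "\<eta> < e" "\<eta> \<le> \<delta>" "\<eta> \<le> \<delta>'" using that assms by (auto simp: \<eta>_def)
    have "hausdorff_pre s \<delta> A + hausdorff_pre s \<delta>' B \<le> hausdorff_pre s \<eta> A + hausdorff_pre s \<eta> B"
      using \<eta> by (intro add_mono hausdorff_pre_antimono)
    also have "\<dots> \<le> hausdorff_pre s \<eta> (A \<union> B)"
      using \<eta> assms by (intro hausdorff_pre_separated)
    also have "\<dots> \<le> hausdorff_outer s (A \<union> B)"
      using \<eta> by (intro hausdorff_pre_le_outer)
    finally show ?thesis .
  qed
  have "hausdorff_outer s A + hausdorff_pre s \<delta>' B \<le> hausdorff_outer s (A \<union> B)" if "0 < \<delta>'" for \<delta>'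
    using * that unfolding hausdorff_outer_def[of s A]
    by (subst ennreal_SUP_add_left[symmetric]) (auto intro!: SUP_least)
  then show ?thesis
    unfolding hausdorff_outer_def[of s B]
    by (subst add.commute, subst ennreal_SUP_add_left[symmetric])
       (auto intro!: SUP_least simp: add.commute)
qed

lemma measure_space_hausdorff_outer:
  assumes "0 < s"
  shows "measure_space UNIV (sets borel) (hausdorff_outer s :: 'a::metric_space set \<Rightarrow> ennreal)"
  by (rule metric_outer_measure_borel[OF hausdorff_outer_space[OF assms]])
     (rule hausdorff_outer_separated[OF assms])

lemma le_mult_INF_ennreal:
  fixes x :: ennreal and a :: real
  assumes "0 < a" and le: "\<And>i. i \<in> I \<Longrightarrow> x \<le> ennreal a * f i"
  shows "x \<le> ennreal a * (INF i\<in>I. f i)"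
proof -
  have inv: "ennreal (1 / a) * (ennreal a * c) = c" "ennreal a * (ennreal (1 / a) * c) = c" for c
    using \<open>0 < a\<close> by (simp_all add: mult.assoc[symmetric] ennreal_mult[symmetric])
  have "ennreal (1 / a) * x \<le> (INF i\<in>I. f i)"
    using mult_left_mono[OF le, of _ "ennreal (1 / a)"] by (intro INF_greatest) (simp add: inv)
  then show ?thesis
    using mult_left_mono[of _ _ "ennreal a"] by (metis inv(2) zero_le)
qed

text \<open>Mapping a cover of \<open>A\<close> by \<open>f\<close> multiplies each diameter at most by \<open>L\<close>. The covering sets are
first cut down to \<open>A\<close>, as \<open>f\<close> need not be Lipschitz elsewhere.\<close>

lemma hausdorff_outer_lipschitz_image:
  fixes f :: "'a::metric_space \<Rightarrow> 'b::metric_space"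
  assumes s: "0 < s" and L: "0 < L"
    and lip: "\<And>x y. x \<in> A \<Longrightarrow> y \<in> A \<Longrightarrow> dist (f x) (f y) \<le> L * dist x y"
  shows "hausdorff_outer s (f ` A) \<le> ennreal (L ^ s) * hausdorff_outer s A"
  unfolding hausdorff_outer_def[of s "f ` A"]
proof (rule SUP_least)
  fix \<delta> :: real assume \<delta>: "\<delta> \<in> {0<..}"
  have "hausdorff_pre s \<delta> (f ` A) \<le> ennreal (L ^ s) * (\<Sum>i. ennreal (diameter (E i) ^ s))"
    if AE: "A \<subseteq> (\<Union>i. E i)" and E: "\<And>i. bounded (E i)" "\<And>i. diameter (E i) \<le> \<delta> / L" for E
  proof -
    have dist: "dist x y \<le> L * diameter (E i)" if xy: "x \<in> f ` (E i \<inter> A)" "y \<in> f ` (E i \<inter> A)" for i x y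
    proof -
      obtain u v where uv: "x = f u" "y = f v" "u \<in> E i" "v \<in> E i" "u \<in> A" "v \<in> A"
        using xy by blast
      have "dist x y \<le> L * dist u v" using lip uv by simp
      also have "\<dots> \<le> L * diameter (E i)"
        using L uv E by (intro mult_left_mono diameter_bounded_bound) auto
      finally show ?thesis .
    qed
    have bd: "bounded (f ` (E i \<inter> A))" for i
      using dist unfolding bounded_two_points by blast
    have diam: "diameter (f ` (E i \<inter> A)) \<le> L * diameter (E i)" for i
    proof (cases "E i \<inter> A = {}")
      case True
      then show ?thesis using L diameter_ge_0[OF E(1)] by simp
    next
      case False
      then show ?thesis unfolding diameter_def[of "f ` _"]
        by (auto intro!: cSUP_least dist)
    qed
    have "hausdorff_pre s \<delta> (f ` A) \<le> (\<Sum>i. ennreal (diameter (f ` (E i \<inter> A)) ^ s))"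
    proof (rule hausdorff_pre_lower)
      show "diameter (f ` (E i \<inter> A)) \<le> \<delta>" for i
        using diam[of i] E(2)[of i] L by (simp add: field_simps)
    qed (use bd AE in \<open>blast+\<close>)
    also have "\<dots> \<le> (\<Sum>i. ennreal (L ^ s) * ennreal (diameter (E i) ^ s))"
    proof (intro suminf_le)
      fix i
      have "diameter (f ` (E i \<inter> A)) ^ s \<le> (L * diameter (E i)) ^ s"
        using diam diameter_ge_0[OF bd] by (intro power_mono)
      then show "ennreal (diameter (f ` (E i \<inter> A)) ^ s) \<le> ennreal (L ^ s) * ennreal (diameter (E i) ^ s)"
        using L diameter_ge_0[OF E(1)] by (simp add: power_mult_distrib flip: ennreal_mult)
    qed auto
    finally show ?thesis by simp
  qed
  then have "hausdorff_pre s \<delta> (f ` A) \<le> ennreal (L ^ s) * hausdorff_pre s (\<delta> / L) A"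
    unfolding hausdorff_pre_def[of s "\<delta> / L"] using L by (intro le_mult_INF_ennreal) auto
  also have "\<dots> \<le> ennreal (L ^ s) * hausdorff_outer s A"
    using L \<delta> by (intro mult_left_mono hausdorff_pre_le_outer) auto
  finally show "hausdorff_pre s \<delta> (f ` A) \<le> ennreal (L ^ s) * hausdorff_outer s A" .
qed

lemma sets_hausdorff [simp, measurable_cong]: "sets (hausdorff S) = sets borel"
  by (simp add: hausdorff_def sets.sigma_sets_eq[of borel, simplified])

lemma space_hausdorff [simp]: "space (hausdorff S) = UNIV"
  using sets_eq_imp_space_eq[OF sets_hausdorff] by simp

text \<open>The measure is built with \<^const>\<open>measure_of\<close>, which gives the null measure if the set function
fails to be countably additive. So this equation is where Caratheodory's criterion is used.\<close>

lemma emeasure_hausdorff: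
  fixes A :: "'a::metric_space set"
  assumes "A \<in> sets borel"
  shows "emeasure (hausdorff TYPE('s::finite)) A =
    hausdorff_outer CARD('s) A / hausdorff_outer CARD('s) (cbox 0 1 :: (real ^ 's) set)"
proof -
  have ms: "measure_space UNIV (sets borel) (hausdorff_outer CARD('s) :: 'a set \<Rightarrow> ennreal)"
    by (rule measure_space_hausdorff_outer) simp
  show ?thesis
    unfolding hausdorff_def
  proof (rule emeasure_measure_of_sigma)
    show "sigma_algebra UNIV (sets (borel :: 'a measure))"
      using sets.sigma_algebra_axioms[of "borel :: 'a measure"] by simp
    show "positive (sets (borel :: 'a measure)) (\<lambda>A. hausdorff_outer CARD('s) A /
        hausdorff_outer CARD('s) (cbox 0 1 :: (real ^ 's) set))"
      using ms by (simp add: measure_space_def positive_def)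
    show "countably_additive (sets (borel :: 'a measure)) (\<lambda>A. hausdorff_outer CARD('s) A /
        hausdorff_outer CARD('s) (cbox 0 1 :: (real ^ 's) set))"
      using ms unfolding measure_space_def countably_additive_def ennreal_suminf_divide by simp
  qed (use assms in auto)
qed

section \<open>Nets\<close>

text \<open>A separated set injects into any finite cover by balls of half the radius, so the cardinalities of
separated sets are bounded, and a largest one is a net.\<close>

lemma compact_maximal_separated:
  fixes K :: "'a::metric_space set"
  assumes "compact K" "0 < r"
  obtains Z where "finite Z" "Z \<subseteq> K" "\<And>x y. x \<in> Z \<Longrightarrow> y \<in> Z \<Longrightarrow> x \<noteq> y \<Longrightarrow> r \<le> dist x y"
    "K \<subseteq> (\<Union>z\<in>Z. ball z r)"
proof -
  define sep where "sep Z \<longleftrightarrow> Z \<subseteq> K \<and> (\<forall>x\<in>Z. \<forall>y\<in>Z. x \<noteq> y \<longrightarrow> r \<le> dist x y)" for Z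
  obtain F where F: "finite F" "K \<subseteq> (\<Union>x\<in>F. ball x (r / 2))"
  proof -
    have "K \<subseteq> (\<Union>x\<in>K. ball x (r / 2))" using \<open>0 < r\<close> by force
    then obtain F where "F \<subseteq> K" "finite F" "K \<subseteq> (\<Union>x\<in>F. ball x (r / 2))"
      using compactE_image[OF \<open>compact K\<close>, of K "\<lambda>x. ball x (r / 2)"] by (metis open_ball)
    then show ?thesis using that by blast
  qed
  have bound: "finite Z \<and> card Z \<le> card F" if Z: "sep Z" for Z
  proof -
    have "Z \<subseteq> (\<Union>x\<in>F. ball x (r / 2))" using F Z by (auto simp: sep_def)
    then have "\<forall>z\<in>Z. \<exists>x\<in>F. dist x z < r / 2" by (simp add: subset_iff)
    then obtain h where h: "\<And>z. z \<in> Z \<Longrightarrow> h z \<in> F \<and> dist (h z) z < r / 2" by metis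
    have "inj_on h Z"
    proof (rule inj_onI, rule ccontr)
      fix x y assume xy: "x \<in> Z" "y \<in> Z" "h x = h y" "x \<noteq> y"
      then have "dist x y < r / 2 + r / 2"
        using h[OF xy(1)] h[OF xy(2)] xy(3) dist_triangle3[of x y "h x"] by (metis add_strict_mono le_less_trans)
      moreover have "r \<le> dist x y" using Z xy(1,2,4) by (simp add: sep_def)
      ultimately show False by simp
    qed
    moreover have "h ` Z \<subseteq> F" using h by blast
    ultimately show ?thesis
      using F(1) by (meson card_inj_on_le inj_on_finite)
  qed
  have "sep {}" by (simp add: sep_def)
  then have "\<exists>Z. sep Z \<and> (\<forall>Z'. sep Z' \<longrightarrow> card Z' \<le> card Z)"
    using bound by (intro ex_has_greatest_nat[of _ "{}" _ "Suc (card F)"]) (auto simp: less_Suc_eq_le)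
  then obtain Z where Z: "sep Z" and max: "\<And>Z'. sep Z' \<Longrightarrow> card Z' \<le> card Z" by blast
  have "K \<subseteq> (\<Union>z\<in>Z. ball z r)"
  proof (rule ccontr)
    assume "\<not> ?thesis"
    then obtain x where x: "x \<in> K" "x \<notin> (\<Union>z\<in>Z. ball z r)" by blast
    then have x: "x \<in> K" "\<And>z. z \<in> Z \<Longrightarrow> r \<le> dist z x"
      by (simp_all add: not_less)
    then have "sep (insert x Z)" using Z unfolding sep_def by (auto simp: dist_commute)
    moreover have "x \<notin> Z" using x(2)[of x] \<open>0 < r\<close> by auto
    ultimately show False using max[of "insert x Z"] bound[OF Z] by simp
  qed
  then show thesis using that[of Z] Z bound[OF Z] unfolding sep_def by simp
qed

lemma disjoint_cballs:
  fixes Z :: "'a::metric_space set"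
  assumes sep: "\<And>x y. x \<in> Z \<Longrightarrow> y \<in> Z \<Longrightarrow> x \<noteq> y \<Longrightarrow> 2 * r < dist x y"
  shows "disjoint_family_on (\<lambda>z. cball z r) Z"
  unfolding disjoint_family_on_def
proof (intro ballI impI, rule ccontr)
  fix x y assume xy: "x \<in> Z" "y \<in> Z" "x \<noteq> y" "cball x r \<inter> cball y r \<noteq> {}"
  then obtain w where "w \<in> cball x r" "w \<in> cball y r" by blast
  then have w: "dist x w \<le> r" "dist y w \<le> r" by simp_all
  have "2 * r < dist x y" by (rule sep) (use xy in simp_all)
  then show False
    using w dist_triangle2[of x y w] by simp
qed

text \<open>Nets are counted by volume: the balls of half the separation are disjoint.\<close>

lemma separated_card_le:
  fixes Z :: "'a::metric_space set"
  assumes sets: "sets M = sets borel" and fin: "finite Z"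
    and U: "U \<in> fmeasurable M" "\<And>z. z \<in> Z \<Longrightarrow> cball z r \<subseteq> U"
    and sep: "\<And>x y. x \<in> Z \<Longrightarrow> y \<in> Z \<Longrightarrow> x \<noteq> y \<Longrightarrow> 2 * r < dist x y"
    and low: "\<And>z. z \<in> Z \<Longrightarrow> m \<le> measure M (cball z r)"
  shows "real (card Z) * m \<le> measure M U"
proof -
  have fm: "cball z r \<in> fmeasurable M" if "z \<in> Z" for z
    using fmeasurableI2[OF U(1) U(2)[OF that]] by (simp add: sets)
  have "real (card Z) * m \<le> (\<Sum>z\<in>Z. measure M (cball z r))"
    using sum_bounded_below[of Z m] low by simp
  also have "\<dots> = measure M (\<Union>z\<in>Z. cball z r)"
  proof (rule measure_finite_Union[symmetric])
    show "emeasure M (cball z r) \<noteq> \<infinity>" if "z \<in> Z" for z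
      using fmeasurableD2[OF fm[OF that]] by simp
    show "disjoint_family_on (\<lambda>z. cball z r) Z" by (rule disjoint_cballs[OF sep])
  next
    show "(\<lambda>z. cball z r) ` Z \<subseteq> sets M" using borel_closed[OF closed_cball] unfolding sets by blast
  qed (rule fin)
  also have "\<dots> \<le> measure M U"
  proof (rule measure_mono_fmeasurable[OF _ _ U(1)])
    show "(\<Union>z\<in>Z. cball z r) \<subseteq> U" using U(2) by blast
    show "(\<Union>z\<in>Z. cball z r) \<in> sets M"
      unfolding sets using fin by (intro sets.finite_UN) auto
  qed
  finally show ?thesis .
qed

section \<open>Comparison with Lebesgue measure\<close>

lemma hausdorff_pre_finite_cover:
  assumes "0 < s" "0 \<le> \<delta>" "finite Z" "A \<subseteq> (\<Union>z\<in>Z. E z)"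
    "\<And>z. z \<in> Z \<Longrightarrow> bounded (E z)" "\<And>z. z \<in> Z \<Longrightarrow> diameter (E z) \<le> \<delta>"
  shows "hausdorff_pre s \<delta> A \<le> (\<Sum>z\<in>Z. ennreal (diameter (E z) ^ s))"
proof -
  obtain h where h: "bij_betw h {0..<card Z} Z"
    using ex_bij_betw_nat_finite[OF \<open>finite Z\<close>] by blast
  then have hZ: "h i \<in> Z" if "i < card Z" for i
    using that by (auto simp: bij_betw_def)
  define C where "C i = (if i < card Z then E (h i) else {})" for i
  have "A \<subseteq> (\<Union>i. C i)"
  proof
    fix x assume "x \<in> A"
    then obtain z where z: "z \<in> Z" "x \<in> E z" using assms by blast
    then obtain i where "i < card Z" "h i = z"
      using h bij_betw_imp_surj_on[OF h] by (metis atLeastLessThan_iff imageE)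
    then show "x \<in> (\<Union>i. C i)" using z by (auto simp: C_def intro!: exI[of _ i])
  qed
  then have "hausdorff_pre s \<delta> A \<le> (\<Sum>i. ennreal (diameter (C i) ^ s))"
    using assms hZ by (intro hausdorff_pre_lower) (auto simp: C_def)
  also have "\<dots> = (\<Sum>i\<in>{0..<card Z}. ennreal (diameter (C i) ^ s))"
    using \<open>0 < s\<close> by (intro suminf_finite) (auto simp: C_def zero_power)
  also have "\<dots> = (\<Sum>i\<in>{0..<card Z}. ennreal (diameter (E (h i)) ^ s))"
    by (intro sum.cong) (auto simp: C_def)
  also have "\<dots> = (\<Sum>z\<in>Z. ennreal (diameter (E z) ^ s))"
    using sum.reindex_bij_betw[OF h] by fast
  finally show ?thesis .
qed

text \<open>Balls of radius \<open>\<delta> / 2\<close> around a maximal \<open>\<delta> / 2\<close>-separated set cover \<open>K\<close>. The volume of disjoint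
balls of radius \<open>\<delta> / 8\<close> shows that there are \<open>O(\<delta>\<^sup>-\<^sup>s)\<close> of them.\<close>

lemma hausdorff_outer_compact_finite:
  fixes K :: "(real ^ 's::finite) set"
  assumes "compact K"
  shows "hausdorff_outer CARD('s) K < top"
proof -
  let ?s = "CARD('s)" and ?v = "unit_ball_vol (real CARD('s))"
  obtain R where R: "K \<subseteq> cball 0 R" "0 < R"
    using bounded_subset_ballD[OF compact_imp_bounded[OF assms], of 0] ball_subset_cball by (metis subset_trans)
  define B where "B = 8 ^ ?s * (R + 1) ^ ?s"
  have v: "0 < ?v" by simp
  have "hausdorff_pre ?s \<delta> K \<le> ennreal B" if \<delta>: "0 < \<delta>" "\<delta> \<le> 1" for \<delta>
  proof -
    obtain Z where Z: "finite Z" "Z \<subseteq> K" "\<And>x y. x \<in> Z \<Longrightarrow> y \<in> Z \<Longrightarrow> x \<noteq> y \<Longrightarrow> \<delta> / 2 \<le> dist x y"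
      "K \<subseteq> (\<Union>z\<in>Z. ball z (\<delta> / 2))"
      by (rule compact_maximal_separated[OF assms half_gt_zero[OF \<delta>(1)]]) (rule that)
    have bd: "bounded (ball z (\<delta> / 2))" for z :: "real ^ 's" by simp
    have diam: "diameter (ball z (\<delta> / 2)) \<le> \<delta>" for z :: "real ^ 's"
      using \<delta> by (simp add: diameter_ball)
    have "real (card Z) * measure lborel (cball (0 :: real ^ 's) (\<delta> / 8)) \<le>
        measure lborel (cball (0 :: real ^ 's) (R + 1))"
    proof (rule separated_card_le[where r = "\<delta> / 8"])
      show "cball z (\<delta> / 8) \<subseteq> cball 0 (R + 1)" if "z \<in> Z" for z
        using that Z(2) R(1) \<delta> by (intro cball_subset_cball_iff[THEN iffD2]) (fastforce simp: dist_commute)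
      show "2 * (\<delta> / 8) < dist x y" if "x \<in> Z" "y \<in> Z" "x \<noteq> y" for x y
        using Z(3)[OF that] \<delta> by simp
      show "measure lborel (cball (0 :: real ^ 's) (\<delta> / 8)) \<le> measure lborel (cball z (\<delta> / 8))" for z :: "real ^ 's"
        using \<delta> by (simp add: content_cball)
      show "cball (0 :: real ^ 's) (R + 1) \<in> fmeasurable lborel"
        by (rule fmeasurable_compact) simp
    qed (use Z in auto)
    then have "?v * (real (card Z) * (\<delta> / 8) ^ ?s) \<le> ?v * (R + 1) ^ ?s"
      using \<delta> R by (simp add: content_cball ac_simps)
    then have "real (card Z) * (\<delta> / 8) ^ ?s \<le> (R + 1) ^ ?s"
      using v by (simp only: mult_le_cancel_left_pos)
    then have card: "real (card Z) * \<delta> ^ ?s \<le> B"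
      by (simp add: B_def power_divide field_simps)
    have "hausdorff_pre ?s \<delta> K \<le> (\<Sum>z\<in>Z. ennreal (diameter (ball z (\<delta> / 2)) ^ ?s))"
      by (rule hausdorff_pre_finite_cover) (use Z \<delta> bd diam in auto)
    also have "\<dots> \<le> (\<Sum>z\<in>Z. ennreal (\<delta> ^ ?s))"
      by (intro sum_mono ennreal_leI power_mono diam diameter_ge_0 bd)
    also have "\<dots> = ennreal (real (card Z) * \<delta> ^ ?s)"
      using \<delta> by (simp add: ennreal_mult ennreal_of_nat_eq_real_of_nat)
    also have "\<dots> \<le> ennreal B" using card by (rule ennreal_leI)
    finally show ?thesis .
  qed
  then have "hausdorff_pre ?s \<delta> K \<le> ennreal B" if "0 < \<delta>" for \<delta>
    using hausdorff_pre_antimono[of "min \<delta> 1" \<delta> ?s K] that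
    by (meson less_eq_real_def min.cobounded1 min.cobounded2 min_less_iff_conj order_trans zero_less_one)
  then have "hausdorff_outer ?s K \<le> ennreal B"
    unfolding hausdorff_outer_def by (intro SUP_least) auto
  then show ?thesis by (rule le_less_trans) simp
qed

text \<open>A set of diameter \<open>d\<close> lies in a ball of radius \<open>d\<close>. This crude constant already shows
that the Hausdorff measure of the unit cube is positive.\<close>

lemma lborel_le_hausdorff_pre:
  fixes A :: "(real ^ 's::finite) set"
  assumes "A \<in> sets borel"
  shows "emeasure lborel A \<le> ennreal (unit_ball_vol (real CARD('s))) * hausdorff_pre CARD('s) \<delta> A"
proof -
  let ?s = "CARD('s)" and ?v = "unit_ball_vol (real CARD('s))"
  have "emeasure lborel A \<le> ennreal ?v * (\<Sum>i. ennreal (diameter (E i) ^ ?s))"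
    if E: "A \<subseteq> (\<Union>i. E i)" "\<And>i. bounded (E i)" for E
  proof -
    \<comment> \<open>an empty \<open>E i\<close> has diameter \<open>0\<close>, so then any centre will do\<close>
    define x where "x i = (SOME x. x \<in> E i)" for i
    have "E i \<subseteq> cball (x i) (diameter (E i))" for i
    proof
      fix y assume "y \<in> E i"
      then show "y \<in> cball (x i) (diameter (E i))"
        using diameter_bounded_bound[OF E(2), of "x i" i y] someI[of "\<lambda>x. x \<in> E i" y] by (simp add: x_def)
    qed
    then have "(\<Union>i. E i) \<subseteq> (\<Union>i. cball (x i) (diameter (E i)))" by (rule UN_mono[OF order_refl])
    with E(1) have "emeasure lborel A \<le> emeasure lborel (\<Union>i. cball (x i) (diameter (E i)))"
      by (intro emeasure_mono) auto
    also have "\<dots> \<le> (\<Sum>i. emeasure lborel (cball (x i) (diameter (E i))))"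
      by (intro emeasure_subadditive_countably) auto
    also have "\<dots> = (\<Sum>i. ennreal ?v * ennreal (diameter (E i) ^ ?s))"
      by (intro suminf_cong) (simp add: emeasure_cball diameter_ge_0 E(2) ennreal_mult)
    finally show ?thesis by simp
  qed
  then show ?thesis
    unfolding hausdorff_pre_def by (intro le_mult_INF_ennreal) auto
qed

lemma hausdorff_outer_isometry:
  fixes f :: "'a::metric_space \<Rightarrow> 'b::metric_space"
  assumes "0 < s" and iso: "\<And>x y. dist (f x) (f y) = dist x y"
  shows "hausdorff_outer s (f ` A) = hausdorff_outer s A"
proof (rule antisym)
  show "hausdorff_outer s (f ` A) \<le> hausdorff_outer s A"
    using hausdorff_outer_lipschitz_image[of s 1 A f] assms by simp
  have "inj f" using iso by (metis dist_eq_0_iff injI)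
  then have e: "the_inv f ` f ` A = A" by (simp add: image_image the_inv_f_f)
  have "dist (the_inv f x) (the_inv f y) \<le> 1 * dist x y" if "x \<in> f ` A" "y \<in> f ` A" for x y
    using that \<open>inj f\<close> iso by (auto simp: the_inv_f_f)
  then show "hausdorff_outer s A \<le> hausdorff_outer s (f ` A)"
    using hausdorff_outer_lipschitz_image[of s 1 "f ` A" "the_inv f"] assms(1) by (simp add: e)
qed

text \<open>With \<open>Q\<close> the unit cube, integrate the indicator of the pairs \<open>(x, y)\<close> with \<open>x \<in> A\<close> and \<open>y - x \<in> Q\<close>
over the product of \<open>M\<close> and Lebesgue measure in both orders. One order gives \<open>M A\<close>. In the other
order, translating \<open>x\<close> by \<open>y\<close> turns the integral into the mass of \<open>-Q\<close> times the volume of \<open>A\<close>, and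
\<open>-Q\<close> is a translate of \<open>Q\<close>.\<close>

lemma translation_invariant_eq_lborel:
  fixes M :: "'a::euclidean_space measure"
  assumes sets: "sets M = sets borel" and fin: "sigma_finite_measure M"
    and inv: "\<And>a. distr M borel ((+) a) = M"
    and A: "A \<in> sets borel"
  shows "emeasure M A = emeasure M (cbox 0 One) * emeasure lborel A"
proof -
  note [measurable_cong] = sets
  note [measurable] = A
  interpret M: sigma_finite_measure M by fact
  interpret P: pair_sigma_finite M "lborel :: 'a measure" ..
  let ?Q = "cbox 0 One :: 'a set"
  have lb: "(\<integral>\<^sup>+y. f y \<partial>lborel) = (\<integral>\<^sup>+y. f (x + y) \<partial>lborel)"
    if [measurable]: "f \<in> borel_measurable borel" for f :: "'a \<Rightarrow> ennreal" and x
    by (subst lborel_distr_plus[of x, symmetric]) (simp add: nn_integral_distr)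
  have Mi: "(\<integral>\<^sup>+y. f y \<partial>M) = (\<integral>\<^sup>+y. f (x + y) \<partial>M)"
    if [measurable]: "f \<in> borel_measurable borel" for f :: "'a \<Rightarrow> ennreal" and x
    by (subst inv[of x, symmetric]) (simp add: nn_integral_distr)
  have Q1: "emeasure lborel ?Q = 1"
    by (simp add: emeasure_lborel_cbox_eq inner_sum_left_Basis)
  have "emeasure M A = (\<integral>\<^sup>+x. indicator A x * (\<integral>\<^sup>+y. indicator ?Q y \<partial>lborel) \<partial>M)"
    by (simp add: Q1 sets)
  also have "\<dots> = (\<integral>\<^sup>+x. indicator A x * (\<integral>\<^sup>+y. indicator ?Q (- x + y) \<partial>lborel) \<partial>M)"
    by (subst lb[of "indicator ?Q", symmetric]) auto
  also have "\<dots> = (\<integral>\<^sup>+x. (\<integral>\<^sup>+y. indicator A x * indicator ?Q (- x + y) \<partial>lborel) \<partial>M)"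
    by (intro nn_integral_cong nn_integral_cmult[symmetric]) simp
  also have "\<dots> = (\<integral>\<^sup>+y. (\<integral>\<^sup>+x. indicator A x * indicator ?Q (- x + y) \<partial>M) \<partial>lborel)"
    by (rule P.Fubini'[symmetric]) measurable
  also have "\<dots> = (\<integral>\<^sup>+y. (\<integral>\<^sup>+x. indicator A (y + x) * indicator ?Q (- x) \<partial>M) \<partial>lborel)"
  proof (rule nn_integral_cong)
    fix y :: 'a
    show "(\<integral>\<^sup>+x. indicator A x * indicator ?Q (- x + y) \<partial>M) =
        (\<integral>\<^sup>+x. indicator A (y + x) * indicator ?Q (- x) \<partial>M)"
      by (subst Mi[of _ y]) simp_all
  qed
  also have "\<dots> = (\<integral>\<^sup>+x. (\<integral>\<^sup>+y. indicator A (y + x) * indicator ?Q (- x) \<partial>lborel) \<partial>M)"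
    by (rule P.Fubini') measurable
  also have "\<dots> = (\<integral>\<^sup>+x. indicator ?Q (- x) * (\<integral>\<^sup>+y. indicator A (x + y) \<partial>lborel) \<partial>M)"
    by (subst nn_integral_cmult[symmetric]) (auto simp: mult.commute add.commute)
  also have "\<dots> = (\<integral>\<^sup>+x. indicator ?Q (- x) * emeasure lborel A \<partial>M)"
    by (subst lb[of "indicator A", symmetric]) auto
  also have "\<dots> = (\<integral>\<^sup>+x. indicator ?Q (- x) \<partial>M) * emeasure lborel A"
    by (rule nn_integral_multc) measurable
  also have "(\<integral>\<^sup>+x. indicator ?Q (- x) \<partial>M) = (\<integral>\<^sup>+x. indicator ?Q (- (- One + x)) \<partial>M)"
    by (rule Mi) measurable
  also have "\<dots> = (\<integral>\<^sup>+x. indicator ?Q x \<partial>M)"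
    by (intro nn_integral_cong) (auto simp: indicator_def mem_box inner_diff_left inner_sum_left_Basis)
  finally show ?thesis by (simp add: sets)
qed

lemma One_cart: "One = (1 :: real ^ 's::finite)"
proof (rule euclidean_eqI)
  fix b :: "real ^ 's" assume b: "b \<in> Basis"
  then obtain i where "b = axis i 1" by (auto simp: Basis_vec_def)
  then have "1 \<bullet> b = 1" by (simp add: inner_axis)
  then show "One \<bullet> b = 1 \<bullet> b" using b by (simp add: inner_sum_left inner_Basis)
qed

lemma hausdorff_cube:
  "0 < hausdorff_outer CARD('s) (cbox 0 1 :: (real ^ 's::finite) set)"
  "hausdorff_outer CARD('s) (cbox 0 1 :: (real ^ 's::finite) set) < top"
proof -
  let ?c = "hausdorff_outer CARD('s) (cbox 0 1 :: (real ^ 's::finite) set)"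
  have "emeasure lborel (cbox 0 1 :: (real ^ 's) set) = 1"
    unfolding One_cart[symmetric] by (simp add: emeasure_lborel_cbox_eq inner_sum_left_Basis)
  then have "1 \<le> ennreal (unit_ball_vol (real CARD('s))) *
      hausdorff_pre CARD('s) 1 (cbox 0 1 :: (real ^ 's) set)"
    using lborel_le_hausdorff_pre[of "cbox 0 1 :: (real ^ 's) set" 1] by simp
  also have "\<dots> \<le> ennreal (unit_ball_vol (real CARD('s))) * ?c"
    by (intro mult_left_mono hausdorff_pre_le_outer) auto
  finally show "0 < ?c"
    by (metis mult_zero_right not_gr_zero not_one_le_zero)
  show "?c < top" by (rule hausdorff_outer_compact_finite) simp
qed

lemma hausdorff_eq_lborel: "(hausdorff TYPE('s::finite) :: (real ^ 's) measure) = lborel"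
proof (rule measure_eqI)
  fix A :: "(real ^ 's) set" assume "A \<in> sets (hausdorff TYPE('s))"
  then have A: "A \<in> sets borel" by simp
  let ?H = "hausdorff TYPE('s) :: (real ^ 's) measure"
  have cube: "emeasure ?H (cbox 0 1) = 1"
    using hausdorff_cube[where 's = 's] by (simp add: emeasure_hausdorff ennreal_divide_self less_top[symmetric])
  have inv: "distr ?H borel ((+) a) = ?H" for a :: "real ^ 's"
  proof (rule measure_eqI)
    fix B assume "B \<in> sets (distr ?H borel ((+) a))"
    then have B: "B \<in> sets borel" by simp
    have e: "(+) a -` B = (+) (- a) ` B" by force
    have "(+) a -` B \<in> sets borel"
      using measurable_sets[OF _ B, of "(+) a" borel] by simp
    then show "emeasure (distr ?H borel ((+) a)) B = emeasure ?H B"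
      using B hausdorff_outer_isometry[of "CARD('s)" "(+) (- a)" B]
      by (simp add: emeasure_distr emeasure_hausdorff e dist_norm)
  qed simp
  have fin: "emeasure ?H (cball 0 (real n)) < top" for n
    using hausdorff_outer_compact_finite[OF compact_cball, of "0 :: real ^ 's" "real n"] hausdorff_cube[where 's = 's]
    by (auto simp: emeasure_hausdorff ennreal_divide_eq_top_iff less_top[symmetric])
  have "sigma_finite_measure ?H"
  proof (rule sigma_finite_measure.intro, intro exI conjI ballI)
    show "countable (range (\<lambda>n. cball (0 :: real ^ 's) (real n)))" by simp
    show "(\<Union>n. cball 0 (real n)) = space ?H"
      by (auto simp: real_arch_simple)
  qed (use fin in \<open>auto simp: less_top\<close>)
  from translation_invariant_eq_lborel[OF _ this inv A]
  show "emeasure ?H A = emeasure lborel A"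
    by (simp add: One_cart cube)
qed simp

text \<open>A general set \<open>A\<close> is compared with the image, since the balls of a submanifold are only known to lie
between two such images.\<close>

lemma hausdorff_le_lipschitz_image_cball:
  fixes F :: "real ^ 's::finite \<Rightarrow> 'a::metric_space"
  assumes A: "A \<in> sets borel" "A \<subseteq> F ` cball v R" and "0 \<le> R" "0 < L"
    and lip: "\<And>x y. x \<in> cball v R \<Longrightarrow> y \<in> cball v R \<Longrightarrow> dist (F x) (F y) \<le> L * dist x y"
  shows "emeasure (hausdorff TYPE('s)) A \<le> ennreal (unit_ball_vol (real CARD('s)) * (L * R) ^ CARD('s))"
proof -
  let ?c = "hausdorff_outer CARD('s) (cbox 0 1 :: (real ^ 's::finite) set)"
  have "hausdorff_outer CARD('s) A \<le> hausdorff_outer CARD('s) (F ` cball v R)"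
    using A by (intro hausdorff_outer_mono)
  also have "\<dots> \<le> ennreal (L ^ CARD('s)) * hausdorff_outer CARD('s) (cball v R)"
    using assms by (intro hausdorff_outer_lipschitz_image) auto
  finally have "hausdorff_outer CARD('s) A / ?c \<le>
      (ennreal (L ^ CARD('s)) * hausdorff_outer CARD('s) (cball v R)) / ?c"
    by (rule divide_right_mono_ennreal)
  also have "\<dots> = ennreal (L ^ CARD('s)) * emeasure (hausdorff TYPE('s)) (cball v R)"
    by (simp add: emeasure_hausdorff ennreal_times_divide)
  also have "\<dots> = ennreal (unit_ball_vol (real CARD('s)) * (L * R) ^ CARD('s))"
    using assms by (simp add: hausdorff_eq_lborel emeasure_cball ennreal_mult[symmetric] power_mult_distrib ac_simps)
  finally show ?thesis
    using A by (simp add: emeasure_hausdorff)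
qed

lemma hausdorff_ge_lipschitz_image_cball:
  fixes F :: "real ^ 's::finite \<Rightarrow> 'a::metric_space"
  assumes A: "A \<in> sets borel" "F ` cball v R \<subseteq> A" and "0 \<le> R" "0 < L"
    and lip: "\<And>x y. x \<in> cball v R \<Longrightarrow> y \<in> cball v R \<Longrightarrow> dist x y \<le> L * dist (F x) (F y)"
  shows "ennreal (unit_ball_vol (real CARD('s)) * (R / L) ^ CARD('s)) \<le> emeasure (hausdorff TYPE('s)) A"
proof -
  let ?c = "hausdorff_outer CARD('s) (cbox 0 1 :: (real ^ 's::finite) set)"
  have inj: "inj_on F (cball v R)"
    using lip by (fastforce intro: inj_onI)
  define G where "G = the_inv_into (cball v R) F"
  have G: "G (F x) = x" if "x \<in> cball v R" for x
    unfolding G_def using the_inv_into_f_f[OF inj that] .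
  have "hausdorff_outer CARD('s) (G ` F ` cball v R) \<le>
      ennreal (L ^ CARD('s)) * hausdorff_outer CARD('s) (F ` cball v R)"
    using assms G by (intro hausdorff_outer_lipschitz_image) auto
  also have "G ` F ` cball v R = cball v R"
    using G by (force simp: image_image)
  also have "ennreal (L ^ CARD('s)) * hausdorff_outer CARD('s) (F ` cball v R) \<le>
     ennreal (L ^ CARD('s)) * hausdorff_outer CARD('s) A"
    using A by (intro mult_left_mono hausdorff_outer_mono) auto
  finally have "hausdorff_outer CARD('s) (cball v R) / ?c \<le>
      (ennreal (L ^ CARD('s)) * hausdorff_outer CARD('s) A) / ?c"
    by (rule divide_right_mono_ennreal)
  then have "ennreal (unit_ball_vol (real CARD('s)) * R ^ CARD('s)) \<le>
      ennreal (L ^ CARD('s)) * emeasure (hausdorff TYPE('s)) A"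
    using A \<open>0 \<le> R\<close> emeasure_hausdorff[of "cball v R", where 's = 's]
    by (simp add: emeasure_hausdorff ennreal_times_divide hausdorff_eq_lborel emeasure_cball)
  then have "ennreal (1 / L ^ CARD('s)) * ennreal (unit_ball_vol (real CARD('s)) * R ^ CARD('s)) \<le>
      ennreal (1 / L ^ CARD('s)) * (ennreal (L ^ CARD('s)) * emeasure (hausdorff TYPE('s)) A)"
    by (intro mult_left_mono) auto
  then show ?thesis
    using \<open>0 < L\<close> \<open>0 \<le> R\<close>
    by (simp add: mult.assoc[symmetric] ennreal_mult[symmetric] power_divide)
qed

section \<open>Charts are almost isometric\<close>

text \<open>The step from \<open>w\<close> to \<open>v\<close> is made one coordinate at a time. On each of these segments the mean value
inequality applies to \<open>\<phi>\<close> minus its linear part, whose derivative is at most \<open>e / s\<close> because \<open>D i\<close> is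
continuous at \<open>u\<close>.\<close>

lemma linear_approximation_of_partials:
  fixes \<phi> :: "real ^ 's::finite \<Rightarrow> 'b::real_normed_vector"
  assumes "open W" "u \<in> W" "0 < e"
    and part: "\<And>i v. v \<in> W \<Longrightarrow> ((\<lambda>t. \<phi> (v + t *\<^sub>R axis i 1)) has_vector_derivative D i v) (at 0)"
    and cont: "\<And>i. continuous_on W (D i)"
  obtains \<delta> where "0 < \<delta>" "ball u \<delta> \<subseteq> W"
    "\<And>v w. v \<in> ball u \<delta> \<Longrightarrow> w \<in> ball u \<delta> \<Longrightarrow>
      norm (\<phi> v - \<phi> w - (\<Sum>i\<in>UNIV. (v - w) $ i *\<^sub>R D i u)) \<le> e * norm (v - w)"
proof -
  define s where "s = real CARD('s)"
  have s: "1 \<le> s" by (simp add: s_def Suc_leI)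
  have "\<exists>\<eta>>0. ball u \<eta> \<subseteq> W \<and> (\<forall>x\<in>ball u \<eta>. norm (D i x - D i u) \<le> e / s)" for i
  proof -
    obtain \<eta>1 where \<eta>1: "0 < \<eta>1" "ball u \<eta>1 \<subseteq> W"
      using \<open>open W\<close> \<open>u \<in> W\<close> open_contains_ball by blast
    have "0 < e / s" using s \<open>0 < e\<close> by simp
    then obtain \<eta>2 where \<eta>2: "0 < \<eta>2" "\<forall>x\<in>W. dist x u < \<eta>2 \<longrightarrow> dist (D i x) (D i u) < e / s"
      using cont[of i] \<open>u \<in> W\<close> unfolding continuous_on_iff by blast
    have "norm (D i x - D i u) \<le> e / s" if "x \<in> ball u (min \<eta>1 \<eta>2)" for x
    proof -
      have "x \<in> W" "dist x u < \<eta>2" using that \<eta>1 by (auto simp: dist_commute)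
      then show ?thesis using \<eta>2(2) by (auto simp: dist_norm less_imp_le)
    qed
    then show ?thesis using \<eta>1 \<eta>2 by (intro exI[of _ "min \<eta>1 \<eta>2"]) auto
  qed
  then obtain h where h: "\<And>i. 0 < h i" "\<And>i. ball u (h i) \<subseteq> W"
    "\<And>i x. x \<in> ball u (h i) \<Longrightarrow> norm (D i x - D i u) \<le> e / s" by metis
  define \<eta> where "\<eta> = Min (range h)"
  have \<eta>: "0 < \<eta>" "\<And>i. \<eta> \<le> h i" unfolding \<eta>_def using h(1) by auto
  have \<eta>W: "ball u \<eta> \<subseteq> W" using h(2) \<eta>(2) subset_ball by (metis order_trans)
  have \<eta>D: "norm (D i x - D i u) \<le> e / s" if "x \<in> ball u \<eta>" for i x
    using h(3)[of x i] \<eta>(2)[of i] that by auto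
  \<comment> \<open>the intermediate points may leave \<open>ball u \<delta>\<close>, but they stay in the cube of half side \<open>\<delta>\<close> around \<open>u\<close>, which lies in \<open>ball u \<eta>\<close>\<close>
  define \<delta> where "\<delta> = \<eta> / s"
  have \<delta>: "0 < \<delta>" "\<delta> \<le> \<eta>" using \<eta> s by (auto simp: \<delta>_def field_simps)
  have box: "z \<in> ball u \<eta>" if z: "\<And>i. \<bar>z $ i - u $ i\<bar> < \<delta>" for z
  proof -
    have "norm (z - u) \<le> (\<Sum>i\<in>UNIV. \<bar>(z - u) $ i\<bar>)" by (rule norm_le_l1_cart)
    also have "\<dots> < (\<Sum>i\<in>(UNIV :: 's set). \<delta>)"
      using z by (intro sum_strict_mono) auto
    also have "\<dots> = \<eta>" using s by (simp add: \<delta>_def s_def)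
    finally show ?thesis by (simp add: dist_norm norm_minus_commute)
  qed
  have main: "norm (\<phi> v - \<phi> w - (\<Sum>i\<in>UNIV. (v - w) $ i *\<^sub>R D i u)) \<le> e * norm (v - w)"
    if vw: "v \<in> ball u \<delta>" "w \<in> ball u \<delta>" for v w
  proof -
    have vi: "\<bar>v $ i - u $ i\<bar> < \<delta>" and wi: "\<bar>w $ i - u $ i\<bar> < \<delta>" for i
      using vw component_le_norm_cart[of "v - u" i] component_le_norm_cart[of "w - u" i]
      by (auto simp: dist_norm norm_minus_commute)
    \<comment> \<open>\<open>mix A\<close> is the point that is reached from \<open>w\<close> once the coordinates in \<open>A\<close> have been changed\<close>
    define mix where "mix A = (\<chi> i. if i \<in> A then v $ i else w $ i)" for A
    have "norm (\<phi> (mix A) - \<phi> w - (\<Sum>i\<in>A. (v - w) $ i *\<^sub>R D i u)) \<le> (\<Sum>i\<in>A. e / s * \<bar>(v - w) $ i\<bar>)"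
      if "finite A" for A
      using that
    proof (induction A)
      case empty
      have "mix {} = w" by (simp add: mix_def vec_eq_iff)
      then show ?case by simp
    next
      case (insert i A)
      let ?d = "(v - w) $ i"
      let ?S = "closed_segment 0 ?d"
      let ?D = "\<lambda>t. D i (mix A + t *\<^sub>R axis i 1) - D i u"
      define g where "g t = \<phi> (mix A + t *\<^sub>R axis i 1) - t *\<^sub>R D i u" for t :: real
      have step: "mix (insert i A) = mix A + ?d *\<^sub>R axis i 1"
        using insert by (auto simp: mix_def vec_eq_iff axis_def)
      have inball: "mix A + t *\<^sub>R axis i 1 \<in> ball u \<eta>" if t: "t \<in> ?S" for t
      proof (rule box)
        fix j
        show "\<bar>(mix A + t *\<^sub>R axis i 1) $ j - u $ j\<bar> < \<delta>"
        proof (cases "j = i")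
          case True
          have "w $ i + t \<in> closed_segment (w $ i) (v $ i)"
            using t by (auto simp: closed_segment_eq_real_ivl split: if_splits)
          then have "\<bar>w $ i + t - u $ i\<bar> < \<delta>"
            using vi[of i] wi[of i] by (auto simp: closed_segment_eq_real_ivl split: if_splits)
          then show ?thesis using True insert by (simp add: mix_def)
        next
          case False
          then show ?thesis using vi[of j] wi[of j] by (simp add: mix_def axis_def)
        qed
      qed
      have deriv: "(g has_vector_derivative ?D t) (at t within ?S)"
        if t: "t \<in> ?S" for t
      proof -
        let ?p = "mix A + t *\<^sub>R axis i 1"
        have "((\<lambda>h. \<phi> (?p + h *\<^sub>R axis i 1)) has_vector_derivative D i ?p) (at (t - t))"
          using part[of ?p i] inball[OF t] \<eta>W by auto
        moreover have "((\<lambda>x. x - t) has_vector_derivative 1) (at t)"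
          by (auto intro!: derivative_eq_intros)
        ultimately have "((\<lambda>h. \<phi> (?p + h *\<^sub>R axis i 1)) \<circ> (\<lambda>x. x - t) has_vector_derivative 1 *\<^sub>R D i ?p) (at t)"
          by (intro vector_diff_chain_at)
        moreover have "(\<lambda>h. \<phi> (?p + h *\<^sub>R axis i 1)) \<circ> (\<lambda>x. x - t) = (\<lambda>x. \<phi> (mix A + x *\<^sub>R axis i 1))"
          by (auto simp: fun_eq_iff algebra_simps)
        ultimately have "((\<lambda>x. \<phi> (mix A + x *\<^sub>R axis i 1)) has_vector_derivative D i ?p) (at t within ?S)"
          by (simp add: has_vector_derivative_at_within)
        then show ?thesis
          unfolding g_def by (auto intro!: derivative_eq_intros)
      qed
      have "norm (g ?d - g 0) \<le> e / s * norm (?d - 0)"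
      proof (rule differentiable_bound[where S = ?S and f' = "\<lambda>t h. h *\<^sub>R ?D t"])
        show "(g has_derivative (\<lambda>h. h *\<^sub>R ?D t)) (at t within ?S)"
          if "t \<in> ?S" for t
          using deriv[OF that] by (simp add: has_vector_derivative_def)
        show "onorm (\<lambda>h. h *\<^sub>R ?D t) \<le> e / s" if "t \<in> ?S" for t
        proof (rule onorm_le)
          fix h :: real
          have "\<bar>h\<bar> * norm (?D t) \<le> \<bar>h\<bar> * (e / s)"
            using \<eta>D[OF inball[OF that]] by (intro mult_left_mono) auto
          then show "norm (h *\<^sub>R ?D t) \<le> e / s * norm h"
            by (simp add: mult.commute)
        qed
      qed auto
      also have "g ?d - g 0 = \<phi> (mix (insert i A)) - \<phi> (mix A) - ?d *\<^sub>R D i u"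
        unfolding g_def step by simp
      finally have one: "norm (\<phi> (mix (insert i A)) - \<phi> (mix A) - ?d *\<^sub>R D i u) \<le> e / s * \<bar>?d\<bar>"
        by simp
      have "\<phi> (mix (insert i A)) - \<phi> w - (\<Sum>i\<in>insert i A. (v - w) $ i *\<^sub>R D i u) =
          (\<phi> (mix A) - \<phi> w - (\<Sum>i\<in>A. (v - w) $ i *\<^sub>R D i u)) +
          (\<phi> (mix (insert i A)) - \<phi> (mix A) - ?d *\<^sub>R D i u)"
        using insert by (simp add: algebra_simps)
      then have "norm (\<phi> (mix (insert i A)) - \<phi> w - (\<Sum>i\<in>insert i A. (v - w) $ i *\<^sub>R D i u)) \<le>
          (\<Sum>i\<in>A. e / s * \<bar>(v - w) $ i\<bar>) + e / s * \<bar>?d\<bar>"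
        by (metis (no_types, lifting) insert.IH one norm_triangle_mono)
      then show ?case using insert by (simp add: add.commute)
    qed
    from this[of UNIV] have "norm (\<phi> v - \<phi> w - (\<Sum>i\<in>UNIV. (v - w) $ i *\<^sub>R D i u)) \<le>
        (\<Sum>i\<in>UNIV. e / s * \<bar>(v - w) $ i\<bar>)"
      by (simp add: mix_def)
    also have "\<dots> \<le> (\<Sum>i\<in>(UNIV :: 's set). e / s * norm (v - w))"
      using \<open>0 < e\<close> s by (intro sum_mono mult_left_mono component_le_norm_cart) auto
    also have "\<dots> = e * norm (v - w)" using s by (simp add: s_def)
    finally show ?thesis .
  qed
  have "ball u \<delta> \<subseteq> W" using \<eta>W \<delta>(2) subset_ball by blast
  then show thesis using that \<delta>(1) main by blast
qed

text \<open>Let \<open>A\<close> be the Jacobian of \<open>\<phi>\<close> at \<open>u\<close>. Its range is isometric to \<open>\<real>\<^sup>s\<close> by some \<open>f\<close>, so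
\<open>B = A\<^sup>-\<^sup>1 f\<close> satisfies \<open>\<bar>A (B x)\<bar> = \<bar>x\<bar>\<close>, and \<open>\<phi>\<close> composed with \<open>x \<mapsto> u + B x\<close> is almost isometric
near \<open>0\<close>.\<close>

lemma C11_chart_almost_isometry:
  fixes \<phi> :: "real ^ 's::finite \<Rightarrow> real ^ 'd::finite"
  assumes chart: "C11_local_parametrization K W \<phi>" and "u \<in> W" "0 < e"
  obtains F :: "real ^ 's \<Rightarrow> real ^ 'd" and \<rho> where "0 < \<rho>"
    "openin (top_of_set K) (F ` ball 0 \<rho>)" "F 0 = \<phi> u"
    "\<And>v w. v \<in> ball 0 \<rho> \<Longrightarrow> w \<in> ball 0 \<rho> \<Longrightarrow>
       (1 - e) * dist v w \<le> dist (F v) (F w) \<and> dist (F v) (F w) \<le> (1 + e) * dist v w"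
proof -
  from chart obtain \<psi> D L where W: "open W" and oin: "openin (top_of_set K) (\<phi> ` W)"
    and hom: "homeomorphism W (\<phi> ` W) \<phi> \<psi>"
    and part: "\<And>i v. v \<in> W \<Longrightarrow> ((\<lambda>t. \<phi> (v + t *\<^sub>R axis i 1)) has_vector_derivative D i v) (at 0)"
    and lip: "\<And>i. L-lipschitz_on W (D i)"
    and injD: "\<And>u. u \<in> W \<Longrightarrow> inj (\<lambda>v :: real ^ 's. \<Sum>i\<in>UNIV. v $ i *\<^sub>R D i u)"
    unfolding C11_local_parametrization_def by blast
  define A where "A v = (\<Sum>i\<in>UNIV. v $ i *\<^sub>R D i u)" for v :: "real ^ 's"
  have linA: "linear A"
    unfolding A_def by (intro linear_compose_sum ballI linearI) (simp_all add: algebra_simps)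
  have injA: "inj A" using injD[OF \<open>u \<in> W\<close>] by (simp add: A_def[abs_def])
  obtain A' where A': "linear A'" "A' \<circ> A = id"
    using linear_injective_left_inverse[OF linA injA] by blast
  have dim: "dim (UNIV :: (real ^ 's) set) = dim (range A)"
    using dim_image_eq[OF linA, of UNIV] injA by simp
  obtain f :: "real ^ 's \<Rightarrow> real ^ 'd" where f: "linear f" "f ` UNIV = range A" "\<And>x. x \<in> UNIV \<Longrightarrow> norm (f x) = norm x"
    using isometry_subspaces[OF subspace_UNIV linear_subspace_image[OF linA subspace_UNIV] dim] by metis
  have fnorm: "norm (f x) = norm x" for x using f(3) by simp
  define B where "B = A' \<circ> f"
  have linB: "linear B" unfolding B_def by (rule linear_compose[OF f(1) A'(1)])
  have AB: "A (B x) = f x" for x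
  proof -
    obtain y where "f x = A y" using f(2) by blast
    then show ?thesis using A'(2) by (simp add: B_def fun_eq_iff)
  qed
  have injB: "inj B"
  proof (rule injI)
    fix x y assume "B x = B y"
    then have "f x = f y" using AB by metis
    then have "norm (f (x - y)) = 0" by (simp add: linear_diff[OF f(1)])
    then show "x = y" by (simp add: fnorm)
  qed
  obtain M where M: "0 < M" "\<And>x. norm (B x) \<le> M * norm x"
    using linear_bounded_pos[OF linB] by blast
  have eM: "0 < e / M" using M \<open>0 < e\<close> by simp
  obtain \<delta> where \<delta>: "0 < \<delta>" "ball u \<delta> \<subseteq> W"
    "\<And>v w. v \<in> ball u \<delta> \<Longrightarrow> w \<in> ball u \<delta> \<Longrightarrow> norm (\<phi> v - \<phi> w - A (v - w)) \<le> e / M * norm (v - w)"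
  proof (rule linear_approximation_of_partials[where \<phi> = \<phi> and D = D and W = W and u = u and e = "e / M"])
    show "continuous_on W (D i)" for i by (rule lipschitz_on_continuous_on[OF lip])
    fix \<delta> assume "0 < \<delta>" "ball u \<delta> \<subseteq> W" "\<And>v w. v \<in> ball u \<delta> \<Longrightarrow> w \<in> ball u \<delta> \<Longrightarrow>
      norm (\<phi> v - \<phi> w - (\<Sum>i\<in>UNIV. (v - w) $ i *\<^sub>R D i u)) \<le> e / M * norm (v - w)"
    then show thesis using that[of \<delta>] unfolding A_def by blast
  qed (use W \<open>u \<in> W\<close> eM part in auto)
  define \<rho> where "\<rho> = \<delta> / M"
  define F where "F x = \<phi> (u + B x)" for x
  have \<rho>: "0 < \<rho>" using M \<delta> by (simp add: \<rho>_def)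
  have inball: "u + B x \<in> ball u \<delta>" if "x \<in> ball 0 \<rho>" for x
  proof -
    have "norm (B x) \<le> M * norm x" by (rule M)
    also have "\<dots> < \<delta>" using that M by (simp add: \<rho>_def field_simps)
    finally show ?thesis by (simp add: dist_norm)
  qed
  have est: "norm (F v - F w - f (v - w)) \<le> e * norm (v - w)"
    if "v \<in> ball 0 \<rho>" "w \<in> ball 0 \<rho>" for v w
  proof -
    have "norm (F v - F w - A (B (v - w))) \<le> e / M * norm (B (v - w))"
      using \<delta>(3)[OF inball[OF that(1)] inball[OF that(2)]] by (simp add: F_def linear_diff[OF linB])
    also have "\<dots> \<le> e / M * (M * norm (v - w))"
      using eM by (intro mult_left_mono M) auto
    finally show ?thesis using M by (simp add: AB)
  qed
  have "openin (top_of_set K) (F ` ball 0 \<rho>)"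
  proof -
    have "open (B ` ball 0 \<rho>)"
      using linB injB by (intro open_surjective_linear_image) (auto simp: linear_injective_imp_surjective)
    then have "open ((+) u ` B ` ball 0 \<rho>)" by (rule open_translation)
    moreover have "(+) u ` B ` ball 0 \<rho> \<subseteq> W" using inball \<delta>(2) by blast
    ultimately have "openin (top_of_set W) ((+) u ` B ` ball 0 \<rho>)"
      by (simp add: openin_open_eq[OF W])
    then have "openin (top_of_set (\<phi> ` W)) (\<phi> ` (+) u ` B ` ball 0 \<rho>)"
      by (rule homeomorphism_imp_open_map[OF hom])
    then have "openin (top_of_set K) (\<phi> ` (+) u ` B ` ball 0 \<rho>)"
      using oin openin_trans by blast
    then show ?thesis by (simp add: F_def image_image)
  qed
  moreover have "F 0 = \<phi> u" by (simp add: F_def linear_0[OF linB])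
  moreover have "(1 - e) * dist v w \<le> dist (F v) (F w) \<and> dist (F v) (F w) \<le> (1 + e) * dist v w"
    if "v \<in> ball 0 \<rho>" "w \<in> ball 0 \<rho>" for v w
    using est[OF that] fnorm[of "v - w"] norm_triangle_ineq2[of "F v - F w" "f (v - w)"]
      norm_triangle_ineq2[of "f (v - w)" "F v - F w"]
    by (simp add: dist_norm norm_minus_commute algebra_simps)
  ultimately show thesis using that \<rho> by blast
qed

section \<open>Asymptotic flatness\<close>

text \<open>The bounds that an almost isometric chart with distortion \<open>e\<close> gives for the measure of \<open>K \<inter> cball x r\<close>:
one factor comes from the change of the radius, the other one from the change of the measure.\<close>

definition flat_ball :: "'s::finite itself \<Rightarrow> (real ^ 'd) set \<Rightarrow> real \<Rightarrow> real ^ 'd \<Rightarrow> real \<Rightarrow> bool" where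
  "flat_ball S K e x r \<longleftrightarrow>
     ennreal (unit_ball_vol (real CARD('s)) * (r * (1 - e) / (1 + e)) ^ CARD('s))
       \<le> emeasure (hausdorff S) (cball x r \<inter> K) \<and>
     emeasure (hausdorff S) (cball x r \<inter> K)
       \<le> ennreal (unit_ball_vol (real CARD('s)) * (r * (1 + e) / (1 - e)) ^ CARD('s))"

lemma C11_ball_measure_local:
  fixes K :: "(real ^ 'd::finite) set"
  assumes "closed K" and chart: "C11_local_parametrization K W \<phi>" and x0: "x0 \<in> \<phi> ` (W :: (real ^ 's::finite) set)"
    and e: "0 < e" "e < 1"
  obtains \<eta> where "0 < \<eta>" "\<And>x r. x \<in> K \<Longrightarrow> x \<in> ball x0 \<eta> \<Longrightarrow> 0 < r \<Longrightarrow> r < \<eta> \<Longrightarrow>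
     flat_ball TYPE('s) K e x r"
proof -
  let ?v = "unit_ball_vol (real CARD('s))"
  let ?H = "emeasure (hausdorff TYPE('s)) :: (real ^ 'd) set \<Rightarrow> ennreal"
  obtain u where u: "u \<in> W" "x0 = \<phi> u" using x0 by blast
  obtain F :: "real ^ 's \<Rightarrow> real ^ 'd" and \<rho> where \<rho>: "0 < \<rho>"
    and oin: "openin (top_of_set K) (F ` ball 0 \<rho>)" and F0: "F 0 = x0"
    and biL: "\<And>v w. v \<in> ball 0 \<rho> \<Longrightarrow> w \<in> ball 0 \<rho> \<Longrightarrow>
       (1 - e) * dist v w \<le> dist (F v) (F w) \<and> dist (F v) (F w) \<le> (1 + e) * dist v w"
    using C11_chart_almost_isometry[OF chart u(1) e(1)] u(2) by metis
  obtain T where T: "open T" "F ` ball 0 \<rho> = K \<inter> T" using oin by (auto simp: openin_open)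
  have "F 0 \<in> F ` ball 0 \<rho>" using \<rho> by (intro imageI) simp
  then have "x0 \<in> T" using T F0 by blast
  then obtain \<eta>0 where \<eta>0: "0 < \<eta>0" "ball x0 \<eta>0 \<subseteq> T" using T(1) open_contains_ball by blast
  \<comment> \<open>the first bound keeps \<open>K \<inter> cball x r\<close> in the range of \<open>F\<close>, the second one keeps \<open>v\<close> and the balls around \<open>v\<close> in the domain of \<open>F\<close>\<close>
  define \<eta> where "\<eta> = min (\<eta>0 / 2) ((1 - e) * \<rho> / 4)"
  have \<eta>: "0 < \<eta>" "\<eta> \<le> \<eta>0 / 2" "\<eta> \<le> (1 - e) * \<rho> / 4" using \<eta>0 e \<rho> by (auto simp: \<eta>_def)
  show thesis
  proof (rule that[OF \<eta>(1)], unfold flat_ball_def, intro conjI)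
    fix x r assume x: "x \<in> K" "x \<in> ball x0 \<eta>" and r: "0 < r" "r < \<eta>"
    have ball: "y \<in> F ` ball 0 \<rho>" if "y \<in> K" "dist x0 y < \<eta>0" for y
      using that T \<eta>0 by auto
    have "x \<in> F ` ball 0 \<rho>" using x \<eta> \<eta>0 by (intro ball) auto
    then obtain v where v: "v \<in> ball 0 \<rho>" "x = F v" by blast
    have "(1 - e) * dist 0 v \<le> dist x0 x"
      using biL[of 0 v] \<rho> v F0 by auto
    also have "\<dots> < (1 - e) * (\<rho> / 4)" using x \<eta> by auto
    finally have nv: "norm v < \<rho> / 4" using e by (simp add: mult_less_cancel_left)
    have sub: "cball v R \<subseteq> ball 0 \<rho>" if "R \<le> \<rho> / 4" for R
    proof
      fix w assume "w \<in> cball v R"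
      then have "norm w \<le> norm v + R" using norm_triangle_sub[of w v] by (simp add: dist_norm norm_minus_commute)
      then show "w \<in> ball 0 \<rho>" using nv that \<rho> by simp
    qed
    have closed: "cball x r \<inter> K \<in> sets borel" using \<open>closed K\<close> by (auto intro: borel_closed)
    have R1: "r / (1 - e) \<le> \<rho> / 4" using r \<eta> e by (simp add: field_simps)
    have "r / (1 + e) \<le> r" using r e by (simp add: field_simps)
    moreover have "(1 - e) * \<rho> \<le> \<rho>" using e \<rho> by simp
    ultimately have R2: "r / (1 + e) \<le> \<rho> / 4" using r \<eta> by linarith
    have "ennreal (?v * ((r / (1 + e)) / (1 / (1 - e))) ^ CARD('s)) \<le>
        ?H (cball x r \<inter> K)"
    proof (rule hausdorff_ge_lipschitz_image_cball[OF closed])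
      show "F ` cball v (r / (1 + e)) \<subseteq> cball x r \<inter> K"
      proof (rule image_subsetI)
        fix w assume w: "w \<in> cball v (r / (1 + e))"
        then have wr: "w \<in> ball 0 \<rho>" using sub[OF R2] by blast
        have "dist (F v) (F w) \<le> (1 + e) * dist v w" using biL v wr by blast
        also have "\<dots> \<le> r" using w e by (simp add: field_simps)
        finally show "F w \<in> cball x r \<inter> K" using T(2) wr v(2) by auto
      qed
      show "dist w w' \<le> 1 / (1 - e) * dist (F w) (F w')"
        if "w \<in> cball v (r / (1 + e))" "w' \<in> cball v (r / (1 + e))" for w w'
      proof -
        have "w \<in> ball 0 \<rho>" "w' \<in> ball 0 \<rho>" using that sub[OF R2] by blast+
        then have "(1 - e) * dist w w' \<le> dist (F w) (F w')" using biL by blast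
        then show ?thesis using e by (simp add: field_simps)
      qed
    qed (use r e in auto)
    then show "ennreal (?v * (r * (1 - e) / (1 + e)) ^ CARD('s)) \<le> ?H (cball x r \<inter> K)"
      by simp
    have "?H (cball x r \<inter> K) \<le>
        ennreal (?v * ((1 + e) * (r / (1 - e))) ^ CARD('s))"
    proof (rule hausdorff_le_lipschitz_image_cball[OF closed])
      show "cball x r \<inter> K \<subseteq> F ` cball v (r / (1 - e))"
      proof
        fix y assume y: "y \<in> cball x r \<inter> K"
        have "dist x0 y < \<eta>0" using dist_triangle[of x0 y x] x y r \<eta> by auto
        then obtain w where w: "w \<in> ball 0 \<rho>" "y = F w" using ball y by blast
        have "(1 - e) * dist v w \<le> r" using biL[OF v(1) w(1)] v w y by auto
        then have "w \<in> cball v (r / (1 - e))" using e by (simp add: field_simps)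
        then show "y \<in> F ` cball v (r / (1 - e))" using w by blast
      qed
      show "dist (F w) (F w') \<le> (1 + e) * dist w w'"
        if "w \<in> cball v (r / (1 - e))" "w' \<in> cball v (r / (1 - e))" for w w'
      proof -
        have "w \<in> ball 0 \<rho>" "w' \<in> ball 0 \<rho>" using that sub[OF R1] by blast+
        then show ?thesis using biL by blast
      qed
    qed (use r e in auto)
    then show "?H (cball x r \<inter> K) \<le> ennreal (?v * (r * (1 + e) / (1 - e)) ^ CARD('s))"
      by (simp add: mult.commute)
  qed
qed

lemma C11_ball_measure_uniform:
  fixes K :: "(real ^ 'd::finite) set"
  assumes "compact K" and charts: "\<And>x. x \<in> K \<Longrightarrow> \<exists>(W :: (real ^ 's::finite) set) \<phi>. C11_local_parametrization K W \<phi> \<and> x \<in> \<phi> ` W"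
    and e: "0 < e" "e < 1"
  obtains \<eta> where "0 < \<eta>" "\<And>x r. x \<in> K \<Longrightarrow> 0 < r \<Longrightarrow> r < \<eta> \<Longrightarrow>
     flat_ball TYPE('s) K e x r"
proof -
  have "\<exists>\<eta>>0. \<forall>x r. x \<in> K \<longrightarrow> x \<in> ball x0 \<eta> \<longrightarrow> 0 < r \<longrightarrow> r < \<eta> \<longrightarrow> flat_ball TYPE('s) K e x r" if x0: "x0 \<in> K" for x0
  proof -
    obtain W :: "(real ^ 's::finite) set" and \<phi> where "C11_local_parametrization K W \<phi>" "x0 \<in> \<phi> ` W"
      using charts[OF x0] by blast
    from C11_ball_measure_local[OF compact_imp_closed[OF \<open>compact K\<close>] this e] show ?thesis
      by metis
  qed
  then obtain h where h: "\<And>x0. x0 \<in> K \<Longrightarrow> 0 < h x0"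
    "\<And>x0 x r. x0 \<in> K \<Longrightarrow> x \<in> K \<Longrightarrow> x \<in> ball x0 (h x0) \<Longrightarrow> 0 < r \<Longrightarrow> r < h x0 \<Longrightarrow> flat_ball TYPE('s) K e x r"
    by metis
  have "K \<subseteq> (\<Union>x\<in>K. ball x (h x))" using h(1) by force
  then obtain C where C: "C \<subseteq> K" "finite C" "K \<subseteq> (\<Union>x\<in>C. ball x (h x))"
    using compactE_image[OF \<open>compact K\<close>, of K "\<lambda>x. ball x (h x)"] by (metis open_ball)
  define \<eta> where "\<eta> = Min (insert 1 (h ` C))"
  have \<eta>: "0 < \<eta>" "\<And>c. c \<in> C \<Longrightarrow> \<eta> \<le> h c" unfolding \<eta>_def using C h(1) by auto
  have "flat_ball TYPE('s) K e x r" if x: "x \<in> K" and r: "0 < r" "r < \<eta>" for x r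
  proof -
    obtain c where c: "c \<in> C" "x \<in> ball c (h c)" using C(3) x by blast
    show ?thesis
      by (rule h(2)[OF _ x c(2) r(1)]) (use c C(1) \<eta>(2)[OF c(1)] r in auto)
  qed
  then show thesis using that[OF \<eta>(1)] by blast
qed

text \<open>The quotients in \<^const>\<open>flat_ball\<close> tend to \<open>1\<close> as \<open>e\<close> tends to \<open>0\<close>. A fixed value of \<open>e\<close> already
shows that the measure of \<open>K\<close> is positive and finite.\<close>

theorem C11_asymptotically_flat:
  fixes K :: "(real ^ 'd::finite) set"
  assumes "compact K" "K \<noteq> {}"
    and charts: "\<And>x. x \<in> K \<Longrightarrow> \<exists>(W :: (real ^ 's::finite) set) \<phi>. C11_local_parametrization K W \<phi> \<and> x \<in> \<phi> ` W"
  shows "asymptotically_flat_regular TYPE('s) K"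
proof -
  let ?H = "hausdorff TYPE('s) :: (real ^ 'd) measure" and ?s = "CARD('s)" and ?v = "unit_ball_vol (real CARD('s))"
  have v: "0 < ?v" by simp
  have unif: "\<exists>\<eta>>0. \<forall>x r. x \<in> K \<longrightarrow> 0 < r \<longrightarrow> r < \<eta> \<longrightarrow> flat_ball TYPE('s) K e x r"
    if "0 < e" "e < 1" for e
    using C11_ball_measure_uniform[OF \<open>compact K\<close> charts that] by metis
  have Kb: "K \<in> sets borel" using \<open>compact K\<close> by (simp add: borel_compact)
  obtain \<eta> where \<eta>: "0 < \<eta>" "\<And>x r. x \<in> K \<Longrightarrow> 0 < r \<Longrightarrow> r < \<eta> \<Longrightarrow>
     ennreal (?v * (r * (1 - 1/2) / (1 + 1/2)) ^ ?s) \<le> emeasure ?H (cball x r \<inter> K) \<and>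
     emeasure ?H (cball x r \<inter> K) \<le> ennreal (?v * (r * (1 + 1/2) / (1 - 1/2)) ^ ?s)"
    using unif[of "1/2"] unfolding flat_ball_def by auto
  define r0 where "r0 = \<eta> / 2"
  have r0: "0 < r0" "r0 < \<eta>" using \<eta>(1) by (auto simp: r0_def)
  have pos: "0 < emeasure ?H K"
  proof -
    obtain x where x: "x \<in> K" using \<open>K \<noteq> {}\<close> by blast
    have "0 < ennreal (?v * (r0 * (1 - 1/2) / (1 + 1/2)) ^ ?s)" using r0 v by simp
    also have "\<dots> \<le> emeasure ?H (cball x r0 \<inter> K)" using \<eta>(2)[OF x r0] by blast
    also have "\<dots> \<le> emeasure ?H K" using Kb by (intro emeasure_mono) auto
    finally show ?thesis .
  qed
  have fin: "emeasure ?H K < \<infinity>"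
  proof -
    have "K \<subseteq> (\<Union>x\<in>K. ball x r0)" using r0 by force
    then obtain C where C: "C \<subseteq> K" "finite C" "K \<subseteq> (\<Union>x\<in>C. ball x r0)"
      using compactE_image[OF \<open>compact K\<close>, of K "\<lambda>x. ball x r0"] by (metis open_ball)
    have "K \<subseteq> (\<Union>x\<in>C. cball x r0 \<inter> K)" using C(3) ball_subset_cball by blast
    moreover have "(\<Union>x\<in>C. cball x r0 \<inter> K) \<in> sets ?H"
      unfolding sets_hausdorff using Kb C(2) by (intro sets.finite_UN) auto
    ultimately have "emeasure ?H K \<le> emeasure ?H (\<Union>x\<in>C. cball x r0 \<inter> K)"
      by (rule emeasure_mono)
    also have "\<dots> \<le> (\<Sum>x\<in>C. emeasure ?H (cball x r0 \<inter> K))"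
      using Kb C(2) by (intro emeasure_subadditive_finite) auto
    also have "\<dots> \<le> (\<Sum>x\<in>C. ennreal (?v * (r0 * (1 + 1/2) / (1 - 1/2)) ^ ?s))"
      using \<eta>(2) r0 C(1) by (intro sum_mono) blast
    also have "\<dots> < \<infinity>" using r0 v by (simp add: ennreal_mult_less_top of_nat_less_top)
    finally show ?thesis .
  qed
  have "uniform_limit K (\<lambda>r x. measure ?H (cball x r \<inter> K) / r ^ ?s) (\<lambda>_. ?v) (at_right 0)"
  proof (rule uniform_limitI)
    fix \<epsilon> :: real assume \<epsilon>: "0 < \<epsilon>"
    have "((\<lambda>e::real. ?v * ((1 + e) / (1 - e)) ^ ?s) \<longlongrightarrow> ?v * ((1 + 0) / (1 - 0)) ^ ?s) (at_right 0)"
      by (intro tendsto_intros) auto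
    then have "\<forall>\<^sub>F e in at_right 0. ?v * ((1 + e) / (1 - e)) ^ ?s < ?v + \<epsilon>"
      by (rule order_tendstoD) (use \<epsilon> in simp)
    moreover
    have "((\<lambda>e::real. ?v * ((1 - e) / (1 + e)) ^ ?s) \<longlongrightarrow> ?v * ((1 - 0) / (1 + 0)) ^ ?s) (at_right 0)"
      by (intro tendsto_intros) auto
    then have "\<forall>\<^sub>F e in at_right 0. ?v - \<epsilon> < ?v * ((1 - e) / (1 + e)) ^ ?s"
      by (rule order_tendstoD) (use \<epsilon> in simp)
    moreover have "\<forall>\<^sub>F e in at_right 0. (0::real) < e \<and> e < 1"
      by (auto simp: eventually_at_right[of 0 1] intro!: exI[of _ 1])
    ultimately have "\<forall>\<^sub>F e in at_right 0. ?v * ((1 + e) / (1 - e)) ^ ?s < ?v + \<epsilon> \<and>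
        ?v - \<epsilon> < ?v * ((1 - e) / (1 + e)) ^ ?s \<and> (0::real) < e \<and> e < 1"
      by eventually_elim auto
    then obtain e where e: "?v * ((1 + e) / (1 - e)) ^ ?s < ?v + \<epsilon>"
        "?v - \<epsilon> < ?v * ((1 - e) / (1 + e)) ^ ?s" "(0::real) < e" "e < 1"
      using eventually_happens'[OF trivial_limit_at_right_real[of "0::real"]] by blast
    obtain \<eta> where \<eta>: "0 < \<eta>" "\<And>x r. x \<in> K \<Longrightarrow> 0 < r \<Longrightarrow> r < \<eta> \<Longrightarrow>
       ennreal (?v * (r * (1 - e) / (1 + e)) ^ ?s) \<le> emeasure ?H (cball x r \<inter> K) \<and>
       emeasure ?H (cball x r \<inter> K) \<le> ennreal (?v * (r * (1 + e) / (1 - e)) ^ ?s)"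
      using unif[OF e(3,4)] unfolding flat_ball_def by auto
    have "dist (measure ?H (cball x r \<inter> K) / r ^ ?s) ?v < \<epsilon>" if x: "x \<in> K" and r: "0 < r" "r < \<eta>" for x r
    proof -
      let ?m = "measure ?H (cball x r \<inter> K)"
      have "emeasure ?H (cball x r \<inter> K) \<noteq> top"
        using \<eta>(2)[OF x r] by (metis ennreal_less_top le_less_trans less_irrefl)
      then have em: "emeasure ?H (cball x r \<inter> K) = ennreal ?m"
        by (rule emeasure_eq_ennreal_measure)
      have up: "0 \<le> ?v * (r * (1 + e) / (1 - e)) ^ ?s" using e r by simp
      have "?v * (r * (1 - e) / (1 + e)) ^ ?s \<le> ?m" "?m \<le> ?v * (r * (1 + e) / (1 - e)) ^ ?s"
        using \<eta>(2)[OF x r] unfolding em ennreal_le_iff[OF measure_nonneg] ennreal_le_iff[OF up] by simp_all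
      then have "?v * ((1 - e) / (1 + e)) ^ ?s \<le> ?m / r ^ ?s" "?m / r ^ ?s \<le> ?v * ((1 + e) / (1 - e)) ^ ?s"
        using r unfolding times_divide_eq_right[symmetric] power_mult_distrib[of r]
        by (simp_all add: pos_le_divide_eq pos_divide_le_eq ac_simps)
      then show ?thesis using e by (simp add: dist_real_def abs_less_iff)
    qed
    then show "\<forall>\<^sub>F r in at_right 0. \<forall>x\<in>K. dist (measure ?H (cball x r \<inter> K) / r ^ ?s) ?v < \<epsilon>"
      using \<eta>(1) by (auto simp: eventually_at_right[of 0 1] intro!: exI[of _ \<eta>])
  qed
  then show ?thesis
    unfolding asymptotically_flat_regular_def using \<open>compact K\<close> pos fin by simp
qed

section \<open>The covering radius of a finite set\<close>

lemma min_dist_lipschitz: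
  assumes "finite X" "X \<noteq> {}"
  shows "(MIN x\<in>X. dist y x) \<le> dist y z + (MIN x\<in>X. dist z x)"
proof -
  have "(MIN x\<in>X. dist z x) \<in> dist z ` X" using assms by (intro Min_in) auto
  then obtain x where x: "x \<in> X" "(MIN x\<in>X. dist z x) = dist z x" by auto
  have "(MIN x\<in>X. dist y x) \<le> dist y x" using assms x by (intro Min_le) auto
  also have "\<dots> \<le> dist y z + dist z x" by (rule dist_triangle)
  finally show ?thesis using x by simp
qed

lemma bdd_above_min_dist:
  assumes "bounded K" "finite X" "X \<noteq> {}"
  shows "bdd_above ((\<lambda>y. MIN x\<in>X. dist y x) ` K)"
proof -
  obtain x where x: "x \<in> X" using assms by blast
  obtain b where b: "\<And>y. y \<in> K \<Longrightarrow> dist x y \<le> b"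
    using assms(1) unfolding bounded_any_center[of _ x] by blast
  have "(MIN x\<in>X. dist y x) \<le> b" if "y \<in> K" for y
  proof -
    have "(MIN x\<in>X. dist y x) \<le> dist y x" using assms x by (intro Min_le) auto
    then show ?thesis using b[OF that] by (simp add: dist_commute)
  qed
  then show ?thesis by (intro bdd_aboveI[of _ b]) auto
qed

lemma covering_radius_ge:
  assumes "bounded K" "finite X" "X \<noteq> {}" "y \<in> K" "\<And>x. x \<in> X \<Longrightarrow> r \<le> dist y x"
  shows "r \<le> covering_radius X K"
proof -
  have "r \<le> (MIN x\<in>X. dist y x)" using assms by (intro Min.boundedI) auto
  then show ?thesis
    unfolding covering_radius_def
    by (intro cSUP_upper2[OF bdd_above_min_dist[OF assms(1-3)] assms(4)])
qed

lemma covering_radius_nonneg: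
  assumes "bounded K" "finite X" "X \<noteq> {}" "K \<noteq> {}"
  shows "0 \<le> covering_radius X K"
  using covering_radius_ge[OF assms(1-3), of _ 0] assms(4) by auto

lemma covering_radius_le:
  assumes "K \<noteq> {}" "finite X" "\<And>y. y \<in> K \<Longrightarrow> \<exists>x\<in>X. dist y x \<le> r"
  shows "covering_radius X K \<le> r"
  unfolding covering_radius_def
proof (rule cSUP_least[OF assms(1)])
  fix y assume "y \<in> K"
  then obtain x where "x \<in> X" "dist y x \<le> r" using assms(3) by blast
  then show "(MIN x\<in>X. dist y x) \<le> r"
    using assms(2) by (meson Min_le finite_imageI imageI order_trans)
qed

text \<open>For countable \<open>T\<close> this is a countable supremum, which makes the covering radius measurable.\<close>

lemma covering_radius_dense:
  assumes "bounded K" "finite X" "X \<noteq> {}" "T \<subseteq> K" "K \<subseteq> closure T"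
  shows "covering_radius X K = (SUP y\<in>T. MIN x\<in>X. dist y x)"
proof (cases "T = {}")
  case True
  then show ?thesis using assms by (simp add: covering_radius_def)
next
  case False
  let ?f = "\<lambda>y. MIN x\<in>X. dist y x"
  have bdd: "bdd_above (?f ` K)" by (rule bdd_above_min_dist[OF assms(1-3)])
  have bddT: "bdd_above (?f ` T)" using bdd assms(4) by (meson bdd_above_mono image_mono)
  show ?thesis
    unfolding covering_radius_def
  proof (rule antisym)
    show "(SUP y\<in>T. ?f y) \<le> (SUP y\<in>K. ?f y)"
      using False assms(4) bdd by (intro cSUP_subset_mono) auto
    show "(SUP y\<in>K. ?f y) \<le> (SUP y\<in>T. ?f y)"
    proof (rule cSUP_least)
      fix y assume "y \<in> K"
      then have cl: "y \<in> closure T" using assms(5) by blast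
      show "?f y \<le> (SUP y\<in>T. ?f y)"
      proof (rule field_le_epsilon)
        fix e :: real assume "0 < e"
        then obtain z where z: "z \<in> T" "dist z y < e"
          using cl by (meson closure_approachable)
        have "?f y \<le> dist y z + ?f z" by (rule min_dist_lipschitz[OF assms(2,3)])
        also have "?f z \<le> (SUP y\<in>T. ?f y)" by (rule cSUP_upper[OF z(1) bddT])
        finally show "?f y \<le> (SUP y\<in>T. ?f y) + e" using z(2) by (simp add: dist_commute)
      qed
    qed (use False assms(4) in auto)
  qed
qed

lemma covering_radius_measurable:
  fixes K :: "'a::euclidean_space set" and N :: nat
  assumes "bounded K" "0 < N" and sets: "sets M = sets borel"
  shows "(\<lambda>\<omega>. covering_radius (\<omega> ` {..<N}) K) \<in> borel_measurable (\<Pi>\<^sub>M i\<in>{..<N}. M)"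
proof -
  obtain T where T: "countable T" "T \<subseteq> K" "K \<subseteq> closure T"
    using separable by metis
  have ne: "\<omega> ` {..<N} \<noteq> {}" for \<omega> :: "nat \<Rightarrow> 'a" using \<open>0 < N\<close> by auto
  have eq: "covering_radius (\<omega> ` {..<N}) K = (SUP y\<in>T. Min ((\<lambda>i. dist y (\<omega> i)) ` {..<N}))" for \<omega> :: "nat \<Rightarrow> 'a"
    unfolding covering_radius_dense[OF assms(1) _ ne T(2,3), simplified] image_image ..
  have comp: "(\<lambda>\<omega>. \<omega> i) \<in> borel_measurable (\<Pi>\<^sub>M i\<in>{..<N}. M)" if "i < N" for i
    using measurable_component_singleton[of i "{..<N}" "\<lambda>_. M"] that
    by (simp cong: measurable_cong_sets add: sets)
  have "(\<lambda>\<omega>. dist y (\<omega> i)) \<in> borel_measurable (\<Pi>\<^sub>M i\<in>{..<N}. M)" if "i < N" for i y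
    by (rule borel_measurable_dist[OF borel_measurable_const comp[OF that]])
  then have "(\<lambda>\<omega>. Min ((\<lambda>i. dist y (\<omega> i)) ` {..<N})) \<in> borel_measurable (\<Pi>\<^sub>M i\<in>{..<N}. M)" for y
    by (intro borel_measurable_Min) auto
  moreover have "bdd_above ((\<lambda>y. Min ((\<lambda>i. dist y (\<omega> i)) ` {..<N})) ` T)" for \<omega> :: "nat \<Rightarrow> 'a"
    using bdd_above_min_dist[OF bounded_subset[OF assms(1) T(2)] _ ne, of \<omega>] by (simp add: image_image)
  ultimately show ?thesis
    unfolding eq by (intro borel_measurable_cSUP T(1)) auto
qed

section \<open>Avoiding and hitting sets with independent points\<close>

lemma prob_avoid:
  assumes M: "prob_space M" and A: "A \<in> sets M"
  shows "measure (\<Pi>\<^sub>M i\<in>{..<N}. M) {\<omega> \<in> space (\<Pi>\<^sub>M i\<in>{..<N}. M). \<forall>i<N. \<omega> i \<notin> A} = (1 - measure M A) ^ N"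
    and "{\<omega> \<in> space (\<Pi>\<^sub>M i\<in>{..<N}. M). \<forall>i<N. \<omega> i \<notin> A} \<in> sets (\<Pi>\<^sub>M i\<in>{..<N}. M)"
proof -
  interpret M: prob_space M by fact
  interpret P: finite_product_prob_space "\<lambda>_. M" "{..<N}"
    by (intro finite_product_prob_space.intro finite_product_sigma_finite.intro product_prob_space.intro
        product_sigma_finite.intro finite_product_sigma_finite_axioms.intro product_prob_space_axioms.intro
        M.sigma_finite_measure_axioms M) auto
  have eq: "{\<omega> \<in> space (\<Pi>\<^sub>M i\<in>{..<N}. M). \<forall>i<N. \<omega> i \<notin> A} = (\<Pi>\<^sub>E i\<in>{..<N}. space M - A)"
    unfolding space_PiM by (rule set_eqI) (simp only: mem_Collect_eq PiE_iff lessThan_iff Diff_iff Ball_def, blast)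
  show "measure (\<Pi>\<^sub>M i\<in>{..<N}. M) {\<omega> \<in> space (\<Pi>\<^sub>M i\<in>{..<N}. M). \<forall>i<N. \<omega> i \<notin> A} = (1 - measure M A) ^ N"
    unfolding eq using A by (subst P.prob_times) (auto simp: M.prob_compl)
  show "{\<omega> \<in> space (\<Pi>\<^sub>M i\<in>{..<N}. M). \<forall>i<N. \<omega> i \<notin> A} \<in> sets (\<Pi>\<^sub>M i\<in>{..<N}. M)"
    unfolding eq using A by (intro sets_PiM_I_finite) auto
qed

text \<open>Let \<open>X\<close> be the number of sets \<open>B z\<close> that no sample point hits, and \<open>\<mu>\<close> its expectation. As the
sets are disjoint, missing \<open>B z\<close> and missing \<open>B w\<close> are negatively correlated, so the variance of \<open>X\<close>
is at most \<open>\<mu>\<close>. Chebyshev's inequality bounds the probability of \<open>X = 0\<close> by \<open>1 / \<mu>\<close>.\<close>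

lemma prob_all_hit_le:
  fixes N :: nat
  assumes M: "prob_space M" and Z: "finite Z" and B: "\<And>z. z \<in> Z \<Longrightarrow> B z \<in> sets M"
    and disj: "disjoint_family_on B Z"
  defines "P \<equiv> \<Pi>\<^sub>M i\<in>{..<N}. M"
  shows "measure P {\<omega> \<in> space P. \<forall>z\<in>Z. \<exists>i<N. \<omega> i \<in> B z} * (\<Sum>z\<in>Z. (1 - measure M (B z)) ^ N) \<le> 1"
proof -
  interpret M: prob_space M by fact
  interpret P: prob_space P unfolding P_def by (intro prob_space_PiM M)
  define E where "E A = {\<omega> \<in> space P. \<forall>i<N. \<omega> i \<notin> A}" for A
  have Em: "E A \<in> sets P" and Ep: "P.prob (E A) = (1 - measure M A) ^ N" if "A \<in> sets M" for A
    unfolding E_def P_def by (rule prob_avoid[OF M that])+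
  define q where "q z = (1 - measure M (B z)) ^ N" for z
  define \<mu> where "\<mu> = (\<Sum>z\<in>Z. q z)"
  define X :: "_ \<Rightarrow> real" where "X \<omega> = (\<Sum>z\<in>Z. indicator (E (B z)) \<omega>)" for \<omega>
  have q0: "0 \<le> q z" for z by (simp add: q_def)
  have \<mu>0: "0 \<le> \<mu>" by (simp add: \<mu>_def sum_nonneg q0)
  have int1: "integrable P (indicator (E (B z)) :: _ \<Rightarrow> real)" if "z \<in> Z" for z
    using Em[OF B[OF that]] by (intro P.integrable_const_bound[of _ 1]) auto
  have EX: "P.expectation X = \<mu>"
    unfolding X_def \<mu>_def q_def using int1 Em B Ep by (subst Bochner_Integration.integral_sum) auto
  have iX: "integrable P X" unfolding X_def using int1 by auto
  have X2: "(X \<omega>)\<^sup>2 = (\<Sum>z\<in>Z. \<Sum>w\<in>Z. indicator (E (B z \<union> B w)) \<omega>)" for \<omega>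
    unfolding X_def power2_eq_square sum_product
    by (intro sum.cong refl) (auto simp: indicator_def E_def)
  have int2: "integrable P (indicator (E (B z \<union> B w)) :: _ \<Rightarrow> real)" if "z \<in> Z" "w \<in> Z" for z w
    using Em B that by (intro P.integrable_const_bound[of _ 1]) auto
  have iX2: "integrable P (\<lambda>\<omega>. (X \<omega>)\<^sup>2)"
    unfolding X2 using int2 by (intro Bochner_Integration.integrable_sum)
  have pair: "P.prob (E (B z \<union> B w)) \<le> q z * q w + (if z = w then q z else 0)" if zw: "z \<in> Z" "w \<in> Z" for z w
  proof (cases "z = w")
    case True
    then show ?thesis using Ep[OF B[OF zw(1)]] q0[of z] by (simp add: q_def)
  next
    case False
    then have "B z \<inter> B w = {}" using disj zw by (auto simp: disjoint_family_on_def)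
    then have un: "measure M (B z \<union> B w) = measure M (B z) + measure M (B w)"
      using B zw by (intro M.finite_measure_Union) auto
    have "P.prob (E (B z \<union> B w)) = (1 - measure M (B z \<union> B w)) ^ N"
      using B zw by (intro Ep) auto
    also have "\<dots> \<le> ((1 - measure M (B z)) * (1 - measure M (B w))) ^ N"
      using M.prob_le_1[of "B z \<union> B w"] by (intro power_mono) (simp_all add: un algebra_simps)
    finally show ?thesis using False by (simp add: q_def power_mult_distrib)
  qed
  have "P.expectation (\<lambda>\<omega>. (X \<omega>)\<^sup>2) = (\<Sum>z\<in>Z. \<Sum>w\<in>Z. P.prob (E (B z \<union> B w)))"
    unfolding X2 using int2 Em B by (simp add: Bochner_Integration.integral_sum Bochner_Integration.integrable_sum)
  also have "\<dots> \<le> (\<Sum>z\<in>Z. \<Sum>w\<in>Z. q z * q w + (if z = w then q z else 0))"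
    by (intro sum_mono pair)
  also have "\<dots> = \<mu>\<^sup>2 + \<mu>"
    using Z by (simp add: sum.distrib \<mu>_def power2_eq_square sum_product sum.delta')
  finally have EX2: "P.expectation (\<lambda>\<omega>. (X \<omega>)\<^sup>2) \<le> \<mu>\<^sup>2 + \<mu>" .
  let ?H = "{\<omega> \<in> space P. \<forall>z\<in>Z. \<exists>i<N. \<omega> i \<in> B z}"
  have H: "?H = space P - (\<Union>z\<in>Z. E (B z))" by (auto simp: E_def)
  have Hm: "?H \<in> sets P" unfolding H using Z Em B by (intro sets.Diff sets.finite_UN) auto
  \<comment> \<open>on \<open>?H\<close> the deviation \<open>X - \<mu>\<close> equals \<open>-\<mu>\<close>\<close>
  have "\<mu>\<^sup>2 * P.prob ?H = P.expectation (\<lambda>\<omega>. \<mu>\<^sup>2 * indicator ?H \<omega>)"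
    using Hm by simp
  also have "\<dots> \<le> P.expectation (\<lambda>\<omega>. (X \<omega>)\<^sup>2 - 2 * \<mu> * X \<omega> + \<mu>\<^sup>2)"
  proof (rule integral_mono)
    show "integrable P (\<lambda>\<omega>. \<mu>\<^sup>2 * indicator ?H \<omega>)"
      using Hm by (intro integrable_mult_right P.integrable_const_bound[of _ 1]) auto
    show "integrable P (\<lambda>\<omega>. (X \<omega>)\<^sup>2 - 2 * \<mu> * X \<omega> + \<mu>\<^sup>2)"
      using iX iX2 by auto
    fix \<omega>
    show "\<mu>\<^sup>2 * indicator ?H \<omega> \<le> (X \<omega>)\<^sup>2 - 2 * \<mu> * X \<omega> + \<mu>\<^sup>2"
    proof (cases "\<omega> \<in> ?H")
      case True
      then have "X \<omega> = 0" unfolding X_def by (intro sum.neutral) (auto simp: E_def)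
      then show ?thesis using True by simp
    next
      case False
      have "0 \<le> (X \<omega> - \<mu>)\<^sup>2" by simp
      then show ?thesis using False by (simp add: power2_diff algebra_simps)
    qed
  qed
  also have "\<dots> = P.expectation (\<lambda>\<omega>. (X \<omega>)\<^sup>2) - 2 * \<mu> * \<mu> + \<mu>\<^sup>2"
    using iX iX2 EX by (simp add: P.prob_space)
  also have "\<dots> \<le> \<mu>"
    using EX2 by (simp add: power2_eq_square algebra_simps)
  finally have "\<mu> * (P.prob ?H * \<mu>) \<le> \<mu> * 1" by (simp add: power2_eq_square ac_simps)
  then have "P.prob ?H * \<mu> \<le> 1"
    using \<mu>0 by (cases "\<mu> = 0") auto
  then show ?thesis by (simp add: \<mu>_def q_def)
qed

section \<open>Moments of the covering radius\<close>

text \<open>The balls around points of \<open>K\<close> have mass asymptotic to \<open>c r\<^sup>s\<close>, uniformly in the centre.\<close>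

locale uniform_density = prob_space M for M :: "'a::euclidean_space measure" +
  fixes K :: "'a set" and s :: nat and c :: real
  assumes sets_M: "sets M = sets borel"
    and compact_K: "compact K" and K_nonempty: "K \<noteq> {}" and prob_K: "prob K = 1"
    and s_pos: "0 < s" and c_pos: "0 < c"
    and density: "\<And>e. 0 < e \<Longrightarrow> \<exists>r0>0. \<forall>x\<in>K. \<forall>r. 0 < r \<and> r < r0 \<longrightarrow>
      (1 - e) * (c * r ^ s) \<le> prob (cball x r) \<and> prob (cball x r) \<le> (1 + e) * (c * r ^ s)"
begin

abbreviation sample :: "nat \<Rightarrow> (nat \<Rightarrow> 'a) measure" where
  "sample N \<equiv> \<Pi>\<^sub>M i\<in>{..<N}. M"

definition \<rho> :: "nat \<Rightarrow> (nat \<Rightarrow> 'a) \<Rightarrow> real" where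
  "\<rho> N \<omega> = covering_radius (\<omega> ` {..<N}) K"

abbreviation sample_prob :: "nat \<Rightarrow> ((nat \<Rightarrow> 'a) \<Rightarrow> bool) \<Rightarrow> real" where
  "sample_prob N P \<equiv> measure (sample N) {\<omega> \<in> space (sample N). P \<omega>}"

lemma prob_space_sample: "prob_space (sample N)"
  by (intro prob_space_PiM prob_space_axioms)

lemma cball_sets [simp]: "cball x r \<in> events"
  by (simp add: sets_M)

lemma space_M: "space M = UNIV"
  using sets_eq_imp_space_eq[OF sets_M] by simp

lemma bounded_K: "bounded K"
  using compact_K by (rule compact_imp_bounded)

lemma sample_ne: "0 < N \<Longrightarrow> \<omega> ` {..<N::nat} \<noteq> {}"
  by auto

lemma \<rho>_measurable: "0 < N \<Longrightarrow> \<rho> N \<in> borel_measurable (sample N)"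
  unfolding \<rho>_def[abs_def] by (rule covering_radius_measurable[OF bounded_K _ sets_M])

lemma \<rho>_nonneg: "0 < N \<Longrightarrow> 0 \<le> \<rho> N \<omega>"
  unfolding \<rho>_def by (intro covering_radius_nonneg bounded_K K_nonempty sample_ne) auto

lemma \<rho>_le_diameter: "0 < N \<Longrightarrow> AE \<omega> in sample N. \<rho> N \<omega> \<le> diameter K"
proof -
  assume N: "0 < N"
  have "AE x in M. x \<in> K"
    using compact_K by (intro AE_prob_1 prob_K)
  then have "AE \<omega> in sample N. \<omega> 0 \<in> K"
    using N by (intro AE_PiM_component prob_space_axioms) auto
  then show ?thesis
  proof eventually_elim
    case (elim \<omega>)
    have "dist y (\<omega> 0) \<le> diameter K" if "y \<in> K" for y
      using diameter_bounded_bound[OF bounded_K that elim] .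
    then show ?case
      unfolding \<rho>_def using N by (intro covering_radius_le K_nonempty) auto
  qed
qed

text \<open>If some point of \<open>K\<close> is farther than \<open>r + \<delta>\<close> from the sample, then the ball of radius \<open>r\<close> around a
nearby point of the net contains no sample point.\<close>

lemma prob_\<rho>_greater:
  assumes N: "0 < N" and Z: "finite Z" "K \<subseteq> (\<Union>z\<in>Z. ball z \<delta>)"
    and m: "\<And>z. z \<in> Z \<Longrightarrow> m \<le> prob (cball z r)"
  shows "sample_prob N (\<lambda>\<omega>. r + \<delta> < \<rho> N \<omega>) \<le> real (card Z) * (1 - m) ^ N"
proof -
  interpret P: prob_space "sample N" by (rule prob_space_sample)
  define E where "E z = {\<omega> \<in> space (sample N). \<forall>i<N. \<omega> i \<notin> cball z r}" for z
  have E: "E z \<in> P.events" "P.prob (E z) = (1 - prob (cball z r)) ^ N" for z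
    unfolding E_def by (rule prob_avoid[OF prob_space_axioms cball_sets])+
  have "{\<omega> \<in> space (sample N). r + \<delta> < \<rho> N \<omega>} \<subseteq> (\<Union>z\<in>Z. E z)"
  proof (rule subsetI, rule ccontr)
    fix \<omega> assume \<omega>: "\<omega> \<in> {\<omega> \<in> space (sample N). r + \<delta> < \<rho> N \<omega>}" "\<omega> \<notin> (\<Union>z\<in>Z. E z)"
    have "\<rho> N \<omega> \<le> r + \<delta>"
      unfolding \<rho>_def
    proof (rule covering_radius_le[OF K_nonempty])
      fix y assume "y \<in> K"
      then obtain z where z: "z \<in> Z" "dist z y < \<delta>" using Z(2) by auto
      then obtain i where i: "i < N" "dist z (\<omega> i) \<le> r" using \<omega> by (auto simp: E_def)
      have "dist y (\<omega> i) \<le> r + \<delta>" using z i dist_triangle3[of y "\<omega> i" z] by simp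
      then show "\<exists>x\<in>\<omega> ` {..<N}. dist y x \<le> r + \<delta>" using i by auto
    qed simp
    then show False using \<omega> by simp
  qed
  then have "P.prob {\<omega> \<in> space (sample N). r + \<delta> < \<rho> N \<omega>} \<le> P.prob (\<Union>z\<in>Z. E z)"
    using Z E by (intro P.finite_measure_mono sets.finite_UN) auto
  also have "\<dots> \<le> (\<Sum>z\<in>Z. P.prob (E z))"
    using Z E by (intro P.finite_measure_subadditive_finite) auto
  also have "\<dots> \<le> (\<Sum>z\<in>Z. (1 - m) ^ N)"
    unfolding E(2) by (intro sum_mono power_mono) (auto simp: m)
  finally show ?thesis by simp
qed

text \<open>If the covering radius is below \<open>r\<close>, then every ball of the packing contains a sample point.\<close>

lemma prob_\<rho>_less:
  assumes N: "0 < N" and Z: "finite Z" "Z \<subseteq> K" "\<And>x y. x \<in> Z \<Longrightarrow> y \<in> Z \<Longrightarrow> x \<noteq> y \<Longrightarrow> 2 * r < dist x y"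
    and q: "\<And>z. z \<in> Z \<Longrightarrow> q \<le> (1 - prob (cball z r)) ^ N"
  shows "sample_prob N (\<lambda>\<omega>. \<rho> N \<omega> < r) * (real (card Z) * q) \<le> 1"
proof -
  interpret P: prob_space "sample N" by (rule prob_space_sample)
  let ?H = "{\<omega> \<in> space (sample N). \<forall>z\<in>Z. \<exists>i<N. \<omega> i \<in> cball z r}"
  have disj: "disjoint_family_on (\<lambda>z. cball z r) Z" by (rule disjoint_cballs[OF Z(3)])
  have H: "?H = space (sample N) - (\<Union>z\<in>Z. {\<omega> \<in> space (sample N). \<forall>i<N. \<omega> i \<notin> cball z r})"
    by auto
  have Hm: "?H \<in> P.events"
    unfolding H using Z(1) by (intro sets.Diff sets.finite_UN prob_avoid[OF prob_space_axioms cball_sets]) auto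
  have "{\<omega> \<in> space (sample N). \<rho> N \<omega> < r} \<subseteq> ?H"
  proof (rule subsetI, rule ccontr)
    fix \<omega> assume \<omega>: "\<omega> \<in> {\<omega> \<in> space (sample N). \<rho> N \<omega> < r}" "\<omega> \<notin> ?H"
    then obtain z where z: "z \<in> Z" "\<And>i. i < N \<Longrightarrow> \<not> dist z (\<omega> i) \<le> r" by auto
    have "r \<le> \<rho> N \<omega>"
      unfolding \<rho>_def
    proof (rule covering_radius_ge[OF bounded_K _ sample_ne[OF N]])
      show "z \<in> K" using z Z by blast
      show "r \<le> dist z x" if "x \<in> \<omega> ` {..<N}" for x
        using z(2) that by force
    qed simp
    then show False using \<omega> by simp
  qed
  then have le: "P.prob {\<omega> \<in> space (sample N). \<rho> N \<omega> < r} \<le> P.prob ?H"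
    by (rule P.finite_measure_mono[OF _ Hm])
  have "real (card Z) * q \<le> (\<Sum>z\<in>Z. (1 - prob (cball z r)) ^ N)"
    using sum_bounded_below[of Z q "\<lambda>z. (1 - prob (cball z r)) ^ N"] q by simp
  then have "P.prob {\<omega> \<in> space (sample N). \<rho> N \<omega> < r} * (real (card Z) * q) \<le>
      P.prob {\<omega> \<in> space (sample N). \<rho> N \<omega> < r} * (\<Sum>z\<in>Z. (1 - prob (cball z r)) ^ N)"
    by (rule mult_left_mono) simp
  also have "\<dots> \<le> P.prob ?H * (\<Sum>z\<in>Z. (1 - prob (cball z r)) ^ N)"
    by (rule mult_right_mono[OF le]) (auto intro!: sum_nonneg)
  also have "\<dots> \<le> 1"
    by (rule prob_all_hit_le[OF prob_space_axioms Z(1) _ disj]) simp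
  finally show ?thesis .
qed

text \<open>The radius \<open>r\<close> that solves \<open>N c r\<^sup>s = \<alpha> ln N\<close>. The threshold is at \<open>\<alpha> = 1\<close>.\<close>

definition rad :: "real \<Rightarrow> nat \<Rightarrow> real" where
  "rad \<alpha> N = (\<alpha> / c * (ln (real N) / real N)) powr (1 / real s)"

lemma rad_pos: "0 < \<alpha> \<Longrightarrow> 2 \<le> N \<Longrightarrow> 0 < rad \<alpha> N"
  using c_pos by (simp add: rad_def)

lemma rad_power: "0 < \<alpha> \<Longrightarrow> 2 \<le> N \<Longrightarrow> rad \<alpha> N ^ s = \<alpha> / c * (ln (real N) / real N)"
  using c_pos s_pos rad_pos[of \<alpha> N]
  by (simp add: powr_realpow[symmetric] powr_powr rad_def)

lemma rad_tendsto: "0 < \<alpha> \<Longrightarrow> rad \<alpha> \<longlonglongrightarrow> 0"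
proof -
  assume "0 < \<alpha>"
  have "(\<lambda>N. \<alpha> / c * (ln (real N) / real N)) \<longlonglongrightarrow> \<alpha> / c * 0"
    by (rule tendsto_mult[OF tendsto_const]) real_asymp
  then show ?thesis
    unfolding rad_def[abs_def] using s_pos c_pos \<open>0 < \<alpha>\<close>
    by (intro tendsto_zero_powrI[where b = "1 / real s"] tendsto_const eventually_sequentiallyI[of 1]) auto
qed

lemma rad_small:
  assumes "0 < \<alpha>" "0 < k" "0 < r"
  shows "\<forall>\<^sub>F N in sequentially. k * rad \<alpha> N < r"
proof -
  have "\<forall>\<^sub>F N in sequentially. rad \<alpha> N < r / k"
    using assms by (intro order_tendstoD(2)[OF rad_tendsto]) auto
  then show ?thesis
    by eventually_elim (use assms in \<open>simp add: field_simps\<close>)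
qed

text \<open>A net of mesh \<open>\<eta> r\<close> has \<open>O(N)\<close> points for \<open>r = rad \<alpha> N\<close>, and each ball of radius \<open>r\<close> is missed with
probability at most \<open>N\<close> to the power \<open>-(1 - e) \<alpha>\<close>.\<close>

lemma \<rho>_upper_tail:
  assumes \<alpha>: "0 < \<alpha>" and e: "0 < e" "e < 1" and \<eta>: "0 < \<eta>"
  obtains C where "0 \<le> C" "\<forall>\<^sub>F N in sequentially.
    sample_prob N (\<lambda>\<omega>. (1 + \<eta>) * rad \<alpha> N < \<rho> N \<omega>) \<le> C * real N powr (1 - (1 - e) * \<alpha>)"
proof -
  obtain r0 where r0: "0 < r0" "\<And>x r. x \<in> K \<Longrightarrow> 0 < r \<Longrightarrow> r < r0 \<Longrightarrow> (1 - e) * (c * r ^ s) \<le> prob (cball x r)"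
    using density[OF e(1)] by blast
  define C where "C = 1 / ((1 - e) * (\<eta> / 3) ^ s * \<alpha>)"
  have C: "0 < C" using e \<eta> \<alpha> by (simp add: C_def)
  have ev1: "\<forall>\<^sub>F N in sequentially. rad \<alpha> N < r0"
    using order_tendstoD(2)[OF rad_tendsto[OF \<alpha>] r0(1)] .
  have ev2: "\<forall>\<^sub>F N in sequentially. \<eta> / 3 * rad \<alpha> N < r0"
    using \<eta> r0(1) by (intro rad_small \<alpha>) auto
  have ev3: "\<forall>\<^sub>F N in sequentially. 1 \<le> ln (real N)" by real_asymp
  have ev4: "\<forall>\<^sub>F N in sequentially. (2::nat) \<le> N" by (rule eventually_ge_at_top)
  have "\<forall>\<^sub>F N in sequentially.
    sample_prob N (\<lambda>\<omega>. (1 + \<eta>) * rad \<alpha> N < \<rho> N \<omega>) \<le> C * real N powr (1 - (1 - e) * \<alpha>)"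
    using ev1 ev2 ev3 ev4
  proof eventually_elim
    case (elim N)
    define r where "r = rad \<alpha> N"
    have r: "0 < r" "r ^ s = \<alpha> / c * (ln (real N) / real N)"
      using rad_pos[OF \<alpha> elim(4)] rad_power[OF \<alpha> elim(4)] by (simp_all add: r_def)
    have N: "0 < real N" using elim by simp
    obtain Z where Z: "finite Z" "Z \<subseteq> K" "\<And>x y. x \<in> Z \<Longrightarrow> y \<in> Z \<Longrightarrow> x \<noteq> y \<Longrightarrow> \<eta> * r \<le> dist x y"
      "K \<subseteq> (\<Union>z\<in>Z. ball z (\<eta> * r))"
      by (rule compact_maximal_separated[OF compact_K mult_pos_pos[OF \<eta> r(1)]]) (rule that)
    \<comment> \<open>the radius \<open>\<eta> r / 3\<close> is less than half the separation, so the balls are disjoint\<close>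
    have "real (card Z) * ((1 - e) * (c * (\<eta> / 3 * r) ^ s)) \<le> prob UNIV"
    proof (rule separated_card_le[where r = "\<eta> / 3 * r"])
      show "2 * (\<eta> / 3 * r) < dist x y" if "x \<in> Z" "y \<in> Z" "x \<noteq> y" for x y
      proof -
        have "2 * (\<eta> / 3 * r) < \<eta> * r" using \<eta> r by simp
        then show ?thesis using Z(3)[OF that] by linarith
      qed
      show "(1 - e) * (c * (\<eta> / 3 * r) ^ s) \<le> prob (cball z (\<eta> / 3 * r))" if "z \<in> Z" for z
        using that Z(2) \<eta> r elim by (intro r0) (auto simp: r_def)
      show "UNIV \<in> fmeasurable M" using sets_M by (simp add: fmeasurable_eq_sets)
    qed (use Z sets_M in auto)
    also have "prob UNIV = 1" using prob_space space_M by simp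
    also have "(1 - e) * (c * (\<eta> / 3 * r) ^ s) = ln (real N) / (C * real N)"
      unfolding power_mult_distrib r(2) using c_pos by (simp add: C_def field_simps)
    finally have "real (card Z) * ln (real N) \<le> C * real N"
      using C N by (simp add: field_simps)
    moreover have "real (card Z) * 1 \<le> real (card Z) * ln (real N)"
      using elim by (intro mult_left_mono) auto
    ultimately have card: "real (card Z) \<le> C * real N" by linarith
    define m where "m = (1 - e) * (c * r ^ s)"
    have m: "m \<le> prob (cball z r)" if "z \<in> Z" for z
      unfolding m_def using that Z(2) r elim by (intro r0) (auto simp: r_def)
    have m': "m = (1 - e) * \<alpha> * ln (real N) / real N"
      unfolding m_def r(2) using c_pos by simp
    have "Z \<noteq> {}" using Z(4) K_nonempty by auto
    then have "m \<le> 1" using m prob_le_1 by (meson equals0I order_trans)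
    have "sample_prob N (\<lambda>\<omega>. r + \<eta> * r < \<rho> N \<omega>) \<le> real (card Z) * (1 - m) ^ N"
      using elim by (intro prob_\<rho>_greater Z m) auto
    also have "\<dots> \<le> C * real N * exp (- m) ^ N"
      using \<open>m \<le> 1\<close> exp_ge_add_one_self[of "- m"] C by (intro mult_mono card power_mono) auto
    also have "exp (- m) ^ N = real N powr (- ((1 - e) * \<alpha>))"
      using N unfolding exp_of_nat_mult[symmetric] powr_def by (simp add: m')
    also have "C * real N * real N powr (- ((1 - e) * \<alpha>)) = C * real N powr (1 - (1 - e) * \<alpha>)"
      using N by (simp add: powr_diff powr_minus divide_simps)
    finally show ?case by (simp add: r_def algebra_simps)
  qed
  then show thesis using that C by (meson less_imp_le)
qed

text \<open>For \<open>r = rad \<alpha> N\<close> a maximal \<open>3 r\<close>-separated set has at least a constant times \<open>N / ln N\<close> points,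
because the balls of radius \<open>3 r\<close> cover \<open>K\<close>. Each ball of radius \<open>r\<close> is missed with probability at
least \<open>N\<close> to the power \<open>-(1 + e)\<^sup>2 \<alpha>\<close>: one factor \<open>1 + e\<close> comes from its mass \<open>p\<close>, the other one from
comparing \<open>1 - p\<close> with the exponential function.\<close>

lemma \<rho>_lower_tail:
  assumes \<alpha>: "0 < \<alpha>" and e: "0 < e"
  obtains C where "\<forall>\<^sub>F N in sequentially.
    sample_prob N (\<lambda>\<omega>. \<rho> N \<omega> < rad \<alpha> N) \<le> C * ln (real N) * real N powr ((1 + e)\<^sup>2 * \<alpha> - 1)"
proof -
  obtain r0 where r0: "0 < r0" "\<And>x r. x \<in> K \<Longrightarrow> 0 < r \<Longrightarrow> r < r0 \<Longrightarrow> prob (cball x r) \<le> (1 + e) * (c * r ^ s)"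
    using density[OF e(1)] by blast
  define C where "C = (1 + e) * 3 ^ s * \<alpha>"
  have C: "0 < C" using e \<alpha> by (simp add: C_def)
  have ev2: "\<forall>\<^sub>F N in sequentially. 3 * rad \<alpha> N < r0"
    using r0(1) by (intro rad_small \<alpha>) auto
  have ev3: "\<forall>\<^sub>F N in sequentially. 1 \<le> ln (real N)" by real_asymp
  have ev4: "\<forall>\<^sub>F N in sequentially. (2::nat) \<le> N" by (rule eventually_ge_at_top)
  have "(\<lambda>N. (1 + e) * \<alpha> * (ln (real N) / real N)) \<longlonglongrightarrow> (1 + e) * \<alpha> * 0"
    by (rule tendsto_mult[OF tendsto_const]) real_asymp
  then have ev5: "\<forall>\<^sub>F N in sequentially. (1 + e) * \<alpha> * (ln (real N) / real N) < e / (1 + e)"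
    using e by (auto dest: order_tendstoD(2)[of _ _ _ "e / (1 + e)"])
  have "\<forall>\<^sub>F N in sequentially.
    sample_prob N (\<lambda>\<omega>. \<rho> N \<omega> < rad \<alpha> N) \<le> C * ln (real N) * real N powr ((1 + e)\<^sup>2 * \<alpha> - 1)"
    using ev2 ev3 ev4 ev5
  proof eventually_elim
    case (elim N)
    define r where "r = rad \<alpha> N"
    have r: "0 < r" "r ^ s = \<alpha> / c * (ln (real N) / real N)"
      using rad_pos[OF \<alpha> elim(3)] rad_power[OF \<alpha> elim(3)] by (simp_all add: r_def)
    have N: "0 < real N" using elim by simp
    have r3: "0 < 3 * r" using r by simp
    obtain Z where Z: "finite Z" "Z \<subseteq> K" "\<And>x y. x \<in> Z \<Longrightarrow> y \<in> Z \<Longrightarrow> x \<noteq> y \<Longrightarrow> 3 * r \<le> dist x y"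
      "K \<subseteq> (\<Union>z\<in>Z. ball z (3 * r))"
      by (rule compact_maximal_separated[OF compact_K r3]) (rule that)
    have "1 = prob K" by (simp add: prob_K)
    also have "\<dots> \<le> prob (\<Union>z\<in>Z. cball z (3 * r))"
      using Z(1,4) ball_subset_cball by (intro finite_measure_mono sets.finite_UN) (blast, auto)
    also have "\<dots> \<le> (\<Sum>z\<in>Z. prob (cball z (3 * r)))"
      using Z(1) by (intro finite_measure_subadditive_finite) auto
    also have "\<dots> \<le> (\<Sum>z\<in>Z. (1 + e) * (c * (3 * r) ^ s))"
      using Z(2) r elim by (intro sum_mono r0) (auto simp: r_def)
    also have "\<dots> = real (card Z) * (C * ln (real N) / real N)"
      unfolding power_mult_distrib r(2) using c_pos by (simp add: C_def field_simps)
    finally have card: "real N \<le> real (card Z) * (C * ln (real N))"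
      using N by (simp add: field_simps)
    define p where "p = (1 + e) * (c * r ^ s)"
    have p': "p = (1 + e) * \<alpha> * (ln (real N) / real N)"
      unfolding p_def r(2) using c_pos by simp
    have p0: "0 \<le> p" unfolding p' using \<alpha> e elim N by simp
    have pe: "p < e / (1 + e)" unfolding p' using elim by simp
    also have "e / (1 + e) < 1" using e by simp
    finally have p1: "p < 1" .
    define q where "q = real N powr (- ((1 + e)\<^sup>2 * \<alpha>))"
    have q: "q \<le> (1 - prob (cball z r)) ^ N" if "z \<in> Z" for z
    proof -
      have "p / (1 - p) \<le> (1 + e) * p"
      proof -
        have "1 \<le> (1 + e) * (1 - p)" using pe e by (simp add: field_simps)
        then have "p * 1 \<le> p * ((1 + e) * (1 - p))" using p0 by (rule mult_left_mono)
        then show ?thesis using p1 by (simp add: field_simps)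
      qed
      then have "exp (- ((1 + e) * p)) \<le> exp (- (p / (1 - p)))" by simp
      also have "\<dots> \<le> 1 - p"
      proof -
        have "1 / (1 - p) = 1 + p / (1 - p)" using p1 by (simp add: field_simps)
        also have "\<dots> \<le> exp (p / (1 - p))" by (rule exp_ge_add_one_self)
        finally have "1 / exp (p / (1 - p)) \<le> 1 - p" using p1 by (simp add: field_simps)
        then show ?thesis by (simp add: exp_minus field_simps)
      qed
      also have "\<dots> \<le> 1 - prob (cball z r)"
        unfolding p_def using that Z(2) r elim r0(2)[of z r] by (auto simp: r_def)
      finally have "exp (- ((1 + e) * p)) ^ N \<le> (1 - prob (cball z r)) ^ N"
        by (rule power_mono) simp
      also have "exp (- ((1 + e) * p)) ^ N = q"
        unfolding exp_of_nat_mult[symmetric] q_def powr_def using N by (simp add: p' power2_eq_square field_simps)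
      finally show ?thesis .
    qed
    let ?P = "sample_prob N (\<lambda>\<omega>. \<rho> N \<omega> < r)"
    have "?P * (real (card Z) * q) \<le> 1"
    proof (rule prob_\<rho>_less[OF _ Z(1,2) _ q])
      show "2 * r < dist x y" if "x \<in> Z" "y \<in> Z" "x \<noteq> y" for x y
        using Z(3)[OF that] r by linarith
    qed (use N in auto)
    then have "?P * (real (card Z) * q) * (C * ln (real N)) \<le> 1 * (C * ln (real N))"
      using C elim by (intro mult_right_mono) auto
    moreover have "?P * q * real N \<le> ?P * q * (real (card Z) * (C * ln (real N)))"
      using card by (intro mult_left_mono) (auto simp: q_def)
    ultimately have "?P * (q * real N) \<le> C * ln (real N)"
      by (simp add: ac_simps)
    moreover have "q * real N > 0" using N by (simp add: q_def)
    ultimately have "?P \<le> C * ln (real N) / (q * real N)"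
      by (simp add: pos_le_divide_eq)
    also have "\<dots> = C * ln (real N) * real N powr ((1 + e)\<^sup>2 * \<alpha> - 1)"
      using N by (simp add: q_def powr_diff powr_minus field_simps)
    finally show ?case by (simp add: r_def)
  qed
  then show thesis by (rule that)
qed

definition moment :: "real \<Rightarrow> nat \<Rightarrow> real" where
  "moment p N = (\<integral>\<omega>. \<rho> N \<omega> powr p \<partial>sample N)"

lemma rad_scaled:
  assumes "0 < \<alpha>" "2 \<le> N"
  shows "rad \<alpha> N powr p * (real N / ln (real N)) powr (p / real s) = (\<alpha> / c) powr (p / real s)"
proof -
  define L where "L = ln (real N) / real N"
  have L: "0 < L" using assms by (simp add: L_def)
  have "rad \<alpha> N powr p = (\<alpha> / c * L) powr (p / real s)"
    by (simp add: rad_def powr_powr L_def)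
  moreover  have "real N / ln (real N) = 1 / L" by (simp add: L_def)
  ultimately show ?thesis
    using L assms c_pos by (simp add: powr_mult[symmetric] )
qed

lemma integrable_\<rho>_powr:
  assumes N: "0 < N" and p: "0 < p"
  shows "integrable (sample N) (\<lambda>\<omega>. \<rho> N \<omega> powr p)"
proof -
  interpret P: prob_space "sample N" by (rule prob_space_sample)
  show ?thesis
  proof (rule P.integrable_const_bound[of _ "diameter K powr p"])
    show "AE \<omega> in sample N. norm (\<rho> N \<omega> powr p) \<le> diameter K powr p"
      using \<rho>_le_diameter[OF N] by eventually_elim (use \<rho>_nonneg[OF N] p in \<open>auto intro: powr_mono2\<close>)
    show "(\<lambda>\<omega>. \<rho> N \<omega> powr p) \<in> borel_measurable (sample N)"
      using \<rho>_measurable[OF N] by measurable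
  qed
qed

text \<open>The covering radius is bounded by \<open>a\<close>, by \<open>b\<close> where it exceeds \<open>a\<close>, and by the diameter of \<open>K\<close>
where it exceeds \<open>b\<close>.\<close>

lemma moment_le:
  assumes N: "0 < N" and p: "0 < p" and ab: "0 \<le> a" "0 \<le> b"
  shows "moment p N \<le> a powr p + b powr p * sample_prob N (\<lambda>\<omega>. a < \<rho> N \<omega>)
    + diameter K powr p * sample_prob N (\<lambda>\<omega>. b < \<rho> N \<omega>)"
proof -
  interpret P: prob_space "sample N" by (rule prob_space_sample)
  note [measurable] = \<rho>_measurable[OF N]
  let ?A = "\<lambda>a. {\<omega> \<in> space (sample N). a < \<rho> N \<omega>}"
  have [measurable]: "?A t \<in> P.events" for t by measurable
  have int: "integrable (sample N) (indicator (?A t) :: _ \<Rightarrow> real)" for t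
    by (intro P.integrable_const_bound[of _ 1]) auto
  have "moment p N \<le> P.expectation (\<lambda>\<omega>. a powr p + b powr p * indicator (?A a) \<omega> + diameter K powr p * indicator (?A b) \<omega>)"
    unfolding moment_def
  proof (rule integral_mono_AE)
    show "AE \<omega> in sample N. \<rho> N \<omega> powr p \<le> a powr p + b powr p * indicator (?A a) \<omega> + diameter K powr p * indicator (?A b) \<omega>"
      using \<rho>_le_diameter[OF N] AE_space
    proof eventually_elim
      case (elim \<omega>)
      have mono: "\<rho> N \<omega> powr p \<le> t powr p" if "\<rho> N \<omega> \<le> t" for t
        using that \<rho>_nonneg[OF N] p by (intro powr_mono2) auto
      show ?case
        using elim mono[of a] mono[of b] mono[of "diameter K"]
        by (auto simp: indicator_def intro: add_increasing add_increasing2)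
    qed
  qed (use int integrable_\<rho>_powr[OF N p] in auto)
  also have "\<dots> = a powr p + b powr p * P.prob (?A a) + diameter K powr p * P.prob (?A b)"
    using int by (simp add: P.prob_space)
  finally show ?thesis .
qed

lemma moment_ge:
  assumes N: "0 < N" and p: "0 < p" and a: "0 \<le> a"
  shows "a powr p * (1 - sample_prob N (\<lambda>\<omega>. \<rho> N \<omega> < a)) \<le> moment p N"
proof -
  interpret P: prob_space "sample N" by (rule prob_space_sample)
  note [measurable] = \<rho>_measurable[OF N]
  let ?A = "{\<omega> \<in> space (sample N). \<rho> N \<omega> < a}"
  have [measurable]: "?A \<in> P.events" by measurable
  have int: "integrable (sample N) (indicator ?A :: _ \<Rightarrow> real)"
    by (intro P.integrable_const_bound[of _ 1]) auto
  have "a powr p * (1 - P.prob ?A) = P.expectation (\<lambda>\<omega>. a powr p * (1 - indicator ?A \<omega>))"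
    using int by (simp add: P.prob_space)
  also have "\<dots> \<le> moment p N"
    unfolding moment_def
  proof (rule integral_mono)
    fix \<omega> assume "\<omega> \<in> space (sample N)"
    then show "a powr p * (1 - indicator ?A \<omega>) \<le> \<rho> N \<omega> powr p"
      using a p by (auto simp: indicator_def intro: powr_mono2)
  qed (use int integrable_\<rho>_powr[OF N p] in auto)
  finally show ?thesis .
qed

text \<open>The lower bound, by Markov's inequality, uses \<open>\<alpha>\<close> slightly below \<open>1\<close>. For the upper bound \<open>moment_le\<close> is applied with
\<open>\<alpha>\<close> slightly above \<open>1\<close> for \<open>a\<close>, and with a second, large parameter \<open>\<beta>\<close> for \<open>b\<close>.\<close>

theorem moment_asymptotics:
  assumes p: "0 < p"
  shows "(\<lambda>N. moment p N * (real N / ln (real N)) powr (p / real s)) \<longlonglongrightarrow> (1 / c) powr (p / real s)"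
proof -
  define g where "g N = (real N / ln (real N)) powr (p / real s)" for N :: nat
  have g0: "0 \<le> g N" for N by (simp add: g_def)
  define t where "t = p / real s"
  have t: "0 < t" using p s_pos by (simp add: t_def)
  have ev2: "\<forall>\<^sub>F N in sequentially. (2::nat) \<le> N" by (rule eventually_ge_at_top)
  have lower: "\<forall>\<^sub>F N in sequentially. x < moment p N * g N" if x: "x < (1 / c) powr t" for x
  proof -
    have "((\<lambda>\<alpha>. (\<alpha> / c) powr t) \<longlongrightarrow> (1 / c) powr t) (at_left 1)"
      using c_pos by (intro tendsto_intros) auto
    then have "\<forall>\<^sub>F \<alpha> in at_left 1. x < (\<alpha> / c) powr t" using x by (rule order_tendstoD)
    moreover have "\<forall>\<^sub>F \<alpha> in at_left (1::real). 0 < \<alpha> \<and> \<alpha> < 1"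
      by (auto simp: eventually_at_left[of 0 1] intro!: exI[of _ 0])
    ultimately have "\<forall>\<^sub>F \<alpha> in at_left 1. x < (\<alpha> / c) powr t \<and> 0 < \<alpha> \<and> \<alpha> < 1"
      by eventually_elim auto
    then obtain \<alpha> where \<alpha>: "x < (\<alpha> / c) powr t" "0 < \<alpha>" "\<alpha> < 1"
      using eventually_happens'[OF trivial_limit_at_left_real[of "1::real"]] by blast
    have "((\<lambda>e. (1 + e)\<^sup>2 * \<alpha>) \<longlongrightarrow> (1 + 0)\<^sup>2 * \<alpha>) (at_right 0)"
      by (intro tendsto_intros)
    then have "\<forall>\<^sub>F e in at_right 0. (1 + e)\<^sup>2 * \<alpha> < 1" by (rule order_tendstoD) (use \<alpha> in simp)
    moreover have "\<forall>\<^sub>F e in at_right (0::real). 0 < e" by (rule eventually_at_right_less)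
    ultimately have "\<forall>\<^sub>F e in at_right (0::real). (1 + e)\<^sup>2 * \<alpha> < 1 \<and> 0 < e" by eventually_elim auto
    then obtain e where e: "(1 + e)\<^sup>2 * \<alpha> < 1" "(0::real) < e"
      using eventually_happens'[OF trivial_limit_at_right_real[of "0::real"]] by blast
    obtain C where C: "\<forall>\<^sub>F N in sequentially.
      sample_prob N (\<lambda>\<omega>. \<rho> N \<omega> < rad \<alpha> N) \<le> C * ln (real N) * real N powr ((1 + e)\<^sup>2 * \<alpha> - 1)"
      using \<rho>_lower_tail[OF \<alpha>(2) e(2)] by blast
    define \<gamma> where "\<gamma> = 1 - (1 + e)\<^sup>2 * \<alpha>"
    have \<gamma>: "0 < \<gamma>" using e by (simp add: \<gamma>_def)
    have "(\<lambda>N. ln (real N) * real N powr (- \<gamma>)) \<longlonglongrightarrow> 0" using \<gamma> by real_asymp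
    then have "(\<lambda>N. (\<alpha> / c) powr t * (1 - C * (ln (real N) * real N powr (- \<gamma>)))) \<longlonglongrightarrow> (\<alpha> / c) powr t * (1 - C * 0)"
      by (intro tendsto_intros)
    then have "\<forall>\<^sub>F N in sequentially. x < (\<alpha> / c) powr t * (1 - C * (ln (real N) * real N powr (- \<gamma>)))"
      by (rule order_tendstoD) (use \<alpha> in simp)
    with C ev2 show ?thesis
    proof eventually_elim
      case (elim N)
      let ?P = "sample_prob N (\<lambda>\<omega>. \<rho> N \<omega> < rad \<alpha> N)"
      note elim(3)
      also have "(\<alpha> / c) powr t * (1 - C * (ln (real N) * real N powr (- \<gamma>))) \<le>
          (\<alpha> / c) powr t * (1 - ?P)"
        using elim(1) by (intro mult_left_mono) (auto simp: \<gamma>_def mult.assoc)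
      also have "(\<alpha> / c) powr t = rad \<alpha> N powr p * g N"
        using rad_scaled[OF \<alpha>(2) elim(2)] by (simp add: t_def g_def)
      also have "rad \<alpha> N powr p * g N * (1 - ?P)
          = (rad \<alpha> N powr p * (1 - ?P)) * g N"
        by simp
      also have "\<dots> \<le> moment p N * g N"
        using elim(2) p g0 by (intro mult_right_mono moment_ge) (auto simp: rad_def)
      finally show ?case .
    qed
  qed
  have upper: "\<forall>\<^sub>F N in sequentially. moment p N * g N < x" if x: "(1 / c) powr t < x" for x
  proof -
    have "((\<lambda>\<eta>. (1 + \<eta>) powr p * ((1 + \<eta>) / c) powr t) \<longlongrightarrow> (1 + 0) powr p * ((1 + 0) / c) powr t) (at_right 0)"
      using c_pos by (intro tendsto_intros) auto
    then have "\<forall>\<^sub>F \<eta> in at_right 0. (1 + \<eta>) powr p * ((1 + \<eta>) / c) powr t < x"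
      by (rule order_tendstoD) (use x in simp)
    moreover have "\<forall>\<^sub>F \<eta> in at_right (0::real). 0 < \<eta>" by (rule eventually_at_right_less)
    ultimately have "\<forall>\<^sub>F \<eta> in at_right (0::real). (1 + \<eta>) powr p * ((1 + \<eta>) / c) powr t < x \<and> 0 < \<eta>"
      by eventually_elim auto
    then obtain \<eta> where \<eta>: "(1 + \<eta>) powr p * ((1 + \<eta>) / c) powr t < x" "(0::real) < \<eta>"
      using eventually_happens'[OF trivial_limit_at_right_real[of "0::real"]] by blast
    define \<alpha> where "\<alpha> = 1 + \<eta>"
    \<comment> \<open>chosen such that \<open>(1 - e) \<alpha>\<close> still exceeds \<open>1\<close>\<close>
    define e where "e = \<eta> / (2 * (1 + \<eta>))"
    have \<alpha>: "0 < \<alpha>" using \<eta> by (simp add: \<alpha>_def)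
    have e: "0 < e" "e < 1" using \<eta> by (auto simp: e_def field_simps)
    have e\<alpha>: "(1 - e) * \<alpha> = 1 + \<eta> / 2" using \<eta> by (simp add: e_def \<alpha>_def field_simps)
    \<comment> \<open>the second tail is then \<open>O(N\<^sup>-\<^sup>1\<^sup>-\<^sup>t)\<close>, which beats the normalizing factor \<open>g N\<close> of order below \<open>N\<^sup>t\<close>\<close>
    define \<beta> where "\<beta> = (2 + t) / (1 - e)"
    have \<beta>: "0 < \<beta>" "(1 - e) * \<beta> = 2 + t" using e t by (auto simp: \<beta>_def)
    obtain C1 where C1: "0 \<le> C1" "\<forall>\<^sub>F N in sequentially.
      sample_prob N (\<lambda>\<omega>. (1 + \<eta>) * rad \<alpha> N < \<rho> N \<omega>) \<le> C1 * real N powr (1 - (1 - e) * \<alpha>)"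
      using \<rho>_upper_tail[OF \<alpha> e \<eta>(2)] by blast
    obtain C2 where C2: "0 \<le> C2" "\<forall>\<^sub>F N in sequentially.
      sample_prob N (\<lambda>\<omega>. (1 + \<eta>) * rad \<beta> N < \<rho> N \<omega>) \<le> C2 * real N powr (1 - (1 - e) * \<beta>)"
      using \<rho>_upper_tail[OF \<beta>(1) e \<eta>(2)] by blast
    define B where "B N = (1 + \<eta>) powr p * (\<alpha> / c) powr t
        + (1 + \<eta>) powr p * (\<beta> / c) powr t * (C1 * real N powr (- (\<eta> / 2)))
        + diameter K powr p * (C2 * ((real N / ln (real N)) powr t * real N powr (- 1 - t)))" for N
    have z1: "(\<lambda>N. real N powr (- (\<eta> / 2))) \<longlonglongrightarrow> 0" using \<eta> by real_asymp
    have z2: "(\<lambda>N. (real N / ln (real N)) powr t * real N powr (- 1 - t)) \<longlonglongrightarrow> 0" using t by real_asymp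
    have "B \<longlonglongrightarrow> (1 + \<eta>) powr p * (\<alpha> / c) powr t
        + (1 + \<eta>) powr p * (\<beta> / c) powr t * (C1 * 0) + diameter K powr p * (C2 * 0)"
      unfolding B_def[abs_def] by (intro tendsto_intros z1 z2)
    then have "\<forall>\<^sub>F N in sequentially. B N < x"
      by (rule order_tendstoD) (use \<eta> in \<open>simp add: \<alpha>_def\<close>)
    with C1(2) C2(2) ev2 show ?thesis
    proof eventually_elim
      case (elim N)
      let ?P = "\<lambda>a. sample_prob N (\<lambda>\<omega>. a < \<rho> N \<omega>)"
      let ?a = "(1 + \<eta>) * rad \<alpha> N" and ?b = "(1 + \<eta>) * rad \<beta> N"
      have sc: "((1 + \<eta>) * rad \<beta>' N) powr p * g N = (1 + \<eta>) powr p * (\<beta>' / c) powr t" if "0 < \<beta>'" for \<beta>'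
        using rad_scaled[OF that elim(3), of p] \<eta> by (simp add: powr_mult rad_def g_def t_def mult.assoc)
      have "moment p N * g N \<le> (?a powr p + ?b powr p * ?P ?a + diameter K powr p * ?P ?b) * g N"
        using elim(3) p g0 \<eta> by (intro mult_right_mono moment_le) (auto simp: rad_def)
      also have "\<dots> = ?a powr p * g N + ?b powr p * g N * ?P ?a + diameter K powr p * (?P ?b * g N)"
        by (simp add: algebra_simps)
      also have "\<dots> \<le> (1 + \<eta>) powr p * (\<alpha> / c) powr t
        + (1 + \<eta>) powr p * (\<beta> / c) powr t * (C1 * real N powr (1 - (1 - e) * \<alpha>))
        + diameter K powr p * ((C2 * real N powr (1 - (1 - e) * \<beta>)) * g N)"
        unfolding sc[OF \<alpha>] sc[OF \<beta>(1)] using elim(1,2) g0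
        by (intro add_mono mult_left_mono mult_right_mono order_refl) auto
      also have "\<dots> = B N"
        unfolding B_def e\<alpha> \<beta>(2) g_def t_def by (simp add: ac_simps)
      also note elim(4)
      finally show ?case .
    qed
  qed
  show ?thesis
    unfolding t_def[symmetric]
    using order_tendstoI[of "(1 / c) powr t" "\<lambda>N. moment p N * g N", OF lower upper]
    by (simp add: g_def t_def)
qed

end

section \<open>The covering radius on an asymptotically flat set\<close>

theorem flat_covering_radius:
  fixes K :: "(real ^ 'd::finite) set"
  assumes flat: "asymptotically_flat_regular TYPE('s::finite) K" and p: "0 < p"
  shows "(\<lambda>N. expected_covering_radius_powr TYPE('s) K p N *
      (real N / ln (real N)) powr (p / real CARD('s)))
    \<longlonglongrightarrow> (measure (hausdorff TYPE('s)) K / unit_ball_vol (real CARD('s))) powr (p / real CARD('s))"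
proof -
  let ?H = "hausdorff TYPE('s) :: (real ^ 'd) measure" and ?s = "CARD('s)" and ?v = "unit_ball_vol (real CARD('s))"
  have K: "compact K" "emeasure ?H K \<noteq> 0" "emeasure ?H K \<noteq> \<infinity>"
    and lim: "uniform_limit K (\<lambda>r x. measure ?H (cball x r \<inter> K) / r ^ ?s) (\<lambda>_. ?v) (at_right 0)"
    using flat by (auto simp: asymptotically_flat_regular_def)
  have v: "0 < ?v" by simp
  have h: "0 < measure ?H K"
    using K by (simp add: measure_def enn2real_positive_iff less_top zero_less_iff_neq_zero)
  let ?M = "uniform_measure ?H K"
  interpret P: prob_space ?M
    using K by (intro prob_space_uniform_measure) auto
  have Kb: "K \<in> sets borel" using K(1) by (simp add: borel_compact)
  have prob: "P.prob A = measure ?H (A \<inter> K) / measure ?H K" if "A \<in> sets borel" for A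
    using K that by (subst measure_uniform_measure) (auto simp: Int_commute)
  interpret uniform_density ?M K ?s "?v / measure ?H K"
  proof unfold_locales
    show "K \<noteq> {}" using K by auto
    show "P.prob K = 1" using prob[OF Kb] h by simp
    show "0 < ?v / measure ?H K" using v h by simp
    fix e :: real assume "0 < e"
    then have "\<forall>\<^sub>F r in at_right 0. \<forall>x\<in>K. dist (measure ?H (cball x r \<inter> K) / r ^ ?s) ?v < e * ?v"
      using v by (intro uniform_limitD[OF lim]) auto
    then obtain r0 where r0: "0 < r0" "\<And>r x. 0 < r \<Longrightarrow> r < r0 \<Longrightarrow> x \<in> K \<Longrightarrow>
        dist (measure ?H (cball x r \<inter> K) / r ^ ?s) ?v < e * ?v"
      by (auto simp: eventually_at_right[of 0 1])
    have "(1 - e) * (?v / measure ?H K * r ^ ?s) \<le> P.prob (cball x r) \<and>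
        P.prob (cball x r) \<le> (1 + e) * (?v / measure ?H K * r ^ ?s)"
      if x: "x \<in> K" and r: "0 < r" "r < r0" for x r
    proof -
      define m where "m = measure ?H (cball x r \<inter> K)"
      have "\<bar>m / r ^ ?s - ?v\<bar> < e * ?v" using r0(2)[OF r x] by (simp add: dist_real_def m_def)
      then have "(1 - e) * ?v \<le> m / r ^ ?s" "m / r ^ ?s \<le> (1 + e) * ?v"
        by (auto simp: abs_less_iff algebra_simps)
      then have "(1 - e) * ?v * r ^ ?s \<le> m" "m \<le> (1 + e) * ?v * r ^ ?s"
        using r by (simp_all add: pos_le_divide_eq pos_divide_le_eq)
      then have "(1 - e) * ?v * r ^ ?s / measure ?H K \<le> m / measure ?H K"
        "m / measure ?H K \<le> (1 + e) * ?v * r ^ ?s / measure ?H K"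
        using h by (intro divide_right_mono; simp)+
      then show ?thesis by (simp add: prob m_def)
    qed
    then show "\<exists>r0>0. \<forall>x\<in>K. \<forall>r. 0 < r \<and> r < r0 \<longrightarrow> (1 - e) * (?v / measure ?H K * r ^ ?s) \<le> P.prob (cball x r) \<and>
        P.prob (cball x r) \<le> (1 + e) * (?v / measure ?H K * r ^ ?s)"
      using r0(1) by blast
  qed (use K in auto)
  have "moment p N = expected_covering_radius_powr TYPE('s) K p N" for N
    by (simp add: moment_def expected_covering_radius_powr_def \<rho>_def)
  with moment_asymptotics[OF p] show ?thesis by simp
qed

section \<open>The sphere is a submanifold\<close>

text \<open>The cap around \<open>x\<close> is the graph of \<open>v \<mapsto> sqrt (1 - \<bar>v\<bar>\<^sup>2)\<close> over the tangent hyperplane, which \<open>T\<close>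
identifies with \<open>\<real>\<^sup>m\<close>. The domain is cut down to radius \<open>1 / 2\<close>, since the derivatives of the
square root are not Lipschitz up to the boundary of the unit ball. The linear map \<open>G\<close>, the projection
to the hyperplane, inverts the chart, and it also shows that the Jacobian is injective.\<close>

lemma sphere_graph_chart:
  fixes x :: "real ^ 'n::finite"
  assumes card: "CARD('n) = CARD('m::finite) + 1" and x: "x \<in> sphere 0 1"
  shows "\<exists>(W :: (real ^ 'm) set) \<phi>. C11_local_parametrization (sphere 0 1) W \<phi> \<and> x \<in> \<phi> ` W"
proof -
  have nx: "norm x = 1" and xx: "x \<bullet> x = 1" using x by (auto simp: dot_square_norm)
  let ?P = "{y. x \<bullet> y = 0}"
  have "dim ?P = CARD('n) - 1" using dim_hyperplane[of x] nx by force
  then have dim: "dim (UNIV :: (real ^ 'm) set) = dim ?P" using card by simp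
  obtain T :: "real ^ 'm \<Rightarrow> real ^ 'n" and g :: "real ^ 'n \<Rightarrow> real ^ 'm" where
    T: "linear T" and g: "linear g" and T_range: "T ` UNIV = ?P" and "g ` ?P = UNIV"
    and T_norm: "\<And>v. v \<in> UNIV \<Longrightarrow> norm (T v) = norm v" and g_norm: "\<And>y. y \<in> ?P \<Longrightarrow> norm (g y) = norm y"
    and gT_UNIV: "\<And>v. v \<in> UNIV \<Longrightarrow> g (T v) = v" and Tg: "\<And>y. y \<in> ?P \<Longrightarrow> T (g y) = y"
    by (rule isometries_subspaces[OF subspace_UNIV subspace_hyperplane dim]) (rule that)
  have Tn: "norm (T v) = norm v" and gT: "g (T v) = v" and xT: "x \<bullet> T v = 0" for v
  proof -
    have "T v \<in> ?P" unfolding T_range[symmetric] by simp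
    then show "x \<bullet> T v = 0" by simp
  qed (simp_all add: T_norm gT_UNIV)
  have Tx: "T v \<bullet> x = 0" for v using xT[of v] by (simp add: inner_commute)
  define W where "W = ball (0 :: real ^ 'm) (1/2)"
  define \<phi> where "\<phi> v = T v + sqrt (1 - (norm v)\<^sup>2) *\<^sub>R x" for v
  define G where "G y = g (y - (x \<bullet> y) *\<^sub>R x)" for y
  define k where "k v = 1 / sqrt (1 - (norm v)\<^sup>2)" for v :: "real ^ 'm"
  define D where "D i v = T (axis i 1) - (v $ i * k v) *\<^sub>R x" for i v
  have linG: "linear G"
    unfolding G_def by (intro linear_compose[OF _ g, unfolded comp_def] linearI)
      (simp_all add: algebra_simps inner_right_distrib)
  have GT: "G (T v + a *\<^sub>R x) = v" for v a
    by (simp add: G_def inner_right_distrib xT xx gT)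
  have nW: "(norm v)\<^sup>2 < 1 / 4" if "v \<in> W" for v
    using that power_strict_mono[of "norm v" "1/2" 2] by (simp add: W_def power_divide)
  have norm_sq: "(norm (T v + a *\<^sub>R x))\<^sup>2 = (norm v)\<^sup>2 + a\<^sup>2" for v a
  proof -
    have TT: "T v \<bullet> T v = (norm v)\<^sup>2" by (simp add: dot_square_norm Tn)
    show ?thesis
      unfolding power2_norm_eq_inner[of "T v + a *\<^sub>R x"]
      by (simp add: inner_add_left inner_add_right xT Tx xx power2_eq_square[of a] TT)
  qed
  have sph: "\<phi> v \<in> sphere 0 1" if "v \<in> W" for v
  proof -
    have "(norm (\<phi> v))\<^sup>2 = 1" using nW[OF that] by (simp add: \<phi>_def norm_sq)
    then show ?thesis by (simp add: power2_eq_1_iff) (smt (verit) norm_ge_zero)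
  qed
  have img: "\<phi> ` W = sphere 0 1 \<inter> ({y. 0 < x \<bullet> y} \<inter> {y. norm (y - (x \<bullet> y) *\<^sub>R x) < 1/2})"
  proof (intro set_eqI iffI)
    fix y assume "y \<in> \<phi> ` W"
    then obtain v where v: "v \<in> W" "y = \<phi> v" by blast
    have xy: "x \<bullet> y = sqrt (1 - (norm v)\<^sup>2)" by (simp add: v \<phi>_def inner_right_distrib xT xx)
    then have "y - (x \<bullet> y) *\<^sub>R x = T v" by (simp add: v \<phi>_def)
    then show "y \<in> sphere 0 1 \<inter> ({y. 0 < x \<bullet> y} \<inter> {y. norm (y - (x \<bullet> y) *\<^sub>R x) < 1/2})"
      using sph[OF v(1)] v nW[OF v(1)] xy by (simp add: Tn W_def)
  next
    fix y assume y: "y \<in> sphere 0 1 \<inter> ({y. 0 < x \<bullet> y} \<inter> {y. norm (y - (x \<bullet> y) *\<^sub>R x) < 1/2})"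
    define w where "w = y - (x \<bullet> y) *\<^sub>R x"
    have w: "w \<in> ?P" by (simp add: w_def inner_diff_right xx)
    then have Tw: "T (g w) = w" "norm (g w) = norm w" using Tg g_norm by auto
    have yeq: "y = T (g w) + (x \<bullet> y) *\<^sub>R x" unfolding Tw(1) by (simp add: w_def)
    have "1 = (norm y)\<^sup>2" using y by simp
    also have "\<dots> = (norm (g w))\<^sup>2 + (x \<bullet> y)\<^sup>2" by (subst yeq) (rule norm_sq)
    finally have "(x \<bullet> y)\<^sup>2 = 1 - (norm (g w))\<^sup>2" by simp
    moreover have "sqrt ((x \<bullet> y)\<^sup>2) = x \<bullet> y" using y by simp
    ultimately have "x \<bullet> y = sqrt (1 - (norm (g w))\<^sup>2)" by simp
    then have "y = \<phi> (g w)" using yeq by (simp add: \<phi>_def)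
    moreover have "g w \<in> W" using y Tw by (simp add: W_def w_def)
    ultimately show "y \<in> \<phi> ` W" by blast
  qed
  have "open ({y. 0 < x \<bullet> y} \<inter> {y. norm (y - (x \<bullet> y) *\<^sub>R x) < 1/2})"
    by (intro open_Int open_Collect_less continuous_intros)
  then have oin: "openin (top_of_set (sphere 0 1)) (\<phi> ` W)"
    unfolding img by (auto simp: openin_open)
  have G\<phi>: "G (\<phi> v) = v" for v by (simp add: \<phi>_def GT)
  have hom: "homeomorphism W (\<phi> ` W) \<phi> G"
    unfolding homeomorphism_def
  proof (intro conjI ballI)
    show "continuous_on W \<phi>"
      unfolding \<phi>_def by (intro continuous_intros linear_continuous_on linear_linear[THEN iffD2] T)
    show "continuous_on (\<phi> ` W) G" by (intro linear_continuous_on linear_linear[THEN iffD2] linG)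
  qed (auto simp: G\<phi> image_image)
  have deriv: "((\<lambda>t. \<phi> (v + t *\<^sub>R axis i 1)) has_vector_derivative D i v) (at 0)" if v: "v \<in> W" for i v
  proof -
    have nsq: "(norm (v + t *\<^sub>R axis i 1))\<^sup>2 = (norm v)\<^sup>2 + 2 * t * v $ i + t\<^sup>2" for t :: real
      by (simp add: power2_norm_eq_inner inner_add_left inner_add_right inner_axis inner_commute[of "axis i 1"]
          inner_axis_axis algebra_simps power2_eq_square[of t])
    have eq: "\<phi> (v + t *\<^sub>R axis i 1) = (T v + t *\<^sub>R T (axis i 1)) + sqrt (1 - ((norm v)\<^sup>2 + 2 * t * v $ i + t\<^sup>2)) *\<^sub>R x" for t
      by (simp only: \<phi>_def nsq linear_add[OF T] linear_scale[OF T])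
    have "((\<lambda>t. sqrt (1 - ((norm v)\<^sup>2 + 2 * t * v $ i + t\<^sup>2))) has_real_derivative (- (v $ i * k v))) (at 0)"
      using nW[OF v] by (auto intro!: derivative_eq_intros simp: k_def field_simps)
    then have "((\<lambda>t. sqrt (1 - ((norm v)\<^sup>2 + 2 * t * v $ i + t\<^sup>2)) *\<^sub>R x) has_vector_derivative (- (v $ i * k v)) *\<^sub>R x) (at 0)"
      using has_vector_derivative_scaleR[OF _ has_vector_derivative_const[of x]] by fastforce
    moreover have "((\<lambda>t. T v + t *\<^sub>R T (axis i 1)) has_vector_derivative T (axis i 1)) (at 0)"
      by (auto intro!: derivative_eq_intros)
    ultimately show ?thesis
      unfolding eq D_def using has_vector_derivative_add by fastforce
  qed
  have lip: "2-lipschitz_on W (D i)" for i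
  proof (rule lipschitz_onI)
    fix v w assume vw: "v \<in> W" "w \<in> W"
    define \<alpha> where "\<alpha> = sqrt (1 - (norm v)\<^sup>2)"
    define \<beta> where "\<beta> = sqrt (1 - (norm w)\<^sup>2)"
    have \<alpha>\<^sub>1: "\<alpha>\<^sup>2 = 1 - (norm v)\<^sup>2" "0 \<le> \<alpha>" "\<alpha> \<le> 1" and \<beta>\<^sub>1: "\<beta>\<^sup>2 = 1 - (norm w)\<^sup>2" "0 \<le> \<beta>" "\<beta> \<le> 1"
      using nW[OF vw(1)] nW[OF vw(2)] by (auto simp: \<alpha>_def \<beta>_def)
    have "(sqrt 3 / 2)\<^sup>2 \<le> \<alpha>\<^sup>2" "(sqrt 3 / 2)\<^sup>2 \<le> \<beta>\<^sup>2"
      using nW[OF vw(1)] nW[OF vw(2)] by (auto simp: \<alpha>\<^sub>1 \<beta>\<^sub>1 power_divide)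
    then have lo: "sqrt 3 / 2 \<le> \<alpha>" "sqrt 3 / 2 \<le> \<beta>"
      using power2_le_imp_le[OF _ \<alpha>\<^sub>1(2)] power2_le_imp_le[OF _ \<beta>\<^sub>1(2)] by blast+
    have "1 \<le> sqrt (3::real)" by simp
    then have sum1: "1 \<le> \<alpha> + \<beta>" "0 < \<alpha>" "0 < \<beta>" using lo by linarith+
    have "(sqrt 3 / 2) * (sqrt 3 / 2) \<le> \<alpha> * \<beta>" using lo \<alpha>\<^sub>1 by (intro mult_mono) auto
    then have prod: "3 / 4 \<le> \<alpha> * \<beta>" by simp
    define d where "d = norm (v - w)"
    have "\<bar>\<alpha> - \<beta>\<bar> * 1 \<le> \<bar>\<alpha> - \<beta>\<bar> * (\<alpha> + \<beta>)" using sum1 by (intro mult_left_mono) auto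
    also have "\<dots> = \<bar>(\<alpha> - \<beta>) * (\<alpha> + \<beta>)\<bar>" using sum1 by (simp add: abs_mult)
    also have "(\<alpha> - \<beta>) * (\<alpha> + \<beta>) = (norm w - norm v) * (norm w + norm v)"
      using \<alpha>\<^sub>1(1) \<beta>\<^sub>1(1) by (simp add: power2_eq_square algebra_simps)
    also have "\<bar>\<dots>\<bar> = \<bar>norm w - norm v\<bar> * (norm w + norm v)" by (simp add: abs_mult)
    also have "\<dots> \<le> d * 1"
      using vw norm_triangle_ineq3[of v w] by (intro mult_mono) (auto simp: W_def d_def abs_minus_commute)
    finally have diff: "\<bar>\<alpha> - \<beta>\<bar> \<le> d" by simp
    have vi: "\<bar>v $ i - w $ i\<bar> \<le> d" using component_le_norm_cart[of "v - w" i] by (simp add: d_def)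
    have wi: "\<bar>w $ i\<bar> \<le> 1 / 2" using component_le_norm_cart[of w i] vw by (simp add: W_def)
    have "v $ i * k v - w $ i * k w = ((v $ i - w $ i) * \<beta> + w $ i * (\<beta> - \<alpha>)) / (\<alpha> * \<beta>)"
      using sum1 by (simp add: k_def \<alpha>_def[symmetric] \<beta>_def[symmetric] field_simps)
    also have "\<bar>\<dots>\<bar> = \<bar>(v $ i - w $ i) * \<beta> + w $ i * (\<beta> - \<alpha>)\<bar> / (\<alpha> * \<beta>)"
      using sum1 by (simp add: abs_divide abs_mult)
    also have "\<dots> \<le> (d * 1 + 1 / 2 * d) / (3 / 4)"
    proof (rule frac_le)
      have "\<bar>(v $ i - w $ i) * \<beta> + w $ i * (\<beta> - \<alpha>)\<bar> \<le> \<bar>v $ i - w $ i\<bar> * \<bar>\<beta>\<bar> + \<bar>w $ i\<bar> * \<bar>\<beta> - \<alpha>\<bar>"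
        by (metis abs_mult abs_triangle_ineq)
      also have "\<dots> \<le> d * 1 + 1 / 2 * d"
        using vi wi diff \<beta>\<^sub>1 sum1 by (intro add_mono mult_mono) (auto simp: d_def abs_minus_commute)
      finally show "\<bar>(v $ i - w $ i) * \<beta> + w $ i * (\<beta> - \<alpha>)\<bar> \<le> d * 1 + 1 / 2 * d" .
    qed (use prod in \<open>auto simp: d_def\<close>)
    finally have est: "\<bar>v $ i * k v - w $ i * k w\<bar> \<le> 2 * d" by simp
    have "D i v - D i w = - ((v $ i * k v - w $ i * k w) *\<^sub>R x)"
      by (simp add: D_def scaleR_diff_left)
    then have "dist (D i v) (D i w) = \<bar>v $ i * k v - w $ i * k w\<bar>"
      unfolding dist_norm by (simp add: nx)
    then show "dist (D i v) (D i w) \<le> 2 * dist v w" using est by (simp add: dist_norm d_def)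
  qed simp
  have inj: "inj (\<lambda>v :: real ^ 'm. \<Sum>i\<in>UNIV. v $ i *\<^sub>R D i u)" for u
  proof (rule inj_on_inverseI[where g = G])
    fix v :: "real ^ 'm"
    have "G (D i u) = axis i 1" for i
      using GT[of "axis i 1" "- (u $ i * k u)"] by (simp add: D_def)
    then have "G (\<Sum>i\<in>UNIV. v $ i *\<^sub>R D i u) = (\<Sum>i\<in>UNIV. v $ i *\<^sub>R axis i 1)"
      by (simp add: linear_sum[OF linG] linear_scale[OF linG])
    also have "\<dots> = v" using basis_expansion[of v] by (simp add: scalar_mult_eq_scaleR)
    finally show "G (\<Sum>i\<in>UNIV. v $ i *\<^sub>R D i u) = v" .
  qed
  have "C11_local_parametrization (sphere 0 1) W \<phi>"
    unfolding C11_local_parametrization_def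
  proof (intro conjI exI[of _ D] exI[of _ G] exI[of _ 2] allI ballI)
    show "open W" by (simp add: W_def)
  qed (use oin hom deriv lip inj in auto)
  moreover have "x \<in> \<phi> ` W"
  proof
    show "x = \<phi> 0" by (simp add: \<phi>_def linear_0[OF T])
    show "0 \<in> W" by (simp add: W_def)
  qed
  ultimately show ?thesis by blast
qed

section \<open>Measures with the same ball densities\<close>

text \<open>Integrating over \<open>\<mu>\<close> the \<open>\<nu>\<close>-mass of the ball around a point, or over \<open>\<nu>\<close> the \<open>\<mu>\<close>-mass, gives the
same number: the product measure of the pairs at distance at most \<open>r\<close>. The former is at least about
\<open>b t\<close> times the mass of \<open>\<mu>\<close>, the latter at most about \<open>a t\<close> times the mass of \<open>\<nu>\<close>.\<close>

lemma ball_density_mass_le: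
  fixes \<mu> \<nu> :: "'a::{metric_space, second_countable_topology} measure"
  assumes \<mu>: "finite_measure \<mu>" "sets \<mu> = sets borel" and \<nu>: "finite_measure \<nu>" "sets \<nu> = sets borel"
    and AE: "AE x in \<mu>. x \<in> K" "AE x in \<nu>. x \<in> K" and b: "0 < b"
    and dens: "\<And>e. 0 < e \<Longrightarrow> \<exists>r t. 0 < t \<and>
      (\<forall>x\<in>K. measure \<mu> (cball x r) \<le> (a + e) * t \<and> (b - e) * t \<le> measure \<nu> (cball x r))"
  shows "b * measure \<mu> UNIV \<le> a * measure \<nu> UNIV"
proof -
  interpret \<mu>: finite_measure \<mu> by fact
  interpret \<nu>: finite_measure \<nu> by fact
  interpret P: pair_sigma_finite \<mu> \<nu> ..
  note sp = sets_eq_imp_space_eq[OF \<mu>(2)] sets_eq_imp_space_eq[OF \<nu>(2)]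
  have ineq: "(b - e) * measure \<mu> UNIV \<le> (a + e) * measure \<nu> UNIV" if e: "0 < e" "e < b" for e
  proof -
    obtain r t where t: "0 < t" and d: "\<And>x. x \<in> K \<Longrightarrow> measure \<mu> (cball x r) \<le> (a + e) * t"
      "\<And>x. x \<in> K \<Longrightarrow> (b - e) * t \<le> measure \<nu> (cball x r)"
      using dens[OF e(1)] by blast
    define Q where "Q = {p :: 'a \<times> 'a. dist (fst p) (snd p) \<le> r}"
    have "closed Q" unfolding Q_def by (intro closed_Collect_le continuous_intros)
    then have "Q \<in> sets borel" by (rule borel_closed)
    also have "sets (borel :: ('a \<times> 'a) measure) = sets (\<mu> \<Otimes>\<^sub>M \<nu>)"
      unfolding borel_prod[symmetric] using \<mu>(2) \<nu>(2) by (intro sets_pair_measure_cong) auto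
    finally have Q: "Q \<in> sets (\<mu> \<Otimes>\<^sub>M \<nu>)" .
    have s1: "Pair x -` Q = cball x r" and s2: "(\<lambda>x. (x, y)) -` Q = cball y r" for x y
      by (auto simp: Q_def dist_commute)
    have "ennreal ((b - e) * t) * emeasure \<mu> UNIV = (\<integral>\<^sup>+x. ennreal ((b - e) * t) \<partial>\<mu>)"
      using sp by simp
    also have "\<dots> \<le> (\<integral>\<^sup>+x. emeasure \<nu> (cball x r) \<partial>\<mu>)"
    proof (rule nn_integral_mono_AE)
      show "AE x in \<mu>. ennreal ((b - e) * t) \<le> emeasure \<nu> (cball x r)"
        using AE(1) by eventually_elim (simp add: d \<nu>.emeasure_eq_measure ennreal_leI)
    qed
    also have "\<dots> = emeasure (\<mu> \<Otimes>\<^sub>M \<nu>) Q"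
      by (simp add: \<nu>.emeasure_pair_measure_alt[OF Q] s1)
    also have "\<dots> = (\<integral>\<^sup>+y. emeasure \<mu> (cball y r) \<partial>\<nu>)"
      by (simp add: P.emeasure_pair_measure_alt2[OF Q] s2)
    also have "\<dots> \<le> (\<integral>\<^sup>+y. ennreal ((a + e) * t) \<partial>\<nu>)"
    proof (rule nn_integral_mono_AE)
      show "AE y in \<nu>. emeasure \<mu> (cball y r) \<le> ennreal ((a + e) * t)"
        using AE(2) by eventually_elim (simp add: d \<mu>.emeasure_eq_measure ennreal_leI)
    qed
    also have "\<dots> = ennreal ((a + e) * t) * emeasure \<nu> UNIV" using sp by simp
    finally have le: "ennreal ((b - e) * t * measure \<mu> UNIV) \<le> ennreal ((a + e) * t) * ennreal (measure \<nu> UNIV)"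
      using e t by (simp add: \<mu>.emeasure_eq_measure \<nu>.emeasure_eq_measure ennreal_mult)
    show ?thesis
    proof (cases "0 \<le> a + e")
      case True
      with le have "(b - e) * t * measure \<mu> UNIV \<le> (a + e) * t * measure \<nu> UNIV"
        using t by (simp add: ennreal_mult[symmetric] ennreal_le_iff)
      then have "t * ((b - e) * measure \<mu> UNIV) \<le> t * ((a + e) * measure \<nu> UNIV)" by (simp add: ac_simps)
      then show ?thesis using t by (simp only: mult_le_cancel_left_pos)
    next
      case False
      have "K = {}"
      proof (rule ccontr)
        assume "K \<noteq> {}"
        then obtain x where "x \<in> K" by blast
        then have "0 \<le> (a + e) * t" using d(1) measure_nonneg order_trans by blast
        then show False using False t by (simp add: zero_le_mult_iff)
      qed
      then have "AE x in \<mu>. False" "AE x in \<nu>. False" using AE by auto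
      then have "measure \<mu> UNIV = 0" "measure \<nu> UNIV = 0"
        using sp emeasure_eq_0_AE[of "\<lambda>_. True" \<mu>] emeasure_eq_0_AE[of "\<lambda>_. True" \<nu>]
        by (simp_all add: measure_def)
      then show ?thesis by simp
    qed
  qed
  have l1: "((\<lambda>e. (b - e) * measure \<mu> UNIV) \<longlongrightarrow> (b - 0) * measure \<mu> UNIV) (at_right 0)"
    and l2: "((\<lambda>e. (a + e) * measure \<nu> UNIV) \<longlongrightarrow> (a + 0) * measure \<nu> UNIV) (at_right 0)"
    by (intro tendsto_intros)+
  have "\<forall>\<^sub>F e in at_right 0. (b - e) * measure \<mu> UNIV \<le> (a + e) * measure \<nu> UNIV"
    using b ineq by (auto simp: eventually_at_right[of 0 b] intro!: exI[of _ b])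
  from tendsto_le[OF trivial_limit_at_right_real l2 l1 this] show ?thesis by simp
qed

section \<open>The area of the sphere\<close>

text \<open>The slice of the cone at height \<open>y\<close> is a ball of radius \<open>\<tau> y\<close> in the remaining coordinates.\<close>

lemma emeasure_cone:
  fixes b :: "'a::euclidean_space"
  assumes b: "b \<in> Basis" and \<tau>: "0 < \<tau>" and h: "0 \<le> h"
  shows "emeasure lborel {y. 0 \<le> y \<bullet> b \<and> y \<bullet> b \<le> h \<and> sqrt (\<Sum>i\<in>Basis - {b}. (y \<bullet> i)\<^sup>2) \<le> \<tau> * (y \<bullet> b)} =
    ennreal (unit_ball_vol (real (DIM('a) - 1)) * \<tau> ^ (DIM('a) - 1) * h ^ DIM('a) / DIM('a))"
proof -
  define A where "A = Basis - {b}"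
  let ?m = "DIM('a) - 1"
  let ?v = "unit_ball_vol (real ?m)"
  let ?C = "{y :: 'a. 0 \<le> y \<bullet> b \<and> y \<bullet> b \<le> h \<and> sqrt (\<Sum>i\<in>A. (y \<bullet> i)\<^sup>2) \<le> \<tau> * (y \<bullet> b)}"
  let ?L = "\<lambda>A. Pi\<^sub>M A (\<lambda>_ :: 'a. lborel :: real measure)"
  let ?D = "\<lambda>y. {f. sqrt (\<Sum>i\<in>A. (f i)\<^sup>2) \<le> \<tau> * y} \<inter> space (?L A)"
  have B: "Basis = insert b A" using b by (auto simp: A_def)
  have bA: "b \<notin> A" "finite A" by (auto simp: A_def)
  have card: "card A = ?m" using b by (simp add: A_def)
  interpret product_sigma_finite "\<lambda>_ :: 'a. lborel :: real measure" by standard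
  have AB: "i \<in> Basis" if "i \<in> A" for i using that by (simp add: A_def)
  have [measurable]: "?C \<in> sets borel" by measurable
  define g :: "('a \<Rightarrow> real) \<Rightarrow> bool" where
    "g f \<longleftrightarrow> 0 \<le> f b \<and> f b \<le> h \<and> sqrt (\<Sum>i\<in>A. (f i)\<^sup>2) \<le> \<tau> * f b" for f
  let ?G = "{f. g f} \<inter> space (?L (insert b A))"
  have comp: "(\<lambda>f. f i) \<in> borel_measurable (?L (insert b A))" if "i \<in> insert b A" for i
    using measurable_component_singleton[OF that, of "\<lambda>_. lborel :: real measure"] by simp
  have rootm: "(\<lambda>f. sqrt (\<Sum>i\<in>A. (f i)\<^sup>2)) \<in> borel_measurable (?L (insert b A))"
    by (intro measurable_compose[OF _ borel_measurable_sqrt] borel_measurable_sum borel_measurable_power comp) auto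
  have bm: "(\<lambda>f. f b) \<in> borel_measurable (?L (insert b A))" by (rule comp) simp
  have gm: "{f \<in> space (?L (insert b A)). g f} \<in> sets (?L (insert b A))"
  proof -
    have "{f \<in> space (?L (insert b A)). g f} = {f \<in> space (?L (insert b A)). 0 \<le> f b} \<inter>
        ({f \<in> space (?L (insert b A)). f b \<le> h} \<inter>
         {f \<in> space (?L (insert b A)). sqrt (\<Sum>i\<in>A. (f i)\<^sup>2) \<le> \<tau> * f b})"
      by (auto simp: g_def)
    also have "\<dots> \<in> sets (?L (insert b A))"
      by (intro sets.Int borel_measurable_le borel_measurable_times borel_measurable_const rootm bm)
    finally show ?thesis .
  qed
  have pow_deriv: "((\<lambda>y. c * y ^ Suc n / real (Suc n)) has_real_derivative c * y ^ n) (at y)" for c y :: real and n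
  proof -
    have "((\<lambda>y. c * y ^ Suc n / real (Suc n)) has_real_derivative c * (real (Suc n) * y ^ n) / real (Suc n)) (at y)"
      using DERIV_cdivide[OF DERIV_cmult[OF DERIV_pow[of "Suc n" y UNIV]], of c "real (Suc n)"] by simp
    then show ?thesis by (simp del: of_nat_Suc)
  qed
  have "emeasure lborel ?C = emeasure (distr (?L Basis) borel (\<lambda>f. \<Sum>c\<in>Basis. f c *\<^sub>R c)) ?C"
    by (subst lborel_eq) simp
  also have "\<dots> = emeasure (?L Basis) ((\<lambda>f. \<Sum>c\<in>Basis. f c *\<^sub>R c) -` ?C \<inter> space (?L Basis))"
    by (rule emeasure_distr) auto
  also have "(\<lambda>f. \<Sum>c\<in>Basis. f c *\<^sub>R c) -` ?C = {f. g f}"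
    using b by (auto simp: g_def AB)
  also have "emeasure (?L Basis) ({f. g f} \<inter> space (?L Basis)) =
      emeasure (?L (insert b A)) ?G"
    unfolding B[symmetric] ..
  also have "\<dots> = (\<integral>\<^sup>+f. indicator ?G f \<partial>?L (insert b A))"
    using gm by (subst nn_integral_indicator) (simp_all add: Int_def conj_commute)
  also have "\<dots> = (\<integral>\<^sup>+y. \<integral>\<^sup>+f. indicator ?G (f(b := y)) \<partial>?L A \<partial>lborel)"
    using bA gm by (subst product_nn_integral_insert_rev) (simp_all add: Int_def conj_commute)
  also have "\<dots> = (\<integral>\<^sup>+y. \<integral>\<^sup>+f. indicator {0..h} y * indicator (?D y) f \<partial>?L A \<partial>lborel)"
  proof (intro nn_integral_cong)
    fix y :: real and f assume f: "f \<in> space (?L A)"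
    have "(\<Sum>i\<in>A. ((f(b := y)) i)\<^sup>2) = (\<Sum>i\<in>A. (f i)\<^sup>2)" using bA by (intro sum.cong) auto
    moreover have "f(b := y) \<in> space (?L (insert b A))" using f by (auto simp: space_PiM PiE_def extensional_def)
    ultimately show "indicator ?G (f(b := y)) =
        (indicator {0..h} y * indicator (?D y) f :: ennreal)"
      using f by (simp add: g_def indicator_def)
  qed
  also have "\<dots> = (\<integral>\<^sup>+y. indicator {0..h} y * emeasure (?L A) (?D y) \<partial>lborel)"
    using bA by (intro nn_integral_cong, subst nn_integral_cmult) auto
  also have "\<dots> = (\<integral>\<^sup>+y. ennreal (?v * \<tau> ^ ?m * y ^ ?m) * indicator {0..h} y \<partial>lborel)"
  proof (rule nn_integral_cong_AE)
    have "AE y in lborel. y \<noteq> (0::real)" by (rule AE_lborel_singleton)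
    then show "AE y in lborel. indicator {0..h} y * emeasure (?L A) (?D y)
        = ennreal (?v * \<tau> ^ ?m * y ^ ?m) * indicator {0..h} y"
    proof eventually_elim
      case (elim y)
      show ?case
      proof (cases "y \<in> {0..h}")
        case True
        then have "0 < \<tau> * y" using elim \<tau> by simp
        from emeasure_cball_aux[OF bA(2) this] show ?thesis
          using True by (simp add: card power_mult_distrib mult.assoc)
      qed simp
    qed
  qed
  also have "\<dots> = ennreal (?v * \<tau> ^ ?m * h ^ Suc ?m / real (Suc ?m) - ?v * \<tau> ^ ?m * 0 ^ Suc ?m / real (Suc ?m))"
  proof (rule nn_integral_FTC_Icc[where f = "\<lambda>y. ?v * \<tau> ^ ?m * y ^ ?m"
        and F = "\<lambda>y. ?v * \<tau> ^ ?m * y ^ Suc ?m / real (Suc ?m)"])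
    fix y :: real assume y: "y \<in> {0..h}"
    show "((\<lambda>y. ?v * \<tau> ^ ?m * y ^ Suc ?m / real (Suc ?m)) has_real_derivative ?v * \<tau> ^ ?m * y ^ ?m) (at y)"
      by (rule pow_deriv)
    show "0 \<le> ?v * \<tau> ^ ?m * y ^ ?m" using y \<tau> by simp
  qed (use h in auto)
  also have "Suc ?m = DIM('a)" by simp
  finally show ?thesis unfolding A_def by (simp add: zero_power)
qed

text \<open>On subsets of the unit sphere this is the volume of the part of the cone over them in the unit ball.\<close>

definition cone_measure :: "'a::euclidean_space measure" where
  "cone_measure = distr (density lborel (indicator (cball 0 1))) borel sgn"

lemma borel_measurable_sgn_vector [measurable]: "(sgn :: 'a::euclidean_space \<Rightarrow> 'a) \<in> borel_measurable borel"
  unfolding sgn_div_norm by measurable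

lemma sets_cone_measure [simp]: "sets cone_measure = sets borel"
  by (simp add: cone_measure_def)

lemma emeasure_cone_measure:
  fixes A :: "'a::euclidean_space set"
  assumes [measurable]: "A \<in> sets borel"
  shows "emeasure cone_measure A = emeasure lborel {y \<in> cball 0 1. sgn y \<in> A}"
proof -
  have *: "{y \<in> cball 0 1. sgn y \<in> A} = cball 0 1 \<inter> (sgn -` A \<inter> space borel)" by auto
  have "(sgn -` A \<inter> space borel :: 'a set) \<in> sets borel" by measurable
  then show ?thesis
    unfolding cone_measure_def * by (simp add: emeasure_distr emeasure_restricted)
qed

lemma cone_measure_UNIV: "emeasure (cone_measure :: 'a::euclidean_space measure) UNIV = ennreal (unit_ball_vol (real DIM('a)))"
proof -
  have "{y \<in> cball 0 1. sgn y \<in> UNIV} = (cball 0 1 :: 'a set)" by auto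
  then show ?thesis by (simp add: emeasure_cone_measure emeasure_cball)
qed

lemma AE_cone_measure: "AE x in cone_measure. x \<in> sphere (0 :: 'a::euclidean_space) 1"
proof -
  have "AE y in (lborel :: 'a measure). y \<noteq> 0" by (rule AE_lborel_singleton)
  then have "AE y in density lborel (indicator (cball 0 1)). sgn y \<in> sphere (0 :: 'a) 1"
    by (subst AE_density) (auto simp: norm_sgn intro!: borel_measurable_indicator)
  then show ?thesis
    unfolding cone_measure_def by (subst AE_distr_iff) auto
qed

text \<open>Isometries preserve Hausdorff measure, and hence Lebesgue measure.\<close>

lemma cone_measure_orthogonal:
  fixes f :: "real ^ 'n::finite \<Rightarrow> real ^ 'n"
  assumes f: "orthogonal_transformation f"
  shows "measure cone_measure (cball (f x) r) = measure cone_measure (cball x r)"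
proof -
  define A where "A x = {y :: real ^ 'n. y \<in> cball 0 1 \<and> sgn y \<in> cball x r}" for x
  have Ab: "A x \<in> sets borel" for x
  proof -
    have *: "A x = cball 0 1 \<inter> (sgn -` cball x r \<inter> space borel)" by (auto simp: A_def)
    have "(sgn -` cball x r \<inter> space borel :: (real ^ 'n) set) \<in> sets borel" by measurable
    then show ?thesis unfolding * by auto
  qed
  have m: "measure cone_measure (cball x r) = measure lborel (A x)" for x
    using Ab[of x] by (simp add: measure_def emeasure_cone_measure A_def)
  have lf: "linear f" using f by (rule orthogonal_transformation_linear)
  have nf: "norm (f y) = norm y" for y using f by (rule orthogonal_transformation_norm)
  have sf: "sgn (f y) = f (sgn y)" for y
    by (simp add: sgn_div_norm nf linear_scale[OF lf])
  have df: "dist (f y) (f z) = dist y z" for y z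
    by (simp add: dist_norm linear_diff[OF lf, symmetric] nf)
  have "A (f x) = f ` A x"
  proof (intro set_eqI iffI)
    fix y assume y: "y \<in> A (f x)"
    obtain z where z: "y = f z" using orthogonal_transformation_surj[OF f] by (metis surjD)
    then have "z \<in> A x" using y by (simp add: A_def nf sf df)
    then show "y \<in> f ` A x" using z by blast
  next
    fix y assume "y \<in> f ` A x"
    then show "y \<in> A (f x)" by (auto simp: A_def nf sf df)
  qed
  then have "hausdorff_outer CARD('n) (A (f x)) = hausdorff_outer CARD('n) (A x)"
    using hausdorff_outer_isometry[of "CARD('n)" f "A x"] df by simp
  then have "emeasure (hausdorff TYPE('n)) (A (f x)) = emeasure (hausdorff TYPE('n)) (A x)"
    by (simp add: emeasure_hausdorff Ab)
  then show ?thesis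
    unfolding m by (simp add: measure_def hausdorff_eq_lborel)
qed

text \<open>The cap of radius \<open>r\<close> around \<open>b\<close> consists of the unit vectors whose inner product with \<open>b\<close> is at least
\<open>\<kappa>\<close>, so the rays through it form a circular cone of slope \<open>sqrt (1 - \<kappa>\<^sup>2) / \<kappa>\<close>. The part of this
cone in the unit ball contains the flat-topped cone of height \<open>\<kappa>\<close> and lies in the one of height \<open>1\<close>.\<close>

lemma cone_measure_cap_bounds:
  fixes b :: "'a::euclidean_space"
  assumes b: "b \<in> Basis" and r: "0 < r" "r < 1"
  defines "\<kappa> \<equiv> 1 - r\<^sup>2 / 2"
  defines "V \<equiv> unit_ball_vol (real (DIM('a) - 1)) * (sqrt (1 - \<kappa>\<^sup>2) / \<kappa>) ^ (DIM('a) - 1) / DIM('a)"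
  shows "V * \<kappa> ^ DIM('a) \<le> measure cone_measure (cball b r)" "measure cone_measure (cball b r) \<le> V"
proof -
  define \<tau> where "\<tau> = sqrt (1 - \<kappa>\<^sup>2) / \<kappa>"
  have r2: "0 < r\<^sup>2" "r\<^sup>2 < 1" using r by (auto simp: power_less_one_iff)
  have \<kappa>: "0 < \<kappa>" "\<kappa> < 1" using r2 by (auto simp: \<kappa>_def)
  have \<kappa>2: "\<kappa>\<^sup>2 < 1" using \<kappa> by (simp add: power_less_one_iff)
  have \<tau>: "0 < \<tau>" using \<kappa> \<kappa>2 by (simp add: \<tau>_def)
  have \<tau>2: "\<tau>\<^sup>2 * \<kappa>\<^sup>2 = 1 - \<kappa>\<^sup>2" using \<kappa> \<kappa>2 by (simp add: \<tau>_def power_divide)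
  have nb: "norm b = 1" using b by simp
  define R where "R y = (\<Sum>i\<in>Basis - {b}. (y \<bullet> i)\<^sup>2)" for y :: 'a
  have R: "(norm y)\<^sup>2 = (y \<bullet> b)\<^sup>2 + R y" for y
    unfolding R_def power2_norm_eq_inner euclidean_inner[of y y] power2_eq_square[symmetric]
    using b by (simp add: sum.remove)
  have R0: "0 \<le> R y" for y by (simp add: R_def sum_nonneg)
  define C where "C h = {y :: 'a. 0 \<le> y \<bullet> b \<and> y \<bullet> b \<le> h \<and> sqrt (R y) \<le> \<tau> * (y \<bullet> b)}" for h
  define A where "A = {y :: 'a. y \<in> cball 0 1 \<and> sgn y \<in> cball b r}"
  have slope: "sqrt (R y) \<le> \<tau> * (y \<bullet> b) \<longleftrightarrow> \<kappa> * norm y \<le> y \<bullet> b" if yb: "0 \<le> y \<bullet> b" for y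
  proof -
    have "sqrt (R y) \<le> \<tau> * (y \<bullet> b) \<longleftrightarrow> R y \<le> (\<tau> * (y \<bullet> b))\<^sup>2"
      using R0 yb \<tau> by (intro real_sqrt_le_iff') auto
    also have "\<dots> \<longleftrightarrow> \<kappa>\<^sup>2 * R y \<le> \<kappa>\<^sup>2 * (\<tau> * (y \<bullet> b))\<^sup>2"
      using \<kappa> by (simp add: mult_le_cancel_left_pos)
    also have "\<kappa>\<^sup>2 * (\<tau> * (y \<bullet> b))\<^sup>2 = (1 - \<kappa>\<^sup>2) * (y \<bullet> b)\<^sup>2"
      unfolding \<tau>2[symmetric] by (simp add: power_mult_distrib)
    also have "\<kappa>\<^sup>2 * R y \<le> (1 - \<kappa>\<^sup>2) * (y \<bullet> b)\<^sup>2 \<longleftrightarrow> (\<kappa> * norm y)\<^sup>2 \<le> (y \<bullet> b)\<^sup>2"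
      by (simp add: power_mult_distrib R algebra_simps)
    also have "\<dots> \<longleftrightarrow> \<kappa> * norm y \<le> y \<bullet> b"
      using \<kappa> yb by (intro power_mono_iff) auto
    finally show ?thesis .
  qed
  have sgn_iff: "sgn y \<in> cball b r \<longleftrightarrow> \<kappa> * norm y \<le> y \<bullet> b" if "y \<noteq> 0" for y
  proof -
    have "dist b (sgn y) \<le> r \<longleftrightarrow> (dist b (sgn y))\<^sup>2 \<le> r\<^sup>2"
      using r by (subst power_mono_iff) auto
    also have "(dist b (sgn y))\<^sup>2 = (norm b)\<^sup>2 + (norm (sgn y))\<^sup>2 - 2 * (b \<bullet> sgn y)"
      unfolding dist_norm power2_norm_eq_inner by (simp add: inner_diff_left inner_diff_right inner_commute)
    also have "\<dots> = 2 - 2 * ((y \<bullet> b) / norm y)"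
      using that nb by (simp add: norm_sgn) (simp add: sgn_div_norm inner_commute divide_inverse mult.commute)
    also have "2 - 2 * ((y \<bullet> b) / norm y) \<le> r\<^sup>2 \<longleftrightarrow> \<kappa> \<le> (y \<bullet> b) / norm y"
      by (auto simp: \<kappa>_def)
    also have "\<dots> \<longleftrightarrow> \<kappa> * norm y \<le> y \<bullet> b" using that by (simp add: pos_le_divide_eq)
    finally show ?thesis by simp
  qed
  have A1: "C \<kappa> - {0} \<subseteq> A"
  proof
    fix y assume y: "y \<in> C \<kappa> - {0}"
    then have k: "\<kappa> * norm y \<le> y \<bullet> b" using slope by (auto simp: C_def)
    also have "\<dots> \<le> \<kappa> * 1" using y by (simp add: C_def)
    finally have "norm y \<le> 1" using \<kappa> by (simp only: mult_le_cancel_left_pos)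
    then show "y \<in> A" using k y sgn_iff by (auto simp: A_def)
  qed
  have A2: "A \<subseteq> C 1"
  proof
    fix y assume y: "y \<in> A"
    have "y \<noteq> 0" using y r nb by (auto simp: A_def)
    then have k: "\<kappa> * norm y \<le> y \<bullet> b" using y sgn_iff by (auto simp: A_def)
    moreover have "0 \<le> \<kappa> * norm y" using \<kappa> by simp
    ultimately have "0 \<le> y \<bullet> b" by linarith
    moreover have "y \<bullet> b \<le> 1" using y Cauchy_Schwarz_ineq2[of y b] nb by (auto simp: A_def)
    ultimately show "y \<in> C 1" using k slope by (auto simp: C_def)
  qed
  have Cb: "C h \<in> sets borel" for h unfolding C_def R_def by measurable
  have Ab: "A \<in> sets borel"
  proof -
    have *: "A = cball 0 1 \<inter> (sgn -` cball b r \<inter> space borel)" by (auto simp: A_def)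
    have "(sgn -` cball b r \<inter> space borel :: 'a set) \<in> sets borel" by measurable
    then show ?thesis unfolding * by auto
  qed
  have em: "emeasure lborel (C h) = ennreal (V * h ^ DIM('a))" if "0 \<le> h" for h
    using emeasure_cone[OF b \<tau> that] by (simp add: C_def R_def V_def \<tau>_def)
  have V: "0 \<le> V" using \<kappa> \<kappa>2 by (simp add: V_def)
  have eA: "emeasure cone_measure (cball b r) = emeasure lborel A"
    by (simp add: emeasure_cone_measure A_def)
  have up: "emeasure lborel A \<le> ennreal V"
    using emeasure_mono[OF A2, of lborel] Cb em[of 1] by simp
  then have fin: "emeasure lborel A = ennreal (measure cone_measure (cball b r))"
    using eA by (metis emeasure_eq_ennreal_measure ennreal_less_top le_less_trans less_irrefl)
  show "measure cone_measure (cball b r) \<le> V"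
    using up V unfolding fin by (simp add: ennreal_le_iff)
  have "ennreal (V * \<kappa> ^ DIM('a)) = emeasure lborel (C \<kappa> - {0})"
    using em[of \<kappa>] \<kappa> Cb emeasure_Diff_null_set[OF countable_imp_null_set_lborel[of "{0}"], of "C \<kappa>"] by simp
  also have "\<dots> \<le> emeasure lborel A"
    using emeasure_mono[OF A1, of lborel] Ab by simp
  finally show "V * \<kappa> ^ DIM('a) \<le> measure cone_measure (cball b r)"
    unfolding fin by (simp add: ennreal_le_iff)
qed

text \<open>By rotation it suffices to consider the caps around one point of the sphere. There the slope of the
cone is \<open>r\<close> times a factor that tends to \<open>1\<close>.\<close>

lemma cone_measure_density:
  assumes card: "CARD('n::finite) = CARD('m::finite) + 1" and e: "0 < e"
  shows "\<exists>r0>0. \<forall>r. 0 < r \<and> r < r0 \<longrightarrow> (\<forall>x\<in>sphere (0 :: real ^ 'n) 1.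
    \<bar>measure cone_measure (cball x r) / r ^ CARD('m) - unit_ball_vol (real CARD('m)) / real CARD('n)\<bar> < e)"
proof -
  let ?m = "CARD('m)" and ?n = "CARD('n)"
  let ?v = "unit_ball_vol (real ?m)"
  obtain k :: 'n where True by simp
  define b where "b = (axis k 1 :: real ^ 'n)"
  have b: "b \<in> Basis" "norm b = 1" by (auto simp: b_def axis_in_Basis_iff)
  have m: "?n - 1 = ?m" "?n = Suc ?m" using card by auto
  define \<kappa> where "\<kappa> r = 1 - r\<^sup>2 / 2" for r :: real
  define q where "q r = (sqrt (1 - r\<^sup>2 / 4) / \<kappa> r) ^ ?m" for r
  have slope: "(sqrt (1 - (\<kappa> r)\<^sup>2) / \<kappa> r) ^ ?m = r ^ ?m * q r" if "0 < r" for r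
  proof -
    have "1 - (\<kappa> r)\<^sup>2 = r\<^sup>2 * (1 - r\<^sup>2 / 4)" by (simp add: \<kappa>_def power2_eq_square field_simps)
    then have "sqrt (1 - (\<kappa> r)\<^sup>2) = r * sqrt (1 - r\<^sup>2 / 4)" using that by (simp add: real_sqrt_mult)
    then show ?thesis by (simp add: q_def power_mult_distrib power_divide)
  qed
  have bounds: "?v / ?n * q r * \<kappa> r ^ ?n \<le> measure cone_measure (cball b r) / r ^ ?m"
    "measure cone_measure (cball b r) / r ^ ?m \<le> ?v / ?n * q r" if r: "0 < r" "r < 1" for r
  proof -
    have D: "DIM(real ^ 'n) = ?n" by simp
    have "?v * (r ^ ?m * q r) / ?n * \<kappa> r ^ ?n \<le> measure cone_measure (cball b r)"
      "measure cone_measure (cball b r) \<le> ?v * (r ^ ?m * q r) / ?n"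
      using cone_measure_cap_bounds[OF b(1) r] unfolding \<kappa>_def[symmetric] D m(1) slope[OF r(1)] by auto
    then show "?v / ?n * q r * \<kappa> r ^ ?n \<le> measure cone_measure (cball b r) / r ^ ?m"
      "measure cone_measure (cball b r) / r ^ ?m \<le> ?v / ?n * q r"
      using r by (simp_all add: pos_le_divide_eq pos_divide_le_eq ac_simps)
  qed
  have lim: "((\<lambda>r. ?v / ?n * q r * \<kappa> r ^ ?n) \<longlongrightarrow> ?v / ?n * ((sqrt (1 - 0\<^sup>2 / 4) / (1 - 0\<^sup>2 / 2)) ^ ?m) * (1 - 0\<^sup>2 / 2) ^ ?n) (at_right 0)"
    "((\<lambda>r. ?v / ?n * q r) \<longlongrightarrow> ?v / ?n * ((sqrt (1 - 0\<^sup>2 / 4) / (1 - 0\<^sup>2 / 2)) ^ ?m)) (at_right 0)"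
    unfolding q_def \<kappa>_def by (intro tendsto_intros; simp)+
  have "\<forall>\<^sub>F r in at_right 0. ?v / ?n - e < ?v / ?n * q r * \<kappa> r ^ ?n"
    by (rule order_tendstoD(1)[OF lim(1)]) (use e in simp)
  moreover have "\<forall>\<^sub>F r in at_right 0. ?v / ?n * q r < ?v / ?n + e"
    by (rule order_tendstoD(2)[OF lim(2)]) (use e in simp)
  moreover have "\<forall>\<^sub>F r in at_right 0. (0::real) < r \<and> r < 1"
    by (auto simp: eventually_at_right[of 0 1] intro!: exI[of _ 1])
  ultimately have "\<forall>\<^sub>F r in at_right 0. \<bar>measure cone_measure (cball b r) / r ^ ?m - ?v / ?n\<bar> < e"
  proof eventually_elim
    case (elim r)
    then show ?case using bounds[of r] by (simp add: abs_less_iff)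
  qed
  then obtain r0 where r0: "0 < r0" "\<And>r. 0 < r \<Longrightarrow> r < r0 \<Longrightarrow>
      \<bar>measure cone_measure (cball b r) / r ^ ?m - ?v / ?n\<bar> < e"
    by (auto simp: eventually_at_right[of 0 1])
  have "measure cone_measure (cball x r) = measure cone_measure (cball b r)" if "x \<in> sphere 0 1" for x :: "real ^ 'n" and r
  proof -
    have nx: "norm x = 1" using that by simp
    obtain f where "orthogonal_transformation f" "f b = x"
      using orthogonal_transformation_exists_1[OF b(2) nx] by blast
    then show ?thesis using cone_measure_orthogonal[of f b r] by simp
  qed
  then show ?thesis using r0 by (intro exI[of _ r0]) auto
qed

lemma sphere_flat:
  assumes card: "CARD('n::finite) = CARD('m::finite) + 1"
  shows "asymptotically_flat_regular TYPE('m) (sphere (0 :: real ^ 'n) 1)"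
proof (rule C11_asymptotically_flat)
  show "sphere (0 :: real ^ 'n) 1 \<noteq> {}" by simp
qed (use sphere_graph_chart[OF card] in auto)

text \<open>The ball densities of the Hausdorff measure and of \<^const>\<open>cone_measure\<close> on the sphere are in the
ratio \<open>n\<close> to \<open>1\<close>, hence so are the total masses, and that of \<^const>\<open>cone_measure\<close> is the volume of
the unit ball.\<close>

theorem hausdorff_sphere:
  assumes card: "CARD('n::finite) = CARD('m::finite) + 1"
  shows "measure (hausdorff TYPE('m)) (sphere (0 :: real ^ 'n) 1) =
    real CARD('n) * unit_ball_vol (real CARD('n))"
proof -
  let ?C = "cone_measure :: (real ^ 'n) measure"
  let ?S = "sphere (0 :: real ^ 'n) 1" and ?H = "hausdorff TYPE('m) :: (real ^ 'n) measure"
  let ?m = "CARD('m)" and ?n = "CARD('n)"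
  let ?v = "unit_ball_vol (real ?m)"
  have v: "0 < ?v" by simp
  have fin: "emeasure ?H ?S < \<infinity>" and lim: "uniform_limit ?S
       (\<lambda>r x. measure ?H (cball x r \<inter> ?S) / r ^ ?m) (\<lambda>_. ?v) (at_right 0)"
    using sphere_flat[OF card] by (auto simp: asymptotically_flat_regular_def)
  define \<mu> where "\<mu> = density ?H (indicator ?S)"
  have sets\<mu>: "sets \<mu> = sets borel" by (simp add: \<mu>_def)
  have em: "emeasure \<mu> A = emeasure ?H (A \<inter> ?S)" if "A \<in> sets borel" for A
    using that by (simp add: \<mu>_def emeasure_restricted Int_commute)
  have \<mu>m: "measure \<mu> A = measure ?H (A \<inter> ?S)" if "A \<in> sets borel" for A
    using em[OF that] by (simp add: measure_def)
  have sp: "space \<mu> = UNIV" using sets_eq_imp_space_eq[OF sets\<mu>] by simp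
  have fm: "finite_measure \<mu>"
    using fin em[of UNIV] by (intro finite_measureI) (simp add: sp)
  have AE\<mu>: "AE x in \<mu>. x \<in> ?S"
    unfolding \<mu>_def by (subst AE_density) (auto intro!: borel_measurable_indicator AE_I2 split: split_indicator)
  have sp\<nu>: "space ?C = UNIV"
    using sets_eq_imp_space_eq[OF sets_cone_measure] by simp
  have f\<nu>: "finite_measure ?C"
    by (intro finite_measureI) (simp add: sp\<nu> cone_measure_UNIV)
  have "\<exists>r t. 0 < t \<and> (\<forall>x\<in>?S. (measure \<mu> (cball x r) \<le> (?v + e) * t \<and> (?v - e) * t \<le> measure \<mu> (cball x r)) \<and>
     (measure ?C (cball x r) \<le> (?v / ?n + e) * t \<and> (?v / ?n - e) * t \<le> measure ?C (cball x r)))"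
    if e: "0 < e" for e
  proof -
    obtain r1 where r1: "0 < r1" "\<And>r x. 0 < r \<Longrightarrow> r < r1 \<Longrightarrow> x \<in> ?S \<Longrightarrow>
        \<bar>measure ?C (cball x r) / r ^ ?m - ?v / ?n\<bar> < e"
      using cone_measure_density[OF card e] by blast
    have "\<forall>\<^sub>F r in at_right 0. \<forall>x\<in>?S. dist (measure ?H (cball x r \<inter> ?S) / r ^ ?m) ?v < e"
      by (rule uniform_limitD[OF lim e])
    then obtain r2 where r2: "0 < r2" "\<And>r x. 0 < r \<Longrightarrow> r < r2 \<Longrightarrow> x \<in> ?S \<Longrightarrow>
        \<bar>measure ?H (cball x r \<inter> ?S) / r ^ ?m - ?v\<bar> < e"
      unfolding dist_real_def by (auto simp: eventually_at_right[of 0 1])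
    define r where "r = min r1 r2 / 2"
    have r: "0 < r" "r < r1" "r < r2" using r1(1) r2(1) by (auto simp: r_def)
    have *: "y \<le> (a + e) * r ^ ?m \<and> (a - e) * r ^ ?m \<le> y" if "\<bar>y / r ^ ?m - a\<bar> < e" for y a
    proof -
      have "y / r ^ ?m \<le> a + e" "a - e \<le> y / r ^ ?m" using that by (auto simp: abs_less_iff)
      then show ?thesis using r by (simp add: pos_le_divide_eq pos_divide_le_eq)
    qed
    show ?thesis
    proof (rule exI[of _ r], rule exI[of _ "r ^ ?m"], intro conjI ballI)
      fix x assume x: "x \<in> ?S"
      note * [OF r1(2)[OF r(1,2) x]] * [OF r2(2)[OF r(1,3) x]]
      then show "measure \<mu> (cball x r) \<le> (?v + e) * r ^ ?m" "(?v - e) * r ^ ?m \<le> measure \<mu> (cball x r)"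
        "measure ?C (cball x r) \<le> (?v / ?n + e) * r ^ ?m" "(?v / ?n - e) * r ^ ?m \<le> measure ?C (cball x r)"
        by (auto simp: \<mu>m)
    qed (use r in simp)
  qed
  note dens = this
  have le1: "?v / ?n * measure \<mu> UNIV \<le> ?v * measure ?C UNIV"
  proof (rule ball_density_mass_le[OF fm sets\<mu> f\<nu> sets_cone_measure AE\<mu> AE_cone_measure])
    show "\<exists>r t. 0 < t \<and> (\<forall>x\<in>?S. measure \<mu> (cball x r) \<le> (?v + e) * t \<and> (?v / ?n - e) * t \<le> measure ?C (cball x r))"
      if "0 < e" for e using dens[OF that] by blast
  qed (use v in simp)
  have le2: "?v * measure ?C UNIV \<le> ?v / ?n * measure \<mu> UNIV"
  proof (rule ball_density_mass_le[OF f\<nu> sets_cone_measure fm sets\<mu> AE_cone_measure AE\<mu>])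
    show "\<exists>r t. 0 < t \<and> (\<forall>x\<in>?S. measure ?C (cball x r) \<le> (?v / ?n + e) * t \<and> (?v - e) * t \<le> measure \<mu> (cball x r))"
      if "0 < e" for e using dens[OF that] by blast
  qed (use v in simp)
  have "measure ?C UNIV = unit_ball_vol (real ?n)"
    by (simp add: measure_def cone_measure_UNIV)
  with le1 le2 have "?v / ?n * measure \<mu> UNIV = ?v * unit_ball_vol (real ?n)" by simp
  then have "measure \<mu> UNIV = real ?n * unit_ball_vol (real ?n)"
    using v by (simp add: field_simps)
  then show ?thesis using \<mu>m[of UNIV] by simp
qed

lemma sphere_area_Gamma:
  fixes d :: real
  assumes "0 < d"
  shows "(d + 1) * unit_ball_vol (d + 1) / unit_ball_vol d = 2 * sqrt pi * Gamma ((d + 2) / 2) / Gamma ((d + 1) / 2)"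
proof -
  define g where "g = Gamma ((d + 1) / 2)"
  define x where "x = Gamma ((d + 2) / 2)"
  define P where "P = pi powr (d / 2)"
  have g: "0 < g" and x: "0 < x" and P: "0 < P" using assms by (simp_all add: g_def x_def P_def)
  have G: "Gamma ((d + 1) / 2 + 1) = (d + 1) / 2 * g"
    unfolding g_def using assms by (intro Gamma_plus1) (auto simp: nonpos_Ints_def)
  have "pi powr ((d + 1) / 2) = P * sqrt pi"
    by (simp add: P_def add_divide_distrib powr_add powr_half_sqrt)
  then have 1: "unit_ball_vol (d + 1) = P * sqrt pi / ((d + 1) / 2 * g)"
    unfolding unit_ball_vol_def G by simp
  have half: "d / 2 + 1 = (d + 2) / 2" by (simp add: add_divide_distrib)
  have 2: "unit_ball_vol d = P / x"
    unfolding unit_ball_vol_def P_def x_def half ..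
  show ?thesis
    unfolding 1 2 g_def[symmetric] x_def[symmetric] using assms g x P by (simp add: divide_simps)
qed

theorem sphere_covering_radius:
  fixes p :: real
  assumes card: "CARD('n::finite) = CARD('m::finite) + 1" and p: "0 < p"
  defines "d \<equiv> real CARD('m)"
  shows "(\<lambda>N. expected_covering_radius_powr TYPE('m) (sphere (0 :: real ^ 'n) 1) p N *
      (real N / ln (real N)) powr (p / d))
    \<longlonglongrightarrow> ((d + 1) * unit_ball_vol (d + 1) / unit_ball_vol d) powr (p / d)"
  using flat_covering_radius[OF sphere_flat[OF card] p]
  unfolding hausdorff_sphere[OF card] by (simp add: card add.commute d_def)

theorem corollary3p3:
  shows
    "(CARD('s::finite) \<le> CARD('d::finite) \<longrightarrow>
       (\<forall>K :: (real ^ 'd) set. closed_C11_submanifold TYPE('s) K \<longrightarrow>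
          asymptotically_flat_regular TYPE('s) K \<and>
          (\<forall>p\<ge>1.
             (\<lambda>N. expected_covering_radius_powr TYPE('s) K p N *
                   (real N / ln (real N)) powr (p / real CARD('s)))
             \<longlonglongrightarrow> (measure (hausdorff TYPE('s)) K / unit_ball_vol (real CARD('s)))
                     powr (p / real CARD('s)))))
     \<and>
     (CARD('n::finite) = CARD('m::finite) + 1 \<longrightarrow>
       (let d = real CARD('m); S = sphere (0 :: real ^ 'n) 1 in
          (\<forall>p\<ge>1.
             (\<lambda>N. expected_covering_radius_powr TYPE('m) S p N * (real N / ln (real N)) powr (p / d))
             \<longlonglongrightarrow> ((d + 1) * unit_ball_vol (d + 1) / unit_ball_vol d) powr (p / d) \<and>
             ((d + 1) * unit_ball_vol (d + 1) / unit_ball_vol d) powr (p / d) =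
               (2 * sqrt pi * Gamma ((d + 2) / 2) / Gamma ((d + 1) / 2)) powr (p / d)) \<and>
          (\<lambda>N. expected_covering_radius_powr TYPE('m) S 1 N * (real N / ln (real N)) powr (1 / d))
          \<longlonglongrightarrow> ((d + 1) * unit_ball_vol (d + 1) / unit_ball_vol d) powr (1 / d)))"
proof (intro conjI impI allI, goal_cases)
  case (1 K)
  then show ?case
    by (intro C11_asymptotically_flat) (auto simp: closed_C11_submanifold_def)
next
  case (2 K p)
  then have "asymptotically_flat_regular TYPE('s) K"
    by (intro C11_asymptotically_flat) (auto simp: closed_C11_submanifold_def)
  with 2 show ?case
    by (intro flat_covering_radius) auto
next
  case 3
  then show ?case
    unfolding Let_def
    by (intro conjI allI impI sphere_covering_radius[OF 3]) (simp_all add: sphere_area_Gamma)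
qed

end
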